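(* Let $p\le q$ be positive integers with $\gcd(p,q)=1$. Then, for $n\gg1$ (with $p,q$ fixed), $$M^{I}(p,q,n)\;\ge\;\frac{3}{2}\,n^2+O(n).$$ In particular, if $p=1$, then $$M^{I}(1,q,n)\;\ge\;2\,n^2+O(n).$$
   Context: Consider planar systems $$\dot x=px+P(x,y),\qquad \dot y=-qy+Q(x,y),$$ where $P,Q$ are general (not necessarily homogeneous) polynomials of degree $n$ over $\mathbb R$ or $\mathbb C$ without constant and linear terms, and $p\le q$ are positive integers with $\gcd(p,q)=1$. There is a formal change of coordinates $X=x+\sum_{i+j\ge2}\varphi_{i,j}x^iy^j$, $Y=y+\sum_{i+j\ge2}\psi_{i,j}x^iy^j$ bringing the system to the formal normal form $$\dot X=pX\Bigl(1+\sum_{k\ge1}\pi_{1,k}(X^qY^p)^k\Bigr),\qquad \dot Y=-qY\Bigl(1+\sum_{k\ge1}\pi_{2,k}(X^qY^p)^k\Bigr).$$ The change is taken in the standard normalization without resonant terms, i.e. $\varphi_{1+kq,kp}=\psi_{kq,1+kp}=0$ for all $k\ge1$, so that it is unique. The $k$-th saddle value is $L_k=\pi_{1,k}-\pi_{2,k}$; it is a polynomial in the coefficients of $P$ and $Q$. Regard the coefficients of $P$ and $Q$ (of all monomials $x^iy^j$, $2\le i+j\le n$) as indeterminates, and work in the ring of polynomials in these coefficients over $\mathbb R$ (or $\mathbb C$). Let $I_k$ be the ideal generated by $L_1,\dots,L_k$, and $I_\infty$ the ideal generated by all $L_k$, $k\ge1$. $M^I(p,q,n)$ is the minimal number $M$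 such that $I_M=I_\infty$ (finite by Hilbert's Basis Theorem); equivalently, it is the maximal $k$ such that $L_k\notin I_{k-1}$. *)

theory Defs
  imports
    Complex_Main
    "HOL-Library.Poly_Mapping"
    "HOL-Library.Landau_Symbols"
    "HOL-Computational_Algebra.Formal_Power_Series"
    "HOL-Algebra.Ideal"
begin

unbundle fps_syntax

text \<open>\<open>CoeffP i j\<close> and \<open>CoeffQ i j\<close> are the indeterminates standing for the coefficients
  of \<open>x ^ i * y ^ j\<close> in \<open>P\<close> and in \<open>Q\<close>.\<close>

datatype coeff_var = CoeffP nat nat | CoeffQ nat nat

type_synonym 'a coeff_poly = "(coeff_var \<Rightarrow>\<^sub>0 nat) \<Rightarrow>\<^sub>0 'a"

definition indet :: "coeff_var \<Rightarrow> 'a::field_char_0 coeff_poly" where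
  "indet v = Poly_Mapping.single (Poly_Mapping.single v 1) 1"

definition coeff_vars :: "nat \<Rightarrow> coeff_var set" where
  "coeff_vars n = {CoeffP i j | i j. 2 \<le> i + j \<and> i + j \<le> n} \<union>
                  {CoeffQ i j | i j. 2 \<le> i + j \<and> i + j \<le> n}"

text \<open>The type \<open>'a coeff_poly\<close> has infinitely many indeterminates; the carrier cuts it down to
  the finitely many in \<open>coeff_vars n\<close>.\<close>

definition coeff_ring :: "nat \<Rightarrow> 'a::field_char_0 coeff_poly ring" where
  "coeff_ring n =
     \<lparr>carrier = {f. \<forall>m \<in> Poly_Mapping.keys f. Poly_Mapping.keys m \<subseteq> coeff_vars n},
      mult = (*), one = 1, zero = 0, add = (+)\<rparr>"

text \<open>Formal power series in \<open>x, y\<close> over \<open>'b\<close> are elements of \<open>'b fps fps\<close>: the coefficient of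
  \<open>x ^ i * y ^ j\<close> in \<open>F\<close> is \<open>F $ i $ j\<close>.\<close>

definition series2 :: "(nat \<Rightarrow> nat \<Rightarrow> 'b) \<Rightarrow> 'b fps fps" where
  "series2 c = Abs_fps (\<lambda>i. Abs_fps (\<lambda>j. c i j))"

definition var_x :: "'b::comm_ring_1 fps fps" where
  "var_x = fps_X"

definition var_y :: "'b::comm_ring_1 fps fps" where
  "var_y = fps_const fps_X"

definition deriv_x :: "'b::comm_ring_1 fps fps \<Rightarrow> 'b fps fps" where
  "deriv_x F = fps_deriv F"

definition deriv_y :: "'b::comm_ring_1 fps fps \<Rightarrow> 'b fps fps" where
  "deriv_y F = Abs_fps (\<lambda>i. fps_deriv (F $ i))"

text \<open>\<open>resonant_sum c Z\<close> is the sum of \<open>c k * Z ^ k\<close> over all \<open>k \<ge> 1\<close>, for \<open>Z\<close> without constant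
  term. Then \<open>Z ^ k\<close> has order at least \<open>k\<close>, so only \<open>k \<le> i + j\<close> contribute to the coefficient
  of \<open>x ^ i * y ^ j\<close>. (\<open>fps_compose\<close> does not apply: it would need \<open>x\<close> to divide \<open>Z\<close>.)\<close>

definition resonant_sum :: "(nat \<Rightarrow> 'b::comm_ring_1) \<Rightarrow> 'b fps fps \<Rightarrow> 'b fps fps" where
  "resonant_sum c Z = series2 (\<lambda>i j. \<Sum>k = 1..i + j. c k * ((Z ^ k) $ i $ j))"

text \<open>The change \<open>X = x + \<phi>, Y = y + \<psi>\<close>, without resonant terms, brings the system
  \<open>x' = p * x + P, y' = - q * y + Q\<close> to the normal form given by \<open>\<pi>1, \<pi>2\<close> (whose values at
  \<open>0\<close> are irrelevant). The last two equations equate the derivatives of \<open>X, Y\<close> along the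
  original system with the right-hand sides of the normal form.\<close>

definition normalizes ::
  "nat \<Rightarrow> nat \<Rightarrow> 'b::comm_ring_1 fps fps \<Rightarrow> 'b fps fps \<Rightarrow>
   (nat \<Rightarrow> nat \<Rightarrow> 'b) \<Rightarrow> (nat \<Rightarrow> nat \<Rightarrow> 'b) \<Rightarrow> (nat \<Rightarrow> 'b) \<Rightarrow> (nat \<Rightarrow> 'b) \<Rightarrow> bool" where
  "normalizes p q P Q \<phi> \<psi> \<pi>1 \<pi>2 \<longleftrightarrow>
     (\<forall>i j. i + j < 2 \<longrightarrow> \<phi> i j = 0 \<and> \<psi> i j = 0) \<and>
     (\<forall>k\<ge>1. \<phi> (1 + k * q) (k * p) = 0 \<and> \<psi> (k * q) (1 + k * p) = 0) \<and>
     (let X = var_x + series2 \<phi>;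
          Y = var_y + series2 \<psi>;
          F = of_nat p * var_x + P;
          G = - of_nat q * var_y + Q
      in deriv_x X * F + deriv_y X * G
           = of_nat p * X * (1 + resonant_sum \<pi>1 (X ^ q * Y ^ p)) \<and>
         deriv_x Y * F + deriv_y Y * G
           = - of_nat q * Y * (1 + resonant_sum \<pi>2 (X ^ q * Y ^ p)))"

definition general_P :: "nat \<Rightarrow> 'a::field_char_0 coeff_poly fps fps" where
  "general_P n = series2 (\<lambda>i j. if 2 \<le> i + j \<and> i + j \<le> n then indet (CoeffP i j) else 0)"

definition general_Q :: "nat \<Rightarrow> 'a::field_char_0 coeff_poly fps fps" where
  "general_Q n = series2 (\<lambda>i j. if 2 \<le> i + j \<and> i + j \<le> n then indet (CoeffQ i j) else 0)"

text \<open>The normalization is carried out with indeterminate coefficients, which is possible in the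
  polynomial ring itself because only nonzero integers occur as denominators. For positive coprime
  \<open>p, q\<close> it is unique, so the description below is proper for \<open>k \<ge> 1\<close>.\<close>

definition saddle_value :: "nat \<Rightarrow> nat \<Rightarrow> nat \<Rightarrow> nat \<Rightarrow> 'a::field_char_0 coeff_poly" where
  "saddle_value p q n k =
     (THE L. \<exists>\<phi> \<psi> \<pi>1 \<pi>2. normalizes p q (general_P n) (general_Q n) \<phi> \<psi> \<pi>1 \<pi>2 \<and>
                          L = \<pi>1 k - \<pi>2 k)"

definition saddle_ideal :: "nat \<Rightarrow> nat \<Rightarrow> nat \<Rightarrow> nat \<Rightarrow> 'a::field_char_0 coeff_poly set" where
  "saddle_ideal p q n m = Idl\<^bsub>coeff_ring n\<^esub> (saddle_value p q n ` {1..m})"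

definition saddle_ideal_inf :: "nat \<Rightarrow> nat \<Rightarrow> nat \<Rightarrow> 'a::field_char_0 coeff_poly set" where
  "saddle_ideal_inf p q n = Idl\<^bsub>coeff_ring n\<^esub> (saddle_value p q n ` {1..})"

text \<open>The minimum exists by Hilbert's basis theorem. The first argument selects the ground field.\<close>

definition M_I :: "'a::field_char_0 itself \<Rightarrow> nat \<Rightarrow> nat \<Rightarrow> nat \<Rightarrow> nat" where
  "M_I _ p q n =
     (LEAST M. (saddle_ideal p q n M :: 'a coeff_poly set) = saddle_ideal_inf p q n)"

end

theory Submission
  imports Defs
begin

text \<open>
  Write \<open>r = (q, p)\<close> and \<open>f = 1 + x\<^sup>u + x\<^sup>v\<close> for exponents \<open>u, v \<in> \<nat>\<^sup>2\<close>. The polynomial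
  field with components \<open>x (p f + \<lambda> y f\<^sub>y)\<close>, \<open>- y (q f + \<lambda> x f\<^sub>x)\<close> has the first integral
  \<open>H = x\<^sup>q y\<^sup>p f\<^sup>\<lambda>\<close>, so all its saddle values vanish. Add \<open>\<epsilon> x\<^sup>w x\<close> to the first component, with
  \<open>\<epsilon>\<^sup>2 = 0\<close>. The first nonzero saddle value of the perturbed field is then \<open>\<epsilon>\<close> times the first
  nonzero Melnikov coefficient, which is a residue: up to a nonzero factor, \<open>M\<^sub>k\<close> is the coefficient
  of \<open>x\<close> to the power \<open>k r - w\<close> in \<open>f\<close> to the power \<open>- \<lambda> k - 1\<close>. It vanishes unless
  \<open>k r - w\<close> lies in the semigroup generated by \<open>u, v\<close>.

  Take \<open>u = (N, a)\<close>, \<open>v = (b, N)\<close> with \<open>p\<^sup>2 b - q\<^sup>2 a = 1\<close>. Then \<open>r\<close> generates \<open>\<int>\<^sup>2 / (\<int>u + \<int>v)\<close>,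
  which has order \<open>D = N\<^sup>2 - a b\<close>. With \<open>w = u + v - m r\<close> the semigroup condition forces
  \<open>k = j D - m\<close> with \<open>j \<ge> 1\<close>. The choice \<open>\<lambda> = - 2 / (D - m)\<close> makes the exponent of \<open>f\<close> equal to
  \<open>1\<close> at \<open>k = D - m\<close>, where the coefficient therefore vanishes too, and non-integral at
  \<open>k = 2 D - m\<close>, where it does not. Hence, for \<open>k = 2 D - m\<close>, \<open>L\<^sub>k\<close> is not in the ideal of the
  earlier saddle values. For degree \<open>n\<close> one can take \<open>N = n - O(1)\<close> and \<open>m = O(n)\<close>, so
  \<open>k = 2 n\<^sup>2 + O(n)\<close>, for all coprime \<open>p \<le> q\<close>.
\<close>

section \<open>Power series in two variables\<close>

lemma fps2_ext: "(\<And>i j. F $ i $ j = G $ i $ j) \<Longrightarrow> F = G"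
  by (simp add: fps_eq_iff)

lemma series2_nth [simp]: "series2 c $ i $ j = c i j"
  by (simp add: series2_def)

lemma fps2_mult_nth:
  fixes F G :: "'b::comm_ring_1 fps fps"
  shows "(F * G) $ i $ j = (\<Sum>a\<le>i. \<Sum>b\<le>j. F $ a $ b * G $ (i - a) $ (j - b))"
  by (simp add: fps_mult_nth fps_sum_nth atLeast0AtMost)

lemma of_nat_fps2_mult_nth [simp]:
  "(of_nat n * (F :: 'b::comm_ring_1 fps fps)) $ i $ j = of_nat n * F $ i $ j"
  by (simp flip: fps_of_nat)

lemma of_nat_fps_mult_nth [simp]:
  "(of_nat n * (F :: 'b::comm_ring_1 fps)) $ i = of_nat n * F $ i"
  by (simp flip: fps_of_nat)

definition monomial :: "nat \<Rightarrow> nat \<Rightarrow> 'b::comm_ring_1 fps fps" where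
  "monomial a b = var_x ^ a * var_y ^ b"

lemma var_y_power_mult_nth: "(var_y ^ b * F) $ i = fps_X ^ b * (F :: 'b::comm_ring_1 fps fps) $ i"
  by (simp add: var_y_def fps_const_power)

lemma monomial_mult_nth:
  "(monomial a b * F) $ i $ j = (if a \<le> i \<and> b \<le> j then F $ (i - a) $ (j - b) else 0)"
  by (simp add: monomial_def mult.assoc var_x_def fps_X_power_mult_nth var_y_power_mult_nth)

lemma monomial_nth: "monomial a b $ i $ j = (if i = a \<and> j = b then 1 else 0)"
  using monomial_mult_nth[of a b 1 i j] by (auto simp: fps_one_nth)

lemma monomial_mult_monomial: "monomial a b * monomial c d = monomial (a + c) (b + d)"
  by (simp add: monomial_def power_add algebra_simps)

lemma monomial_power: "monomial a b ^ k = monomial (a * k) (b * k)"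
  by (simp add: monomial_def power_mult power_mult_distrib)

lemma var_x_eq: "var_x = monomial 1 0" and var_y_eq: "var_y = monomial 0 1"
    and one_eq_monomial: "1 = monomial 0 0"
  by (simp_all add: monomial_def)

section \<open>Order of vanishing at the origin\<close>

definition vanishes_below :: "nat \<Rightarrow> 'b::comm_ring_1 fps fps \<Rightarrow> bool" where
  "vanishes_below d F \<longleftrightarrow> (\<forall>i j. i + j < d \<longrightarrow> F $ i $ j = 0)"

lemma vanishes_belowD: "vanishes_below d F \<Longrightarrow> i + j < d \<Longrightarrow> F $ i $ j = 0"
  by (simp add: vanishes_below_def)

lemma vanishes_below_0 [simp]: "vanishes_below 0 F" and vanishes_below_zero [simp]:
    "vanishes_below d 0"
  by (simp_all add: vanishes_below_def)

lemma vanishes_below_mono: "vanishes_below d F \<Longrightarrow> e \<le> d \<Longrightarrow> vanishes_below e F"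
  by (simp add: vanishes_below_def)

lemma vanishes_below_add: "vanishes_below d F \<Longrightarrow> vanishes_below d G \<Longrightarrow> vanishes_below d (F + G)"
  and vanishes_below_minus: "vanishes_below d F \<Longrightarrow> vanishes_below d (- F)"
  by (simp_all add: vanishes_below_def)

lemma vanishes_below_sum: "(\<And>x. x \<in> A \<Longrightarrow> vanishes_below d (F x)) \<Longrightarrow> vanishes_below d (sum F A)"
  by (simp add: vanishes_below_def fps_sum_nth)

lemma vanishes_below_mult:
  assumes "vanishes_below d F" "vanishes_below e G"
  shows "vanishes_below (d + e) (F * G)"
  unfolding vanishes_below_def
proof (intro allI impI)
  fix i j assume ij: "i + j < d + e"
  have "F $ a $ b * G $ (i - a) $ (j - b) = 0" if "a \<le> i" "b \<le> j" for a b
  proof (cases "a + b < d")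
    case False
    then have "(i - a) + (j - b) < e" using ij that by linarith
    then show ?thesis using vanishes_belowD[OF assms(2)] by simp
  qed (use vanishes_belowD[OF assms(1)] in simp)
  then show "(F * G) $ i $ j = 0" by (simp add: fps2_mult_nth)
qed

lemma vanishes_below_mult_left: "vanishes_below e G \<Longrightarrow> vanishes_below e (F * G)"
    and vanishes_below_mult_right: "vanishes_below d F \<Longrightarrow> vanishes_below d (F * G)"
  using vanishes_below_mult[of 0 F e G] vanishes_below_mult[of d F 0 G] by simp_all

lemma vanishes_below_power: "vanishes_below d F \<Longrightarrow> vanishes_below (k * d) (F ^ k)"
  by (induction k) (simp_all add: vanishes_below_mult)

lemma vanishes_below_monomial: "d \<le> a + b \<Longrightarrow> vanishes_below d (monomial a b)"
  by (auto simp: vanishes_below_def monomial_nth)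

lemma vanishes_below_all_imp_zero: "(\<And>d. vanishes_below d F) \<Longrightarrow> F = 0"
  by (intro fps2_ext) (auto dest: vanishes_belowD[of "Suc _"])

text \<open>\<open>F'\<close> and \<open>G'\<close> play the role of leading forms of degrees
  \<open>d\<close> and \<open>e\<close>. Modulo terms of degree above \<open>d + e\<close>, a
  product depends only on the leading forms of its factors.\<close>

lemma cong_mult:
  assumes "vanishes_below d F'" "vanishes_below (Suc d) (F - F')" "vanishes_below e G'"
      "vanishes_below (Suc e) (G - G')"
  shows "vanishes_below (Suc (d + e)) (F * G - F' * G')"
proof -
  have "vanishes_below e ((G - G') + G')" by (intro vanishes_below_add assms) (use assms(4)
      vanishes_below_mono in force)
  then have "vanishes_below (Suc d + e) ((F - F') * G)"
      using vanishes_below_mult[OF assms(2), of e G] by simp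
  moreover have "vanishes_below (d + Suc e) (F' * (G - G'))" by (intro vanishes_below_mult assms)
  ultimately have "vanishes_below (Suc (d + e)) ((F - F') * G + F' * (G - G'))"
      by (intro vanishes_below_add) auto
  then show ?thesis by (simp add: algebra_simps)
qed

lemma cong_power:
  assumes "vanishes_below d F'" "vanishes_below (Suc d) (F - F')"
  shows "vanishes_below (Suc (k * d)) (F ^ k - F' ^ k)"
proof (induction k)
  case (Suc k)
  show ?case using cong_mult[OF assms vanishes_below_power[OF assms(1)] Suc] by simp
qed simp

lemma vanishes_below_power_diff:
  assumes "vanishes_below d (F - F')"
  shows "vanishes_below d (F ^ k - F' ^ k)"
proof (induction k)
  case (Suc k)
  have "F ^ Suc k - F' ^ Suc k = (F - F') * F ^ k + F' * (F ^ k - F' ^ k)"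
      by (simp add: algebra_simps)
  then show ?case using Suc assms by (simp add: vanishes_below_add vanishes_below_mult_left
      vanishes_below_mult_right)
qed simp

section \<open>Derivations along a vector field\<close>

lemma deriv_x_nth: "deriv_x F $ i $ j = of_nat (i + 1) * F $ (i + 1) $ j"
  unfolding deriv_x_def fps_deriv_nth by (rule of_nat_fps_mult_nth)

lemma deriv_y_nth: "deriv_y F $ i $ j = of_nat (j + 1) * F $ i $ (j + 1)"
  by (simp add: deriv_y_def)

lemma deriv_x_add: "deriv_x (F + G) = deriv_x F + deriv_x G"
  and deriv_y_add: "deriv_y (F + G) = deriv_y F + deriv_y G"
  and deriv_x_diff: "deriv_x (F - G) = deriv_x F - deriv_x G"
  and deriv_y_diff: "deriv_y (F - G) = deriv_y F - deriv_y G"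
  by (intro fps2_ext; simp add: deriv_x_nth deriv_y_nth algebra_simps)+

lemma deriv_x_mult: "deriv_x (F * G) = deriv_x F * G + F * deriv_x G"
  by (simp add: deriv_x_def)

lemma deriv_y_mult: "deriv_y (F * G) = deriv_y F * G + F * deriv_y G"
proof (rule fps_ext)
  fix i
  have "deriv_y (F * G) $ i = fps_deriv (\<Sum>a=0..i. F $ a * G $ (i - a))"
    by (simp add: deriv_y_def fps_mult_nth)
  also have "\<dots> = (\<Sum>a=0..i. fps_deriv (F $ a) * G $ (i - a) + F $ a * fps_deriv (G $ (i - a)))"
    by (simp add: fps_deriv_sum add.commute)
  also have "\<dots> = (deriv_y F * G + F * deriv_y G) $ i"
    by (simp add: fps_mult_nth deriv_y_def sum.distrib add.commute)
  finally show "deriv_y (F * G) $ i = (deriv_y F * G + F * deriv_y G) $ i" .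
qed

lemma vanishes_below_deriv_x: "vanishes_below d F \<Longrightarrow> vanishes_below (d - 1) (deriv_x F)"
  and vanishes_below_deriv_y: "vanishes_below d F \<Longrightarrow> vanishes_below (d - 1) (deriv_y F)"
  by (simp_all add: vanishes_below_def deriv_x_nth deriv_y_nth)

definition flow :: "'b::comm_ring_1 fps fps \<Rightarrow> 'b fps fps \<Rightarrow> 'b fps fps \<Rightarrow> 'b fps fps" where
  "flow F G H = deriv_x H * F + deriv_y H * G"

lemma flow_add: "flow F G (H + K) = flow F G H + flow F G K"
  and flow_diff: "flow F G (H - K) = flow F G H - flow F G K"
  and flow_mult: "flow F G (H * K) = flow F G H * K + H * flow F G K"
  by (simp_all add: flow_def deriv_x_add deriv_y_add deriv_x_diff deriv_y_diff deriv_x_mult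
      deriv_y_mult
      algebra_simps)

lemma deriv_x_1: "deriv_x 1 = 0" and deriv_y_1: "deriv_y 1 = 0"
  by (auto intro!: fps2_ext simp: deriv_x_nth deriv_y_nth one_eq_monomial monomial_nth)

lemma flow_1: "flow F G 1 = 0"
  by (simp add: flow_def deriv_x_1 deriv_y_1)

lemma flow_power: "flow F G (H ^ k) = of_nat k * H ^ (k - 1) * flow F G H"
proof (induction k)
  case (Suc k)
  then show ?case by (cases k) (simp_all add: flow_mult algebra_simps)
qed (simp add: flow_1)

section \<open>Series in a single power series without constant term\<close>

lemma resonant_sum_nth:
  "resonant_sum c Z $ i $ j = (\<Sum>k = 1..i + j. c k * ((Z ^ k) $ i $ j))"
  by (simp add: resonant_sum_def)

lemma resonant_sum_nth_upto:
  assumes "vanishes_below 1 Z" "i + j \<le> n"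
  shows "resonant_sum c Z $ i $ j = (\<Sum>k = 1..n. c k * ((Z ^ k) $ i $ j))"
proof -
  have "(Z ^ k) $ i $ j = 0" if "k > i + j" for k
    using vanishes_below_power[OF assms(1), of k] that by (simp add: vanishes_belowD)
  then show ?thesis unfolding resonant_sum_nth
    by (intro sum.mono_neutral_left) (use assms in auto)
qed

definition const2 :: "'b::comm_ring_1 \<Rightarrow> 'b fps fps" where "const2 c = fps_const (fps_const c)"

lemma const2_mult_nth [simp]: "(const2 c * F) $ i $ j = c * F $ i $ j"
  by (simp add: const2_def)

text \<open>Coefficients of degree at most \<open>n\<close> see only finitely many powers of
  \<open>Z\<close>, so in this range the infinite sum can be handled as a polynomial in
  \<open>Z\<close>.\<close>

lemma resonant_sum_cong_poly:
  assumes "vanishes_below 1 Z"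
  shows "vanishes_below (Suc n) (resonant_sum c Z - (\<Sum>k = 1..n. const2 (c k) * Z ^ k))"
  by (auto simp: vanishes_below_def fps_sum_nth resonant_sum_nth_upto[OF assms, of _ _ n])

lemma resonant_sum_diff: "resonant_sum c Z - resonant_sum d Z = resonant_sum (\<lambda>k. c k - d k) Z"
  by (intro fps2_ext) (simp add: resonant_sum_nth sum_subtractf algebra_simps)

lemma vanishes_below_resonant_sum: "vanishes_below d Z \<Longrightarrow> vanishes_below d (resonant_sum c Z)"
  unfolding vanishes_below_def[of d "resonant_sum c Z"] resonant_sum_nth
proof (intro allI impI sum.neutral ballI)
  fix i j k assume "vanishes_below d Z" "i + j < d" "k \<in> {1..i + j}"
  then have "vanishes_below (k * d) (Z ^ k)" "i + j < k * d" using vanishes_below_power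
      by (auto intro: less_le_trans)
  then show "c k * (Z ^ k) $ i $ j = 0" by (simp add: vanishes_belowD)
qed

lemma vanishes_below_resonant_sum_diff:
  assumes "vanishes_below d (Z - Z')" shows "vanishes_below d (resonant_sum c Z - resonant_sum c
      Z')"
  using vanishes_below_power_diff[OF assms] unfolding vanishes_below_def
  by (simp add: resonant_sum_nth flip: sum_subtractf right_diff_distrib)

text \<open>The factor \<open>X ^ q\<close> contributes the eigenvalue \<open>q p\<close> and
  \<open>Y ^ p\<close> contributes \<open>- p q\<close>. These cancel, and only the difference of
  the two resonant series survives; in a normal form its coefficients are the saddle values.\<close>

lemma flow_Z:
  assumes X: "flow F G X = of_nat p * X * (1 + R1)" and Y: "flow F G Y = - of_nat q * Y * (1 + R2)"
    and p: "p > 0" and q: "q > 0"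
  shows "flow F G (X ^ q * Y ^ p) = of_nat (p * q) * (X ^ q * Y ^ p) * (R1 - R2)"
proof -
  have Xq: "X ^ q = X ^ (q - 1) * X" and Yp: "Y ^ p = Y ^ (p - 1) * Y"
    using p q by (metis power_minus_mult)+
  have "flow F G (X ^ q * Y ^ p) =
      (of_nat q * X ^ (q - 1) * (of_nat p * X * (1 + R1))) * Y ^ p +
      X ^ q * (of_nat p * Y ^ (p - 1) * (- of_nat q * Y * (1 + R2)))"
    by (simp only: flow_mult flow_power X Y)
  also have "\<dots> = of_nat (p * q) * (X ^ q * Y ^ p) * (R1 - R2)"
    unfolding Xq Yp of_nat_mult by (simp add: algebra_simps del: power_Suc)
  finally show ?thesis .
qed

section \<open>Existence and uniqueness of the normal form\<close>

text \<open>The difference factors as \<open>F - F'\<close> times a sum of products of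
  \<open>k\<close> series without constant term, and each of these raises the order by one.\<close>

lemma vanishes_below_power_diff_strong:
  assumes "vanishes_below d (F - F')" "vanishes_below 1 F" "vanishes_below 1 F'"
  shows "vanishes_below (d + k) (F ^ Suc k - F' ^ Suc k)"
proof (induction k)
  case (Suc k)
  have "F ^ Suc (Suc k) - F' ^ Suc (Suc k) = (F - F') * F ^ Suc k + F' * (F ^ Suc k - F' ^ Suc k)"
    by (simp add: algebra_simps)
  moreover have "vanishes_below (d + Suc k) ((F - F') * F ^ Suc k)"
    using vanishes_below_mult[OF assms(1) vanishes_below_power[OF assms(2), of "Suc k"]] by simp
  moreover have "vanishes_below (d + Suc k) (F' * (F ^ Suc k - F' ^ Suc k))"
    using vanishes_below_mult[OF assms(3) Suc] by simp
  ultimately show ?case by (simp only: vanishes_below_add)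
qed (use assms in simp)

section \<open>The homological equation\<close>

lemma deriv_x_mult_var_x: "(deriv_x F * var_x) $ i $ j = of_nat i * F $ i $ j"
  using monomial_mult_nth[of 1 0 "deriv_x F" i j] by (cases i) (auto simp: var_x_eq mult.commute
      deriv_x_nth)

lemma deriv_y_mult_var_y: "(deriv_y F * var_y) $ i $ j = of_nat j * F $ i $ j"
  using monomial_mult_nth[of 0 1 "deriv_y F" i j] by (cases j) (auto simp: var_y_eq mult.commute
      deriv_y_nth)

text \<open>The linear part of the field is diagonal on monomials. When \<open>P\<close> and
  \<open>Q\<close> start in degree two, the second summand involves only coefficients of
  \<open>U\<close> of degree below \<open>i + j\<close>.\<close>

lemma flow_linear:
  "flow (of_nat p * var_x + P) (- of_nat q * var_y + Q) U $ i $ j =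
    of_int (int p * int i - int q * int j) * U $ i $ j + (deriv_x U * P + deriv_y U * Q) $ i $ j"
proof -
  have "flow (of_nat p * var_x + P) (- of_nat q * var_y + Q) U =
     of_nat p * (deriv_x U * var_x) - of_nat q * (deriv_y U * var_y) + (deriv_x U * P + deriv_y U
         * Q)"
    by (simp add: flow_def algebra_simps)
  then have "flow (of_nat p * var_x + P) (- of_nat q * var_y + Q) U $ i $ j =
     of_nat p * (of_nat i * U $ i $ j) - of_nat q * (of_nat j * U $ i $ j) + (deriv_x U * P +
         deriv_y U * Q) $ i $ j"
    by (simp only: fps_add_nth fps_sub_nth of_nat_fps2_mult_nth deriv_x_mult_var_x
        deriv_y_mult_var_y)
  then show ?thesis by (simp only: of_int_diff of_int_mult of_int_of_nat_eq left_diff_distrib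
      mult.assoc)
qed

lemma of_int_fps2_mult_nth [simp]:
  "(of_int n * (F :: 'b::comm_ring_1 fps fps)) $ i $ j = of_int n * F $ i $ j"
  by (simp flip: fps_of_int)

text \<open>The defect in one component of the normal form equations. The eigenvalue
  \<open>m\<close> is \<open>p\<close> for \<open>X\<close> and \<open>- q\<close> for
  \<open>Y\<close>, so both components share one computation.\<close>

definition residual :: "nat \<Rightarrow> nat \<Rightarrow> 'b::comm_ring_1 fps fps \<Rightarrow> 'b fps fps \<Rightarrow> int \<Rightarrow> (nat \<Rightarrow> 'b) \<Rightarrow>
    'b fps fps \<Rightarrow> 'b fps fps \<Rightarrow> 'b fps fps" where
  "residual p q P Q m c U Z = flow (of_nat p * var_x + P) (- of_nat q * var_y + Q) U
     - of_int m * U * (1 + resonant_sum c Z)"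

lemma residual_nth:
  "residual p q P Q m c U Z $ i $ j = of_int (int p * int i - int q * int j - m) * U $ i $ j +
     (deriv_x U * P + deriv_y U * Q) $ i $ j - of_int m * (U * resonant_sum c Z) $ i $ j"
proof -
  have "residual p q P Q m c U Z = flow (of_nat p * var_x + P) (- of_nat q * var_y + Q) U
      - of_int m * U - of_int m * (U * resonant_sum c Z)"
    unfolding residual_def by (simp add: distrib_left mult.assoc)
  then show ?thesis
    by (simp only: fps_sub_nth flow_linear of_int_fps2_mult_nth) (simp add: left_diff_distrib)
qed

text \<open>For candidates that agree below degree \<open>d\<close>, the equation becomes linear in
  degree \<open>d\<close>: what remains is the diagonal action on the new coefficients of
  \<open>U\<close> and the new resonant coefficients, while all other terms involve lower degrees
  and cancel. The exponents \<open>e1\<close>, \<open>e2\<close> are those of the leading monomial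
  of \<open>U'\<close>.\<close>

lemma residual_diff_nth:
  assumes PQ: "vanishes_below 2 P" "vanishes_below 2 Q" and d: "d \<ge> 2"
    and U: "vanishes_below d (U - U')" "vanishes_below 2 (U' - monomial e1 e2)" "e1 + e2 = 1"
    and Z: "vanishes_below (Suc d) (Z - Z')" "vanishes_below (Suc (p + q)) (Z' - monomial q p)" "p
        > 0"
    and c: "\<And>k. k \<ge> 1 \<Longrightarrow> 1 + k * (p + q) < d \<Longrightarrow> c k = c' k"
    and ij: "i + j = d"
  shows "residual p q P Q m c U Z $ i $ j - residual p q P Q m c' U' Z' $ i $ j =
    of_int (int p * int i - int q * int j - m) * (U $ i $ j - U' $ i $ j) -
    of_int m * (\<Sum>k = 1..d. if i = e1 + k * q \<and> j = e2 + k * p then c k - c' k else 0)"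
proof -
  let ?D = "U - U'" and ?c = "\<lambda>k. c k - c' k"
  have "vanishes_below 1 ((Z' - monomial q p) + monomial q p)"
    by (intro vanishes_below_add) (use Z in \<open>auto intro: vanishes_below_mono
        vanishes_below_monomial\<close>)
  then have Z'1: "vanishes_below 1 Z'" by simp
  then have "vanishes_below 1 ((Z - Z') + Z')" by (intro vanishes_below_add vanishes_below_mono[OF
      Z(1)]) auto
  then have Z1: "vanishes_below 1 Z" by simp
  have "vanishes_below 1 ((U' - monomial e1 e2) + monomial e1 e2)"
    by (intro vanishes_below_add) (use U in \<open>auto intro: vanishes_below_mono
        vanishes_below_monomial\<close>)
  then have U'1: "vanishes_below 1 U'" by simp
  \<comment> \<open>The changes of \<open>U\<close>, of \<open>Z\<close> and of the coefficients are
    separated by telescoping. In degree \<open>d\<close> only the diagonal part of the first and the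
    last of them survive.\<close>
  have split: "residual p q P Q m c U Z - residual p q P Q m c' U' Z' =
      flow (of_nat p * var_x + P) (- of_nat q * var_y + Q) ?D - of_int m * ?D
      - (of_int m * (?D * resonant_sum c Z) + of_int m * (U' * (resonant_sum c Z - resonant_sum c
          Z'))
      + of_int m * (U' * resonant_sum ?c Z'))"
    by (simp add: residual_def flow_diff algebra_simps flip: resonant_sum_diff)
  have "vanishes_below (d - 1 + 2) (deriv_x ?D * P)" "vanishes_below (d - 1 + 2) (deriv_y ?D * Q)"
    by (intro vanishes_below_mult vanishes_below_deriv_x vanishes_below_deriv_y U PQ)+
  then have 1: "(deriv_x ?D * P + deriv_y ?D * Q) $ i $ j = 0"
    using d ij by (simp add: vanishes_below_def)
  have "vanishes_below (d + 1) (?D * resonant_sum c Z)"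
      by (intro vanishes_below_mult U vanishes_below_resonant_sum Z1)
  then have 2: "(?D * resonant_sum c Z) $ i $ j = 0" using ij by (simp add: vanishes_below_def)
  have "vanishes_below (1 + Suc d) (U' * (resonant_sum c Z - resonant_sum c Z'))"
    by (intro vanishes_below_mult U'1 vanishes_below_resonant_sum_diff Z)
  then have 3: "(U' * (resonant_sum c Z - resonant_sum c Z')) $ i $ j = 0" using ij
      by (simp add: vanishes_below_def)
  have "vanishes_below (Suc d) (U' * resonant_sum ?c Z' - U' * (\<Sum>k = 1..d. const2 (?c k) * Z' ^ k))"
    using vanishes_below_mult_left[OF resonant_sum_cong_poly[OF Z'1, of d ?c], of U']
        by (simp add: right_diff_distrib)
  moreover have "vanishes_below (Suc d) (U' * (\<Sum>k = 1..d. const2 (?c k) * Z' ^ k)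
       - (\<Sum>k = 1..d. const2 (?c k) * (monomial e1 e2 * monomial q p ^ k)))"
    unfolding sum_distrib_left sum_subtractf[symmetric]
  proof (intro vanishes_below_sum)
    fix k assume k: "k \<in> {1..d}"
    show "vanishes_below (Suc d) (U' * (const2 (?c k) * Z' ^ k) - const2 (?c k) * (monomial e1 e2
        * monomial q p ^ k))"
    \<comment> \<open>The \<open>k\<close>-th term starts in degree \<open>1 + k * (p + q)\<close>.
      If this is below \<open>d\<close>, its coefficient is zero by assumption; otherwise at most
      its leading monomial reaches degree \<open>d\<close>.\<close>
    proof (cases "1 + k * (p + q) < d")
      case True
      then show ?thesis using c[of k] k by (simp add: const2_def)
    next
      case False
      have "vanishes_below (Suc (1 + k * (p + q))) (U' * Z' ^ k - monomial e1 e2 * monomial q p ^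
          k)"
        by (rule cong_mult)
          (use U Z in \<open>auto intro!: cong_power vanishes_below_power vanishes_below_monomial simp:
              numeral_2_eq_2 add.commute\<close>)
      then have "vanishes_below (Suc d) (const2 (?c k) * (U' * Z' ^ k - monomial e1 e2 * monomial
          q p ^ k))"
        using False by (intro vanishes_below_mult_left) (auto intro: vanishes_below_mono)
      then show ?thesis by (simp add: algebra_simps)
    qed
  qed
  ultimately have "vanishes_below (Suc d) (U' * resonant_sum ?c Z' - (\<Sum>k
      = 1..d. const2 (?c k) * (monomial e1 e2 * monomial q p ^ k)))"
    using vanishes_below_add by fastforce
  then have 4: "(U' * resonant_sum ?c Z') $ i $ j =
      (\<Sum>k = 1..d. if i = e1 + k * q \<and> j = e2 + k * p then ?c k else 0)"
    using ij by (simp add: vanishes_below_def fps_sum_nth monomial_power monomial_mult_monomial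
        monomial_nth mult.commute if_distrib
        cong: if_cong)
  have "residual p q P Q m c U Z $ i $ j - residual p q P Q m c' U' Z' $ i $ j =
     (residual p q P Q m c U Z - residual p q P Q m c' U' Z') $ i $ j" by simp
  then show ?thesis unfolding split fps_sub_nth fps_add_nth flow_linear of_int_fps2_mult_nth 2 3 4
    using 1 by (simp add: algebra_simps)
qed

text \<open>The base ring is general because the normalization is used over the polynomials in the
  coefficients as well as over power series in \<open>\<epsilon>\<close>. Assumption
  \<open>inv\<close> provides the divisions that occur, those by nonzero integers.\<close>

locale resonant_saddle =
  fixes p q :: nat and P Q :: "'b::comm_ring_1 fps fps"
  assumes p: "p > 0" and q: "q > 0" and coprime: "coprime p q" and P: "vanishes_below 2 P"
      and Q: "vanishes_below 2 Q"
    and inv: "\<And>n::int. n \<noteq> 0 \<Longrightarrow> \<exists>c::'b. of_int n * c = 1"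
begin

definition admissible :: "(nat \<Rightarrow> nat \<Rightarrow> 'b) \<Rightarrow> (nat \<Rightarrow> nat \<Rightarrow> 'b) \<Rightarrow> bool" where
  "admissible \<phi> \<psi> \<longleftrightarrow> (\<forall>i j. i + j < 2 \<longrightarrow> \<phi> i j = 0 \<and> \<psi> i j = 0) \<and>
     (\<forall>k\<ge>1. \<phi> (1 + k * q) (k * p) = 0 \<and> \<psi> (k * q) (1 + k * p) = 0)"

definition X where "X \<phi> = var_x + series2 (\<phi> :: nat \<Rightarrow> nat \<Rightarrow> 'b)"
definition Y where "Y \<psi> = var_y + series2 (\<psi> :: nat \<Rightarrow> nat \<Rightarrow> 'b)"
definition Z where "Z \<phi> \<psi> = X \<phi> ^ q * Y \<psi> ^ p"
definition res1 where "res1 \<phi> \<psi> c = residual p q P Q (int p) c (X \<phi>) (Z \<phi> \<psi>)"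
definition res2 where "res2 \<phi> \<psi> c = residual p q P Q (- int q) c (Y \<psi>) (Z \<phi> \<psi>)"

text \<open>An approximate normalization, the object of the induction on the degree
  \<open>d\<close>.\<close>

definition normal_below where
  "normal_below d \<phi> \<psi> a b \<longleftrightarrow> admissible \<phi> \<psi> \<and> vanishes_below d (res1 \<phi> \<psi> a) \<and> vanishes_below d
      (res2 \<phi> \<psi> b)"

lemma normalizes_iff: "normalizes p q P Q \<phi> \<psi> a b \<longleftrightarrow> admissible \<phi> \<psi> \<and> res1 \<phi> \<psi> a = 0 \<and> res2 \<phi> \<psi> b
    = 0"
  unfolding normalizes_def admissible_def res1_def res2_def residual_def X_def Y_def Z_def
      flow_def Let_def
    right_minus_eq of_int_minus of_int_of_nat_eq by (rule conj_assoc[symmetric])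

lemma normalizes_imp_normal_below: "normalizes p q P Q \<phi> \<psi> a b \<Longrightarrow> normal_below d \<phi> \<psi> a b"
  by (simp add: normalizes_iff normal_below_def)

text \<open>The resonant coefficients with index \<open>k\<close> first enter the equations in
  degree \<open>1 + k * (p + q)\<close>, the order of \<open>X * Z ^ k\<close>; they are compared
  only when this is below \<open>d\<close>.\<close>

definition agree where
  "agree d \<phi> \<psi> a b \<phi>' \<psi>' a' b' \<longleftrightarrow>
     (\<forall>i j. i + j < d \<longrightarrow> \<phi> i j = \<phi>' i j \<and> \<psi> i j = \<psi>' i j) \<and>
     (\<forall>k\<ge>1. 1 + k * (p + q) < d \<longrightarrow> a k = a' k \<and> b k = (b' k :: 'b))"

lemma vanishes_below_X: "admissible \<phi> \<psi> \<Longrightarrow> vanishes_below 2 (X \<phi> - monomial 1 0)"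
    and vanishes_below_Y: "admissible \<phi> \<psi> \<Longrightarrow> vanishes_below 2 (Y \<psi> - monomial 0 1)"
  by (simp_all add: admissible_def X_def Y_def var_x_eq var_y_eq vanishes_below_def)

lemma vanishes_below_one_X: "admissible \<phi> \<psi> \<Longrightarrow> vanishes_below 1 (X \<phi>)"
    and vanishes_below_one_Y: "admissible \<phi> \<psi> \<Longrightarrow> vanishes_below 1 (Y \<psi>)"
  using vanishes_below_add[OF vanishes_below_mono[OF vanishes_below_X] vanishes_below_monomial[of
      1 1 0]] vanishes_below_add[OF vanishes_below_mono[OF vanishes_below_Y]
      vanishes_below_monomial[of 1 0 1]] by auto

lemma vanishes_below_Z: "admissible \<phi> \<psi> \<Longrightarrow> vanishes_below (Suc (p + q)) (Z \<phi> \<psi> - monomial q p)"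
proof -
  assume s: "admissible \<phi> \<psi>"
  have X: "vanishes_below (Suc (q * 1)) (X \<phi> ^ q - monomial 1 0 ^ q)"
    using vanishes_below_X[OF s] by (intro cong_power vanishes_below_monomial) (auto simp:
        numeral_2_eq_2)
  have Y: "vanishes_below (Suc (p * 1)) (Y \<psi> ^ p - monomial 0 1 ^ p)"
    using vanishes_below_Y[OF s] by (intro cong_power vanishes_below_monomial) (auto simp:
        numeral_2_eq_2)
  have "vanishes_below (Suc (q + p)) (X \<phi> ^ q * Y \<psi> ^ p - monomial 1 0 ^ q * monomial 0 1 ^ p)"
    by (rule cong_mult) (use X Y in \<open>auto simp: monomial_power intro: vanishes_below_monomial\<close>)
  then show ?thesis by (simp add: Z_def monomial_power monomial_mult_monomial add.commute)
qed

lemma vanishes_below_diff_agree: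
  assumes "agree d \<phi> \<psi> a b \<phi>' \<psi>' a' b'"
  shows "vanishes_below d (X \<phi> - X \<phi>')" "vanishes_below d (Y \<psi> - Y \<psi>')"
  using assms by (simp_all add: agree_def X_def Y_def vanishes_below_def)

text \<open>\<open>Z\<close> is a product of \<open>p + q\<close> factors, at least two, and the
  factors left over in the telescoped difference raise the order by at least one. This is the extra
  order that \<open>residual_diff_nth\<close> asks for.\<close>

lemma vanishes_below_Z_diff_agree:
  assumes "agree d \<phi> \<psi> a b \<phi>' \<psi>' a' b'" and s: "admissible \<phi> \<psi>" "admissible \<phi>' \<psi>'"
  shows "vanishes_below (Suc d) (Z \<phi> \<psi> - Z \<phi>' \<psi>')"
proof -
  note D = vanishes_below_diff_agree[OF assms(1)]
  have "vanishes_below (d + (q - 1)) (X \<phi> ^ Suc (q - 1) - X \<phi>' ^ Suc (q - 1))"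
    by (rule vanishes_below_power_diff_strong) (use D vanishes_below_one_X s in auto)
  then have 1: "vanishes_below (d + (q - 1) + p) ((X \<phi> ^ q - X \<phi>' ^ q) * Y \<psi> ^ p)"
    using vanishes_below_power[OF vanishes_below_one_Y[OF s(1)], of p] q
        by (intro vanishes_below_mult) auto
  have "vanishes_below (d + (p - 1)) (Y \<psi> ^ Suc (p - 1) - Y \<psi>' ^ Suc (p - 1))"
    by (rule vanishes_below_power_diff_strong) (use D vanishes_below_one_Y s in auto)
  then have 2: "vanishes_below (q + (d + (p - 1))) (X \<phi>' ^ q * (Y \<psi> ^ p - Y \<psi>' ^ p))"
    using vanishes_below_power[OF vanishes_below_one_X[OF s(2)], of q] p
        by (intro vanishes_below_mult) auto
  have "vanishes_below (Suc d) ((X \<phi> ^ q - X \<phi>' ^ q) * Y \<psi> ^ p + X \<phi>' ^ q * (Y \<psi> ^ p - Y \<psi>' ^ p))"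
    by (intro vanishes_below_add vanishes_below_mono[OF 1] vanishes_below_mono[OF 2]) (use p q in
        auto)
  then show ?thesis by (simp add: Z_def algebra_simps)
qed

lemma res_diff_nth:
  assumes ag: "agree d \<phi> \<psi> a b \<phi>' \<psi>' a' b'" and s: "admissible \<phi> \<psi>" "admissible \<phi>' \<psi>'"
    and d: "d \<ge> 2" and ij: "i + j = d"
  shows "res1 \<phi> \<psi> a $ i $ j - res1 \<phi>' \<psi>' a' $ i $ j =
     of_int (int p * int i - int q * int j - int p) * (\<phi> i j - \<phi>' i j) -
     of_int (int p) * (\<Sum>k = 1..d. if i = 1 + k * q \<and> j
         = k * p then a k - a' k else 0)" (is ?thesis1)
   and "res2 \<phi> \<psi> b $ i $ j - res2 \<phi>' \<psi>' b' $ i $ j =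
     of_int (int p * int i - int q * int j + int q) * (\<psi> i j - \<psi>' i j) +
     of_int (int q) * (\<Sum>k = 1..d. if i = k * q \<and> j = 1 + k * p then b k - b' k else 0)" (is
         ?thesis2)
proof -
  note D = vanishes_below_diff_agree[OF ag] vanishes_below_Z_diff_agree[OF ag s]
      vanishes_below_Z[OF s(2)]
  have "res1 \<phi> \<psi> a $ i $ j - res1 \<phi>' \<psi>' a' $ i $ j =
     of_int (int p * int i - int q * int j - int p) * (X \<phi> $ i $ j - X \<phi>' $ i $ j) -
     of_int (int p) * (\<Sum>k = 1..d. if i = 1 + k * q \<and> j = 0 + k * p then a k - a' k else 0)"
    unfolding res1_def
    by (rule residual_diff_nth) (use P Q d D vanishes_below_X[OF s(2)] p ij ag in \<open>auto simp:
        agree_def\<close>)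
  then show ?thesis1 by (simp add: X_def)
  have "res2 \<phi> \<psi> b $ i $ j - res2 \<phi>' \<psi>' b' $ i $ j =
     of_int (int p * int i - int q * int j - (- int q)) * (Y \<psi> $ i $ j - Y \<psi>' $ i $ j) -
     of_int (- int q) * (\<Sum>k = 1..d. if i = 0 + k * q \<and> j = 1 + k * p then b k - b' k else 0)"
    unfolding res2_def
    by (rule residual_diff_nth) (use P Q d D vanishes_below_Y[OF s(2)] p ij ag in \<open>auto simp:
        agree_def\<close>)
  then show ?thesis2 by (simp add: Y_def)
qed

section \<open>Resonant and nonresonant monomials\<close>

lemma resonance1:
  assumes "int p * int i - int q * int j - int p = 0" "i + j \<ge> 2"
  obtains k where "k \<ge> 1" "i = 1 + k * q" "j = k * p"
proof -
  have "int q * int j \<ge> 0" by simp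
  then have "int p * int i \<noteq> 0" using assms p by linarith
  then have "i \<noteq> 0" by auto
  then obtain i' where i: "i = Suc i'" by (cases i) auto
  have "int (p * i') = int (q * j)" using assms by (simp add: i algebra_simps)
  then have e: "p * i' = q * j" by (simp only: of_nat_eq_iff)
  then have "q dvd i'" using coprime by (metis coprime_commute coprime_dvd_mult_right_iff
      dvd_triv_left)
  then obtain k where k: "i' = k * q" by (metis dvd_def mult.commute)
  then have "j = k * p" using e q by (simp add: mult.left_commute mult.commute)
  moreover have "k \<ge> 1" using assms(2) k i calculation by (cases k) auto
  ultimately show ?thesis using that k i by simp
qed

lemma resonance2:
  assumes "int p * int i - int q * int j + int q = 0" "i + j \<ge> 2"
  obtains k where "k \<ge> 1" "i = k * q" "j = 1 + k * p"
proof -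
  have "int p * int i \<ge> 0" by simp
  then have "int q * int j \<noteq> 0" using assms q by linarith
  then have "j \<noteq> 0" by auto
  then obtain j' where j: "j = Suc j'" by (cases j) auto
  have "int (p * i) = int (q * j')" using assms by (simp add: j algebra_simps)
  then have e: "p * i = q * j'" by (simp only: of_nat_eq_iff)
  then have "q dvd i" using coprime by (metis coprime_commute coprime_dvd_mult_right_iff
      dvd_triv_left)
  then obtain k where k: "i = k * q" by (metis dvd_def mult.commute)
  then have "j' = k * p" using e q by (simp add: mult.left_commute mult.commute)
  moreover have "k \<ge> 1" using assms(2) k j calculation by (cases k) auto
  ultimately show ?thesis using that k j by simp
qed

lemma inv_cancel:
  assumes "n \<noteq> 0" "of_int n * x = (0::'b)" shows "x = 0"
proof -
  obtain c :: 'b where "of_int n * c = 1" using inv[OF assms(1)] by blast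
  then have "x = c * (of_int n * x)" by (metis mult.assoc mult.commute mult.left_neutral)
  then show ?thesis by (simp add: assms)
qed

lemma sum_resonant1:
  assumes "k \<ge> 1" "i = 1 + k * q" "j = k * p" "i + j = d"
  shows "(\<Sum>l = 1..d. if i = 1 + l * q \<and> j = l * p then f l else 0) = (f k :: 'b)"
proof -
  have "k * 1 \<le> k * q" using q by (intro mult_le_mono) auto
  then have "k \<le> d" using assms(2-4) by linarith
  have "(\<Sum>l = 1..d. if i = 1 + l * q \<and> j = l * p then f l else 0) = (\<Sum>l = 1..d.
      if l = k then f l else 0)"
    using assms p q by (intro sum.cong) auto
  then show ?thesis using assms \<open>k \<le> d\<close> by simp
qed

lemma sum_resonant2:
  assumes "k \<ge> 1" "i = k * q" "j = 1 + k * p" "i + j = d"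
  shows "(\<Sum>l = 1..d. if i = l * q \<and> j = 1 + l * p then f l else 0) = (f k :: 'b)"
proof -
  have "k * 1 \<le> k * q" using q by (intro mult_le_mono) auto
  then have "k \<le> d" using assms(2-4) by linarith
  have "(\<Sum>l = 1..d. if i = l * q \<and> j = 1 + l * p then f l else 0) = (\<Sum>l = 1..d.
      if l = k then f l else 0)"
    using assms p q by (intro sum.cong) auto
  then show ?thesis using assms \<open>k \<le> d\<close> by simp
qed

lemma sum_nonresonant1:
  assumes "int p * int i - int q * int j - int p \<noteq> 0"
  shows "(\<Sum>l = 1..d. if i = 1 + l * q \<and> j = l * p then f l else 0) = (0 :: 'b)"
  using assms by (intro sum.neutral) (auto simp: algebra_simps)

lemma sum_nonresonant2:
  assumes "int p * int i - int q * int j + int q \<noteq> 0"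
  shows "(\<Sum>l = 1..d. if i = l * q \<and> j = 1 + l * p then f l else 0) = (0 :: 'b)"
  using assms by (intro sum.neutral) (auto simp: algebra_simps)

text \<open>On a nonresonant monomial the eigenvalue is a nonzero integer and determines the
  coefficient of the change. On a resonant one the eigenvalue is zero, but there the change has no
  term, and the residual determines the coefficient of the normal form instead.\<close>

lemma agree_step:
  assumes ag: "agree d \<phi> \<psi> a b \<phi>' \<psi>' a' b'" and d: "d \<ge> 2"
    and normal_below: "normal_below (Suc d) \<phi> \<psi> a b" "normal_below (Suc d) \<phi>' \<psi>' a' b'"
  shows "agree (Suc d) \<phi> \<psi> a b \<phi>' \<psi>' a' b'"
proof -
  have s: "admissible \<phi> \<psi>" "admissible \<phi>' \<psi>'" using normal_below by (simp_all add: normal_below_def)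
  note D = res_diff_nth[OF ag s d]
  have Z: "res1 \<phi> \<psi> a $ i $ j = 0" "res1 \<phi>' \<psi>' a' $ i $ j = 0"
      "res2 \<phi> \<psi> b $ i $ j = 0" "res2 \<phi>' \<psi>' b' $ i $ j = 0" if "i + j = d" for i j
    using normal_below that by (simp_all add: normal_below_def vanishes_below_def)
  have A: "\<phi> i j = \<phi>' i j" if ij: "i + j = d" for i j
  proof (cases "int p * int i - int q * int j - int p = 0")
    case True
    then obtain k where "k \<ge> 1" "i = 1 + k * q" "j = k * p" using resonance1 ij d by blast
    then show ?thesis using s by (simp add: admissible_def)
  next
    case False
    have "\<phi> i j - \<phi>' i j = 0"
      by (rule inv_cancel[OF False]) (use D(1)[OF ij] Z[OF ij] sum_nonresonant1[OF False] in simp)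
    then show ?thesis by simp
  qed
  have B: "\<psi> i j = \<psi>' i j" if ij: "i + j = d" for i j
  proof (cases "int p * int i - int q * int j + int q = 0")
    case True
    then obtain k where "k \<ge> 1" "i = k * q" "j = 1 + k * p" using resonance2 ij d by blast
    then show ?thesis using s by (simp add: admissible_def)
  next
    case False
    have "\<psi> i j - \<psi>' i j = 0"
      by (rule inv_cancel[OF False]) (use D(2)[OF ij] Z[OF ij] sum_nonresonant2[OF False] in simp)
    then show ?thesis by simp
  qed
  have C: "a k = a' k" "b k = b' k" if k: "k \<ge> 1" "1 + k * (p + q) = d" for k
  proof -
    have ij: "1 + k * q + k * p = d" "k * q + (1 + k * p) = d" using k by (auto simp: algebra_simps)
    have "of_int (int p) * (a k - a' k) = 0"
      using D(1)[OF ij(1)] Z[OF ij(1)] A[OF ij(1)] sum_resonant1[OF k(1) refl refl ij(1)] by simp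
    moreover have "of_int (int q) * (b k - b' k) = 0"
      using D(2)[OF ij(2)] Z[OF ij(2)] B[OF ij(2)] sum_resonant2[OF k(1) refl refl ij(2)] by simp
    ultimately show "a k = a' k" "b k = b' k"
      using inv_cancel[of "int p" "a k - a' k"] inv_cancel[of "int q" "b k - b' k"] p q by auto
  qed
  show ?thesis using ag A B C unfolding agree_def less_Suc_eq by blast
qed

lemma normal_below_mono: "normal_below d \<phi> \<psi> a b \<Longrightarrow> e \<le> d \<Longrightarrow> normal_below e \<phi> \<psi> a b"
  unfolding normal_below_def using vanishes_below_mono by blast

lemma normal_below_unique:
  assumes "normal_below d \<phi> \<psi> a b" "normal_below d \<phi>' \<psi>' a' b'"
  shows "agree d \<phi> \<psi> a b \<phi>' \<psi>' a' b'"
  using assms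
proof (induction d)
  case 0
  then show ?case by (simp add: agree_def)
next
  case (Suc d)
  show ?case
  proof (cases "d \<ge> 2")
    case True
    then show ?thesis using Suc normal_below_mono by (intro agree_step) auto
  next
    case False
    \<comment> \<open>In degrees below two admissibility fixes everything: \<open>p + q\<close> is
      at least two, so no resonant coefficient enters yet.\<close>
    have "\<not> 1 + k * (p + q) < Suc d" if "k \<ge> 1" for k
    proof -
      have "1 * 2 \<le> k * (p + q)" using that p q by (intro mult_le_mono) auto
      then show ?thesis using False by simp
    qed
    then show ?thesis using Suc.prems False unfolding agree_def normal_below_def admissible_def
      by auto
  qed
qed

text \<open>The induction can start with any admissible change: the linear parts of \<open>X\<close>
  and \<open>Y\<close> are eigenvectors of the linear field, and all other terms have order at least
  two.\<close>

lemma normal_below_2: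
  assumes s: "admissible \<phi> \<psi>"
  shows "normal_below 2 \<phi> \<psi> a b"
proof -
    have "vanishes_below 1 (Z \<phi> \<psi>)" using vanishes_below_add[OF vanishes_below_mono[OF
        vanishes_below_Z[OF s]] vanishes_below_monomial[of 1 q p]] p by simp
    then have R: "vanishes_below 1 (resonant_sum c (Z \<phi> \<psi>))" for c
        by (rule vanishes_below_resonant_sum)
    have "vanishes_below 2 (residual p q P Q m c U (Z \<phi> \<psi>))"
      if U: "vanishes_below 2 (U - monomial e1 e2)" and e: "e1 + e2 = 1"
          and m: "m = int p * int e1 - int q * int e2" for m c U e1 e2
    proof -
      let ?fl = "flow (of_nat p * var_x + P) (- of_nat q * var_y + Q)"
      have "vanishes_below 1 ((U - monomial e1 e2) + monomial e1 e2)" using e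
          by (intro vanishes_below_add vanishes_below_monomial) (auto intro:
          vanishes_below_mono[OF U])
      then have "vanishes_below (1 + 1) (U * resonant_sum c (Z \<phi> \<psi>))" using R
          by (intro vanishes_below_mult) simp_all
      moreover have "vanishes_below 2 (deriv_x U * P + deriv_y U * Q)"
          by (intro vanishes_below_add vanishes_below_mult_left P Q)
      ultimately have 0: "(U * resonant_sum c (Z \<phi> \<psi>)) $ i $ j = 0"
          "(deriv_x U * P + deriv_y U * Q) $ i $ j = 0" if "i + j < 2" for i j
        using that by (simp_all only: vanishes_below_def one_add_one)
      have "of_int (int p * int i - int q * int j - m) * U $ i $ j = 0" if "i + j < 2" for i j
      proof -
        have "U $ i $ j = (if i = e1 \<and> j = e2 then 1 else 0)"
          using U that by (simp add: vanishes_below_def monomial_nth)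
        then show ?thesis using m by simp
      qed
      then show ?thesis unfolding vanishes_below_def residual_nth using 0 by simp
    qed
    from this[OF vanishes_below_X[OF s]] this[OF vanishes_below_Y[OF s]] show ?thesis
      unfolding res1_def res2_def normal_below_def using s by simp
qed

lemma normal_below_cong:
  assumes ag: "agree d \<phi> \<psi> a b \<phi>' \<psi>' a' b'" and s: "admissible \<phi> \<psi>"
      and normal_below: "normal_below d \<phi>' \<psi>' a' b'"
  shows "normal_below d \<phi> \<psi> a b"
proof -
  have s': "admissible \<phi>' \<psi>'" using normal_below by (simp add: normal_below_def)
  have sm: "res1 \<phi> \<psi> a $ i $ j = 0 \<and> res2 \<phi> \<psi> b $ i $ j = 0" if "i + j < 2" for i j
    using normal_below_2[OF s] that by (simp add: normal_below_def vanishes_below_def)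
  have lg: "res1 \<phi> \<psi> a $ i $ j = 0 \<and> res2 \<phi> \<psi> b $ i $ j = 0" if ij: "i + j < d" "i + j \<ge> 2" for i j
  proof -
    let ?e = "i + j"
    have "agree (Suc ?e) \<phi> \<psi> a b \<phi>' \<psi>' a' b'" using ag that by (simp add: agree_def)
    then have ag': "agree ?e \<phi> \<psi> a b \<phi>' \<psi>' a' b'"
      and eq: "\<phi> i j = \<phi>' i j" "\<psi> i j = \<psi>' i j" "\<And>k. k \<ge> 1 \<Longrightarrow> 1 + k * (p + q) = ?e \<Longrightarrow>
          a k = a' k \<and> b k = b' k"
      by (auto simp: agree_def)
    have s1: "(\<Sum>k = 1..?e. if i = 1 + k * q \<and> j = k * p then a k - a' k else 0) = 0"
      using eq(3) by (intro sum.neutral) (auto simp: algebra_simps)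
    have s2: "(\<Sum>k = 1..?e. if i = k * q \<and> j = 1 + k * p then b k - b' k else 0) = 0"
      using eq(3) by (intro sum.neutral) (auto simp: algebra_simps)
    show ?thesis using res_diff_nth[OF ag' s s' ij(2) refl] s1 s2 eq(1,2) normal_below ij
      by (simp add: normal_below_def vanishes_below_def)
  qed
  show ?thesis unfolding normal_below_def vanishes_below_def using sm lg s by (metis not_less)
qed

text \<open>The defect in degree \<open>d\<close> is removed by solving the homological equation.
  Nonresonant terms are divided by their eigenvalue, and resonant ones are absorbed into the normal
  form.\<close>

lemma normal_below_step:
  assumes normal_below: "normal_below d \<phi> \<psi> a b" and d: "d \<ge> 2"
  obtains \<phi>' \<psi>' a' b' where "normal_below (Suc d) \<phi>' \<psi>' a' b'"
proof -
  have s: "admissible \<phi> \<psi>" using normal_below by (simp add: normal_below_def)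
  define iv where "iv n = (SOME c::'b. of_int n * c = 1)" for n
  have iv: "of_int n * (iv n * x) = x" if "n \<noteq> 0" for n x
    using someI_ex[OF inv[OF that]] by (simp add: iv_def flip: mult.assoc)
  define e1 where "e1 i j = int p * int i - int q * int j - int p" for i j
  define e2 where "e2 i j = int p * int i - int q * int j + int q" for i j
  define \<phi>' where "\<phi>' i j = (if i + j = d \<and> e1 i j \<noteq> 0 then \<phi> i j - iv (e1 i j) * res1 \<phi> \<psi> a $ i $
      j else \<phi> i j)" for i j
  define \<psi>' where "\<psi>' i j = (if i + j = d \<and> e2 i j \<noteq> 0 then \<psi> i j - iv (e2 i j) * res2 \<phi> \<psi> b $ i $
      j else \<psi> i j)" for i j
  \<comment> \<open>The sign is opposite to that in \<open>b'\<close> because resonant coefficients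
    enter the first residual with the factor \<open>- p\<close> and the second with
    \<open>q\<close>.\<close>
  define a' where "a' k = (if 1 + k * (p + q) = d then a k + iv (int p) * res1 \<phi> \<psi> a $ (1 + k * q)
      $ (k * p) else a k)" for k
  define b' where "b' k = (if 1 + k * (p + q) = d then b k - iv (int q) * res2 \<phi> \<psi> b $ (k * q) $
      (1 + k * p) else b k)" for k
  have ag: "agree d \<phi>' \<psi>' a' b' \<phi> \<psi> a b" by (simp add: agree_def \<phi>'_def \<psi>'_def a'_def b'_def)
  have e0: "e1 (1 + k * q) (k * p) = 0" "e2 (k * q) (1 + k * p) = 0" for k
    by (simp_all add: e1_def e2_def algebra_simps)
  have s': "admissible \<phi>' \<psi>'" using s d e0 by (auto simp: admissible_def \<phi>'_def \<psi>'_def)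
  have normal_below': "normal_below d \<phi>' \<psi>' a' b'" by (rule normal_below_cong[OF ag s'
      normal_below])
  have 1: "res1 \<phi>' \<psi>' a' $ i $ j = 0" if ij: "i + j = d" for i j
  proof (cases "e1 i j = 0")
    case True
    then obtain k where k: "k \<ge> 1" "i = 1 + k * q" "j = k * p"
        using resonance1 ij d unfolding e1_def by blast
    then have "1 + k * (p + q) = d" using ij by (simp add: algebra_simps)
    then show ?thesis using res_diff_nth(1)[OF ag s' s d ij] sum_resonant1[OF k ij] True iv[of
        "int p"] p k(2,3)
      unfolding e1_def[symmetric] by (simp add: a'_def)
  next
    case False
    then show ?thesis using res_diff_nth(1)[OF ag s' s d ij] sum_nonresonant1[OF False[unfolded
        e1_def]] iv[OF False] ij
      unfolding e1_def[symmetric] by (simp add: \<phi>'_def)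
  qed
  have 2: "res2 \<phi>' \<psi>' b' $ i $ j = 0" if ij: "i + j = d" for i j
  proof (cases "e2 i j = 0")
    case True
    then obtain k where k: "k \<ge> 1" "i = k * q" "j = 1 + k * p"
        using resonance2 ij d unfolding e2_def by blast
    then have "1 + k * (p + q) = d" using ij by (simp add: algebra_simps)
    then show ?thesis using res_diff_nth(2)[OF ag s' s d ij] sum_resonant2[OF k ij] True iv[of
        "int q"] q k(2,3)
      unfolding e2_def[symmetric] by (simp add: b'_def)
  next
    case False
    then show ?thesis using res_diff_nth(2)[OF ag s' s d ij] sum_nonresonant2[OF False[unfolded
        e2_def]] iv[OF False] ij
      unfolding e2_def[symmetric] by (simp add: \<psi>'_def)
  qed
  have "normal_below (Suc d) \<phi>' \<psi>' a' b'" using normal_below' 1 2 unfolding normal_below_def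
      vanishes_below_def less_Suc_eq by blast
  then show ?thesis by (rule that)
qed

lemma normal_below_exists: "\<exists>\<phi> \<psi> a b. normal_below d \<phi> \<psi> a b"
proof -
  have "normal_below 2 (\<lambda>_ _. 0) (\<lambda>_ _. 0) (\<lambda>_. 0) (\<lambda>_. 0)"
    by (rule normal_below_2) (simp add: admissible_def)
  then have "\<exists>\<phi> \<psi> a b. normal_below (2 + d) \<phi> \<psi> a b" for d
  proof (induction d)
    case (Suc d)
    then obtain \<phi> \<psi> a b where "normal_below (2 + d) \<phi> \<psi> a b" by auto
    then show ?case using normal_below_step[of "2 + d"] by (metis add_Suc_right le_add1)
  qed auto
  then show ?thesis using normal_below_mono by (meson le_add2)
qed

theorem normalizes_exists: "\<exists>\<phi> \<psi> a b. normalizes p q P Q \<phi> \<psi> a b"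
proof -
  have "\<exists>t. normal_below d (fst t) (fst (snd t)) (fst (snd (snd t))) (snd (snd (snd t)))" for d
    using normal_below_exists[of d] by auto
  then obtain T where T: "\<And>d. normal_below d (fst (T d)) (fst (snd (T d))) (fst (snd (snd (T d))))
      (snd (snd (snd (T d))))"
    by metis
  define \<Phi> where "\<Phi> d = fst (T d)" for d
  define \<Psi> where "\<Psi> d = fst (snd (T d))" for d
  define A where "A d = fst (snd (snd (T d)))" for d
  define B where "B d = snd (snd (snd (T d)))" for d
  have normal_below: "normal_below d (\<Phi> d) (\<Psi> d) (A d) (B d)" for d using T
      by (simp add: \<Phi>_def \<Psi>_def A_def B_def)
  have ag: "agree d (\<Phi> d) (\<Psi> d) (A d) (B d) (\<Phi> e) (\<Psi> e) (A e) (B e)" if "d \<le> e" for d e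
    by (intro normal_below_unique normal_below normal_below_mono[OF normal_below that])
  \<comment> \<open>By uniqueness the coefficient of \<open>x ^ i * y ^ j\<close> is the same in all
    approximations from index \<open>Suc (i + j)\<close> on, the first one that settles degree
    \<open>i + j\<close>. The limit is read off diagonally.\<close>
  define \<phi> where "\<phi> i j = \<Phi> (Suc (i + j)) i j" for i j
  define \<psi> where "\<psi> i j = \<Psi> (Suc (i + j)) i j" for i j
  define a where "a k = A (Suc (1 + k * (p + q))) k" for k
  define b where "b k = B (Suc (1 + k * (p + q))) k" for k
  have ag2: "agree d \<phi> \<psi> a b (\<Phi> d) (\<Psi> d) (A d) (B d)" for d
    unfolding agree_def \<phi>_def \<psi>_def a_def b_def
    using ag[unfolded agree_def] by (metis Suc_leI lessI)
  have "admissible \<phi> \<psi>"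
    unfolding admissible_def \<phi>_def \<psi>_def using normal_below unfolding normal_below_def
        admissible_def by simp
  then have "normal_below d \<phi> \<psi> a b" for d using normal_below_cong[OF ag2 _ normal_below] by blast
  then have "normalizes p q P Q \<phi> \<psi> a b"
    by (auto simp: normalizes_iff normal_below_def intro: vanishes_below_all_imp_zero)
  then show ?thesis by blast
qed

theorem normalizes_unique:
  assumes "normalizes p q P Q \<phi> \<psi> a b" "normalizes p q P Q \<phi>' \<psi>' a' b'"
  shows "\<phi> = \<phi>'" "\<psi> = \<psi>'" "\<And>k. k \<ge> 1 \<Longrightarrow> a k = a' k" "\<And>k. k \<ge> 1 \<Longrightarrow> b k = b' k"
proof -
  have "agree d \<phi> \<psi> a b \<phi>' \<psi>' a' b'" for d
    using assms by (intro normal_below_unique normalizes_imp_normal_below)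
  then show "\<phi> = \<phi>'" "\<psi> = \<psi>'" "\<And>k. k \<ge> 1 \<Longrightarrow> a k = a' k" "\<And>k. k \<ge> 1 \<Longrightarrow> b k = b' k"
    unfolding agree_def by (blast intro: lessI)+
qed

end

section \<open>Hilbert's basis theorem\<close>

text \<open>Subrings are sets inside a type, since the polynomial rings in finitely many
  indeterminates are cut out of a type with infinitely many.\<close>

definition closed_ring :: "'r::comm_ring_1 set \<Rightarrow> bool" where
  "closed_ring A \<longleftrightarrow> 0 \<in> A \<and> 1 \<in> A \<and> (\<forall>a\<in>A. \<forall>b\<in>A. a + b \<in> A \<and> a * b \<in> A) \<and> (\<forall>a\<in>A. - a \<in> A)"

lemma closed_ringD:
  assumes "closed_ring A"
  shows "0 \<in> A" "1 \<in> A" "a \<in> A \<Longrightarrow> b \<in> A \<Longrightarrow> a + b \<in> A" "a \<in> A \<Longrightarrow> b \<in> A \<Longrightarrow> a * b \<in> A"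
    "a \<in> A \<Longrightarrow> - a \<in> A"
  using assms by (auto simp: closed_ring_def)

lemma closed_ring_power: "closed_ring A \<Longrightarrow> a \<in> A \<Longrightarrow> a ^ n \<in> A"
  by (induction n) (auto simp: closed_ringD)

lemma closed_ring_sum: "closed_ring A \<Longrightarrow> (\<And>x. x \<in> S \<Longrightarrow> f x \<in> A) \<Longrightarrow> sum f S \<in> A"
  by (induction S rule: infinite_finite_induct) (auto simp: closed_ringD)

lemma closed_ring_prod: "closed_ring A \<Longrightarrow> (\<And>x. x \<in> S \<Longrightarrow> f x \<in> A) \<Longrightarrow> prod f S \<in> A"
  by (induction S rule: infinite_finite_induct) (auto simp: closed_ringD)

text \<open>Linear combinations are built one summand at a time; the resulting induction is what
  later refutes membership of a saddle value.\<close>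

inductive_set span_ideal :: "'r::comm_ring_1 set \<Rightarrow> 'r set \<Rightarrow> 'r set" for A S where
  zero: "0 \<in> span_ideal A S"
| step: "a \<in> A \<Longrightarrow> s \<in> S \<Longrightarrow> x \<in> span_ideal A S \<Longrightarrow> a * s + x \<in> span_ideal A S"

lemma span_ideal_base: "closed_ring A \<Longrightarrow> s \<in> S \<Longrightarrow> s \<in> span_ideal A S"
  using span_ideal.step[OF closed_ringD(2) _ span_ideal.zero] by fastforce

lemma span_ideal_add: "x \<in> span_ideal A S \<Longrightarrow> y \<in> span_ideal A S \<Longrightarrow> x + y \<in> span_ideal A S"
  by (induction rule: span_ideal.induct) (auto simp: add.assoc intro: span_ideal.step)

lemma span_ideal_mult: "x \<in> span_ideal A S \<Longrightarrow> closed_ring A \<Longrightarrow> b \<in> A \<Longrightarrow> b * x \<in> span_ideal A S"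
proof (induction rule: span_ideal.induct)
  case (step a s x)
  have "b * (a * s + x) = (b * a) * s + b * x" by (simp add: algebra_simps)
  then show ?case using step by (auto intro: span_ideal.step simp: closed_ringD)
qed (simp add: span_ideal.zero)

lemma span_ideal_diff: "closed_ring A \<Longrightarrow> x \<in> span_ideal A S \<Longrightarrow> y \<in> span_ideal A S \<Longrightarrow>
    x - y \<in> span_ideal A S"
  using span_ideal_add[of x A S "(-1) * y"] span_ideal_mult[of y A S "-1"]
      by (simp add: closed_ringD)

lemma span_ideal_subset:
  assumes "closed_ring A" "S \<subseteq> span_ideal A T" shows "span_ideal A S \<subseteq> span_ideal A T"
proof
  fix x assume "x \<in> span_ideal A S"
  then show "x \<in> span_ideal A T"
    by induction (use assms in \<open>auto intro!: span_ideal.zero span_ideal_add span_ideal_mult\<close>)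
qed

lemma span_ideal_mono: "x \<in> span_ideal A S \<Longrightarrow> S \<subseteq> T \<Longrightarrow> x \<in> span_ideal A T"
  by (induction x rule: span_ideal.induct) (auto intro: span_ideal.intros)

lemma span_ideal_closed: "x \<in> span_ideal A S \<Longrightarrow> closed_ring A \<Longrightarrow> S \<subseteq> A \<Longrightarrow> x \<in> A"
  by (induction rule: span_ideal.induct) (auto simp: closed_ringD subset_iff)

lemma span_ideal_finite:
  assumes "x \<in> span_ideal A S"
  obtains F where "F \<subseteq> S" "finite F" "x \<in> span_ideal A F"
proof -
  have "\<exists>F\<subseteq>S. finite F \<and> x \<in> span_ideal A F" using assms
  proof induction
    case (step a s x)
    then obtain F where "F \<subseteq> S" "finite F" "x \<in> span_ideal A F" by auto
    then have "insert s F \<subseteq> S" "finite (insert s F)" "a * s + x \<in> span_ideal A (insert s F)"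
      using step by (auto intro: span_ideal.step span_ideal_mono[of x A F])
    then show ?case by blast
  qed (auto intro: span_ideal.zero)
  then show ?thesis using that by blast
qed

text \<open>Stated for arbitrary subsets \<open>J\<close> rather than ideals, so that finitely many
  generators can be picked among the saddle values themselves.\<close>

definition noetherian :: "'r::comm_ring_1 set \<Rightarrow> bool" where
  "noetherian A \<longleftrightarrow> (\<forall>J\<subseteq>A. \<exists>F\<subseteq>J. finite F \<and> J \<subseteq> span_ideal A F)"

text \<open>\<open>d\<close> is a formal degree: \<open>c d\<close> may be zero, and
  \<open>b\<close> may have several representations.\<close>

definition poly_repr :: "'r::comm_ring_1 set \<Rightarrow> 'r \<Rightarrow> nat \<Rightarrow> (nat \<Rightarrow> 'r) \<Rightarrow> 'r \<Rightarrow> bool" where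
  "poly_repr A X d c b \<longleftrightarrow> (\<forall>i. c i \<in> A) \<and> b = (\<Sum>i\<le>d. c i * X ^ i)"

lemma poly_repr_add:
  "closed_ring A \<Longrightarrow> poly_repr A X d c b \<Longrightarrow> poly_repr A X d c' b' \<Longrightarrow>
      poly_repr A X d (\<lambda>i. c i + c' i) (b + b')"
  by (auto simp: poly_repr_def closed_ringD sum.distrib algebra_simps)

lemma poly_repr_smult:
  "closed_ring A \<Longrightarrow> a \<in> A \<Longrightarrow> poly_repr A X d c b \<Longrightarrow> poly_repr A X d (\<lambda>i. a * c i) (a * b)"
  by (auto simp: poly_repr_def closed_ringD sum_distrib_left mult.assoc)

lemma poly_repr_shift:
  assumes "closed_ring A" "poly_repr A X d c b"
  shows "poly_repr A X (e + d) (\<lambda>i. if i < e then 0 else c (i - e)) (X ^ e * b)"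
proof -
  have "(\<Sum>i\<le>e + d. (if i < e then 0 else c (i - e)) * X ^ i)
      = (\<Sum>i=0+e..d+e. (if i < e then 0 else c (i - e)) * X ^ i)"
    by (intro sum.mono_neutral_right) auto
  also have "\<dots> = (\<Sum>i=0..d. c i * X ^ (i + e))"
    by (subst sum.shift_bounds_cl_nat_ivl) simp
  finally show ?thesis using assms
    by (auto simp: poly_repr_def closed_ringD sum_distrib_left power_add algebra_simps
        atLeast0AtMost)
qed

lemma poly_repr_le:
  assumes "closed_ring A" "poly_repr A X d c b" "d \<le> e"
  shows "poly_repr A X e (\<lambda>i. if i \<le> d then c i else 0) b"
proof -
  have "(\<Sum>i\<le>e. (if i \<le> d then c i else 0) * X ^ i) = (\<Sum>i\<le>d. (if i \<le> d then c i else 0) * X ^ i)"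
    by (intro sum.mono_neutral_right) (use assms in auto)
  then show ?thesis using assms by (auto simp: poly_repr_def closed_ringD)
qed

text \<open>The generator \<open>X\<close> need not be transcendental over \<open>A\<close>.\<close>

theorem noetherian_extension:
  fixes A B :: "'r::comm_ring_1 set"
  assumes A: "closed_ring A" and B: "closed_ring B" and AB: "A \<subseteq> B" and X: "X \<in> B"
    and repr: "\<And>b. b \<in> B \<Longrightarrow> \<exists>d c. poly_repr A X d c b" and noe: "noetherian A"
  shows "noetherian B"
proof (rule ccontr)
  assume "\<not> noetherian B"
  then obtain J where J: "J \<subseteq> B" "\<And>F. F \<subseteq> J \<Longrightarrow> finite F \<Longrightarrow> \<not> J \<subseteq> span_ideal B F"
    unfolding noetherian_def by blast
  \<comment> \<open>The argument subtracts elements from each other, so it runs in the ideal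
    generated by \<open>J\<close>.\<close>
  define K where "K = span_ideal B J"
  have JK: "J \<subseteq> K" using span_ideal_base[OF B] by (auto simp: K_def)
  have KB: "K \<subseteq> B" using span_ideal_closed[OF _ B J(1)] by (auto simp: K_def)
  have nfin: "K - span_ideal B F \<noteq> {}" if F: "F \<subseteq> K" "finite F" for F
  proof
    assume "K - span_ideal B F = {}"
    then have KF: "K \<subseteq> span_ideal B F" by blast
    have "\<forall>x\<in>F. \<exists>G\<subseteq>J. finite G \<and> x \<in> span_ideal B G"
      using F(1) span_ideal_finite unfolding K_def by (metis subsetD)
    then obtain G where G: "\<And>x. x \<in> F \<Longrightarrow> G x \<subseteq> J \<and> finite (G x) \<and> x \<in> span_ideal B (G x)" by metis
    have "F \<subseteq> span_ideal B (\<Union>x\<in>F. G x)" using G by (blast intro: span_ideal_mono)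
    then have "J \<subseteq> span_ideal B (\<Union>x\<in>F. G x)" using span_ideal_subset[OF B] JK KF by blast
    moreover have "(\<Union>x\<in>F. G x) \<subseteq> J" "finite (\<Union>x\<in>F. G x)" using G F by auto
    ultimately show False using J(2) by blast
  qed
  \<comment> \<open>Hilbert's choice: each new element has the least formal degree among the
    elements of \<open>K\<close> outside the ideal of its predecessors.\<close>
  define mindeg where "mindeg F = (LEAST d. \<exists>c. \<exists>b\<in>K - span_ideal B F. poly_repr A X d c b)" for F
  have "\<exists>b c. b \<in> K - span_ideal B F \<and> poly_repr A X (mindeg F) c b" if F: "F \<subseteq> K" "finite F" for F
  proof -
    obtain b where b: "b \<in> K - span_ideal B F" using nfin[OF F] by blast
    then obtain d c where "poly_repr A X d c b" using repr KB by blast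
    then have "\<exists>d c. \<exists>b\<in>K - span_ideal B F. poly_repr A X d c b" using b by blast
    from LeastI_ex[OF this] show ?thesis unfolding mindeg_def by blast
  qed
  then obtain pick cf where pick: "\<And>F. F \<subseteq> K \<Longrightarrow> finite F \<Longrightarrow>
      pick F \<in> K - span_ideal B F \<and> poly_repr A X (mindeg F) (cf F) (pick F)"
    by metis
  have minimal: "mindeg F \<le> d" if "b \<in> K - span_ideal B F" "poly_repr A X d c b" for F b c d
    unfolding mindeg_def by (rule Least_le) (use that in blast)
  define Fs where "Fs = rec_nat {} (\<lambda>_ F. insert (pick F) F)"
  define f where "f n = pick (Fs n)" for n
  define d where "d n = mindeg (Fs n)" for n
  \<comment> \<open>The leading coefficients, taken at the minimal formal degree. Noetherianity of
    \<open>A\<close> makes some \<open>a N\<close> a combination of earlier ones.\<close>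
  define a where "a n = cf (Fs n) (d n)" for n
  have Fs: "Fs n = f ` {..<n}" for n
    by (induction n) (auto simp: Fs_def f_def lessThan_Suc)
  have "Fs n \<subseteq> K \<and> finite (Fs n)" for n
  proof (induction n)
    case (Suc n)
    then show ?case using pick[of "Fs n"] by (simp add: Fs_def)
  qed (simp add: Fs_def)
  note pick = pick[OF conjunct1[OF this] conjunct2[OF this], folded f_def d_def]
  have dmono: "d i \<le> d n" if "i \<le> n" for i n
  proof -
    have "Fs i \<subseteq> Fs n" using that by (auto simp: Fs)
    then have "f n \<notin> span_ideal B (Fs i)" using pick[of n] span_ideal_mono[of "f n" B "Fs i" "Fs
        n"] by auto
    then show ?thesis using minimal[of "f n" "Fs i" "d n"] pick[of n] by (auto simp: d_def)
  qed
  have aA: "a n \<in> A" for n using pick[of n] by (simp add: a_def poly_repr_def)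
  then obtain G where G: "G \<subseteq> range a" "finite G" "range a \<subseteq> span_ideal A G"
    using noe unfolding noetherian_def by (metis image_subset_iff)
  then obtain I where I: "finite I" "G = a ` I" by (metis finite_subset_image)
  then obtain N where N: "I \<subseteq> {..<N}" using finite_nat_set_iff_bounded by auto
  have "a N \<in> span_ideal A (a ` {..<N})"
  proof (rule span_ideal_mono)
    show "a N \<in> span_ideal A G" using G(3) by blast
    show "G \<subseteq> a ` {..<N}" unfolding I(2) by (rule image_mono[OF N])
  qed
  \<comment> \<open>The combination of leading coefficients is lifted to the elements themselves.
    Since the degrees increase weakly, a power of \<open>X\<close> brings each earlier
    \<open>f i\<close> to formal degree \<open>d N\<close>.\<close>
  then have "\<exists>g\<in>span_ideal B (f ` {..<N}). \<exists>c. poly_repr A X (d N) c g \<and> c (d N) = a N"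
  proof induction
    case zero
    show ?case by (rule bexI[of _ 0]) (auto simp: poly_repr_def closed_ringD[OF A] span_ideal.zero
        intro!: exI[of _ "\<lambda>_. 0"])
  next
    case (step r s x)
    then obtain g c i where g: "g \<in> span_ideal B (f ` {..<N})" "poly_repr A X (d N) c g" "c (d N)
        = x"
      and i: "i < N" "s = a i" by auto
    let ?e = "d N - d i"
    have e: "?e + d i = d N" using dmono[of i N] i by simp
    have "poly_repr A X (d N) (\<lambda>l. r * (if l < ?e then 0 else cf (Fs i) (l - ?e)) + c l) (r * (X ^
        ?e * f i) + g)"
      using poly_repr_shift[OF A, of X "d i" "cf (Fs i)" "f i" ?e] pick[of i]
      by (intro poly_repr_add[OF A] poly_repr_smult[OF A] step g) (simp add: e)
    moreover have "r * (if d N < ?e then 0 else cf (Fs i) (d N - ?e)) + c (d N) = r * s + x"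
      using e i g(3) dmono[of i N] by (simp add: a_def)
    moreover have "(r * X ^ ?e) * f i + g \<in> span_ideal B (f ` {..<N})"
      using step i g(1) AB by (intro span_ideal.step) (auto simp: closed_ringD[OF B]
          closed_ring_power[OF B X])
    ultimately show ?case unfolding mult.assoc by (intro bexI exI conjI)
  qed
  then obtain g c where g: "g \<in> span_ideal B (f ` {..<N})" "poly_repr A X (d N) c g" "c (d N)
      = a N" by blast
  \<comment> \<open>The leading coefficients cancel, so \<open>?h\<close> has smaller formal degree
    and is still outside the ideal of the predecessors, against minimality. If \<open>d N\<close> is
    zero, \<open>?h\<close> itself is zero.\<close>
  let ?h = "f N - g" and ?c = "\<lambda>i. cf (Fs N) i + (-1) * c i"
  have h: "?h \<notin> span_ideal B (Fs N)"
    using span_ideal_add[of ?h B "Fs N" g] g(1) pick[of N] by (auto simp: Fs)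
  have "g \<in> K" using g(1) \<open>\<And>n. Fs n \<subseteq> K \<and> finite (Fs n)\<close>[of N] span_ideal_subset[OF B, of "Fs N" J]
    by (auto simp: K_def Fs)
  then have hK: "?h \<in> K" using pick[of N] span_ideal_diff[OF B] by (auto simp: K_def)
  have "poly_repr A X (d N) ?c (f N + (-1) * g)"
    using pick[of N] by (intro poly_repr_add[OF A] poly_repr_smult[OF A] g) (auto simp:
        closed_ringD[OF A])
  then have r: "\<And>i. ?c i \<in> A" "?h = (\<Sum>i\<le>d N. ?c i * X ^ i)" and c0: "?c (d N) = 0"
    using g(3) by (auto simp: poly_repr_def a_def)
  show False
  proof (cases "d N")
    case 0
    then have "?h = 0" using r(2) c0 by simp
    then show False using h span_ideal.zero[of B "Fs N"] by simp
  next
    case (Suc m)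
    have "poly_repr A X m ?c ?h" unfolding poly_repr_def using r c0 by (auto simp: Suc)
    then have "d N \<le> m" using minimal[of ?h "Fs N"] hK h by (auto simp: d_def)
    then show False using Suc by simp
  qed
qed

section \<open>Polynomials in finitely many indeterminates\<close>

definition poly_in :: "coeff_var set \<Rightarrow> 'a::field_char_0 coeff_poly set" where
  "poly_in V = {f. \<forall>m \<in> Poly_Mapping.keys f. Poly_Mapping.keys m \<subseteq> V}"

lemma poly_in_iff: "f \<in> poly_in V \<longleftrightarrow> Poly_Mapping.keys f \<subseteq> {m. Poly_Mapping.keys m \<subseteq> V}"
  by (auto simp: poly_in_def)

lemma closed_ring_poly_in: "closed_ring (poly_in V :: 'a::field_char_0 coeff_poly set)"
  unfolding closed_ring_def
proof (intro conjI ballI)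
  fix f g :: "'a coeff_poly" assume fg: "f \<in> poly_in V" "g \<in> poly_in V"
  show "f + g \<in> poly_in V"
    using fg unfolding poly_in_iff by (intro subset_trans[OF keys_add] Un_least)
  have "Poly_Mapping.keys (f * g) \<subseteq> {a + b |a b. a \<in> Poly_Mapping.keys f \<and> b \<in> Poly_Mapping.keys g}"
    by (rule keys_mult)
  also have "\<dots> \<subseteq> {m. Poly_Mapping.keys m \<subseteq> V}"
  proof
    fix m assume "m \<in> {a + b |a b. a \<in> Poly_Mapping.keys f \<and> b \<in> Poly_Mapping.keys g}"
    then obtain a b where m: "m = a + b" and "a \<in> Poly_Mapping.keys f" "b \<in> Poly_Mapping.keys g"
        by blast
    then have "Poly_Mapping.keys a \<subseteq> V" "Poly_Mapping.keys b \<subseteq> V"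
      using fg unfolding poly_in_def by blast+
    then show "m \<in> {m. Poly_Mapping.keys m \<subseteq> V}" using keys_add[of a b] unfolding m by blast
  qed
  finally show "f * g \<in> poly_in V" unfolding poly_in_iff .
qed (simp_all add: poly_in_iff)

lemma poly_mapping_sum_single: "f = (\<Sum>m\<in>Poly_Mapping.keys f. Poly_Mapping.single m
    (Poly_Mapping.lookup f m))"
proof (rule poly_mapping_eqI)
  fix k
  have *: "Poly_Mapping.lookup (Poly_Mapping.single m (Poly_Mapping.lookup f m)) k = (if k
      = m then Poly_Mapping.lookup f k else 0)" for m
    by (simp add: lookup_single when_def)
  have "Poly_Mapping.lookup (\<Sum>m\<in>Poly_Mapping.keys f. Poly_Mapping.single m (Poly_Mapping.lookup f
      m)) k
     = (\<Sum>m\<in>Poly_Mapping.keys f. if k = m then Poly_Mapping.lookup f k else 0)"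
    unfolding lookup_sum * ..
  also have "\<dots> = Poly_Mapping.lookup f k"
    unfolding sum.delta'[OF finite_keys] by (auto simp: in_keys_iff)
  finally show "Poly_Mapping.lookup f k = Poly_Mapping.lookup (\<Sum>m\<in>Poly_Mapping.keys f.
      Poly_Mapping.single m (Poly_Mapping.lookup f m)) k"
    by (rule sym)
qed

lemma indet_power: "(indet v :: 'a::field_char_0 coeff_poly) ^ k
    = Poly_Mapping.single (Poly_Mapping.single v k) 1"
proof (induction k)
  case (Suc k)
  have "(indet v :: 'a coeff_poly) ^ Suc k = indet v * indet v ^ k" by simp
  also have "\<dots> = Poly_Mapping.single (Poly_Mapping.single v 1 + Poly_Mapping.single v k) 1"
    unfolding Suc unfolding indet_def mult_single by simp
  also have "Poly_Mapping.single v 1 + Poly_Mapping.single v k = Poly_Mapping.single v (Suc k)"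
    by (simp flip: single_add)
  finally show ?case .
qed simp

lemma single_in_poly_in: "Poly_Mapping.keys m \<subseteq> V \<Longrightarrow> Poly_Mapping.single m c \<in> poly_in V"
  by (simp add: poly_in_def)

lemma indet_in_poly_in: "v \<in> V \<Longrightarrow> indet v \<in> poly_in V"
  unfolding indet_def by (rule single_in_poly_in) simp

lemma poly_in_mono: "V \<subseteq> W \<Longrightarrow> poly_in V \<subseteq> poly_in W"
  by (auto simp: poly_in_def)

text \<open>Each monomial splits into a power of \<open>v\<close> and a monomial in
  \<open>V\<close>, obtained by resetting the exponent of \<open>v\<close> to zero. The resulting
  representations are padded to a common formal degree and added.\<close>

lemma poly_in_insert_repr:
  fixes b :: "'a::field_char_0 coeff_poly"
  assumes "b \<in> poly_in (insert v V)"
  shows "\<exists>d c. poly_repr (poly_in V) (indet v) d c b"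
proof -
  note A = closed_ring_poly_in[of V]
  have "\<exists>d c. poly_repr (poly_in V) (indet v) d c (\<Sum>m\<in>M. Poly_Mapping.single m
      (Poly_Mapping.lookup b m))"
    if "finite M" "M \<subseteq> Poly_Mapping.keys b" for M
    using that
  proof (induction M)
    case empty
    have "poly_repr (poly_in V) (indet v) 0 (\<lambda>_. 0) (0 :: 'a coeff_poly)"
        by (simp add: poly_repr_def closed_ringD[OF A])
    then show ?case by auto
  next
    case (insert m M)
    then obtain d c where dc: "poly_repr (poly_in V) (indet v) d c (\<Sum>m\<in>M. Poly_Mapping.single m
        (Poly_Mapping.lookup b m))"
      by auto
    let ?k = "Poly_Mapping.lookup m v" and ?m = "Poly_Mapping.update v 0 m"
    have "m = Poly_Mapping.single v ?k + ?m"
      by (rule poly_mapping_eqI) (simp add: lookup_add lookup_single lookup_update when_def)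
    then have eq: "Poly_Mapping.single m (Poly_Mapping.lookup b m)
        = indet v ^ ?k * Poly_Mapping.single ?m (Poly_Mapping.lookup b m)"
      by (simp add: indet_power mult_single)
    have "Poly_Mapping.keys ?m \<subseteq> V"
      using insert.prems assms by (auto simp: poly_in_def keys_update)
    then have "poly_repr (poly_in V) (indet v) 0 (\<lambda>_. Poly_Mapping.single ?m (Poly_Mapping.lookup
        b m)) (Poly_Mapping.single ?m (Poly_Mapping.lookup b m))"
      by (simp add: poly_repr_def single_in_poly_in)
    from poly_repr_shift[OF A this, of ?k]
    obtain c' where c': "poly_repr (poly_in V) (indet v) ?k c' (Poly_Mapping.single m
        (Poly_Mapping.lookup b m))"
      unfolding eq by auto
    have "poly_repr (poly_in V) (indet v) (max ?k d) (\<lambda>i. (if i \<le> ?k then c' i else 0) + (if i \<le> d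
        then c i else 0))
       (Poly_Mapping.single m (Poly_Mapping.lookup b m) + (\<Sum>m\<in>M. Poly_Mapping.single m
           (Poly_Mapping.lookup b m)))"
      by (intro poly_repr_add[OF A] poly_repr_le[OF A c'] poly_repr_le[OF A dc]) auto
    then show ?case using insert by auto
  qed
  from this[OF finite_keys order_refl] show ?thesis by (simp flip: poly_mapping_sum_single)
qed

theorem noetherian_poly_in: "finite V \<Longrightarrow> noetherian (poly_in V :: 'a::field_char_0 coeff_poly set)"
proof (induction rule: finite_induct)
  case empty
  \<comment> \<open>Without indeterminates only constants remain. They form a field, so a single
    nonzero element of \<open>J\<close> generates.\<close>
  have const: "\<exists>c. f = Poly_Mapping.single 0 c" if "f \<in> poly_in {}" for f :: "'a coeff_poly"
  proof -
    have "Poly_Mapping.keys f \<subseteq> {0}" using that by (auto simp: poly_in_def)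
    then have "f = (\<Sum>m\<in>{0}. Poly_Mapping.single m (Poly_Mapping.lookup f m))"
      by (subst poly_mapping_sum_single) (intro sum.mono_neutral_left, auto simp: in_keys_iff)
    then show ?thesis by auto
  qed
  show ?case unfolding noetherian_def
  proof (intro allI impI)
    fix J :: "'a coeff_poly set" assume J: "J \<subseteq> poly_in {}"
    show "\<exists>F\<subseteq>J. finite F \<and> J \<subseteq> span_ideal (poly_in {}) F"
    proof (cases "J \<subseteq> {0}")
      case True
      then show ?thesis by (intro exI[of _ "{}"]) (auto intro: span_ideal.zero)
    next
      case False
      then obtain s where s: "s \<in> J" "s \<noteq> 0" by blast
      then obtain c where c: "s = Poly_Mapping.single 0 c" using const J by blast
      have "t \<in> span_ideal (poly_in {}) {s}" if "t \<in> J" for t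
      proof -
        obtain e where e: "t = Poly_Mapping.single 0 e" using const J \<open>t \<in> J\<close> by blast
        have "t = Poly_Mapping.single 0 (e / c) * s + 0" using s by (auto simp: c e mult_single)
        also have "\<dots> \<in> span_ideal (poly_in {}) {s}"
          by (intro span_ideal.intros) (simp_all add: single_in_poly_in)
        finally show ?thesis .
      qed
      then show ?thesis using s by (intro exI[of _ "{s}"]) auto
    qed
  qed
next
  case (insert v V)
  show ?case
    by (rule noetherian_extension[OF closed_ring_poly_in closed_ring_poly_in, of V "insert v V"
        "indet v"])
      (use insert in \<open>auto simp: poly_in_insert_repr intro: indet_in_poly_in subsetD[OF
          poly_in_mono]\<close>)
qed

section \<open>Specializing the coefficients\<close>

definition is_ring_hom :: "('b::comm_ring_1 \<Rightarrow> 'c::comm_ring_1) \<Rightarrow> bool" where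
  "is_ring_hom h \<longleftrightarrow> h 1 = 1 \<and> (\<forall>a b. h (a + b) = h a + h b \<and> h (a * b) = h a * h b)"

lemma is_ring_hom_simps:
  assumes "is_ring_hom h"
  shows "h 1 = 1" "h (a + b) = h a + h b" "h (a * b) = h a * h b" "h 0 = 0" "h (- a) = - h a"
    "h (a - b) = h a - h b" "h (of_nat n) = of_nat n" "h (a ^ n) = h a ^ n" "h (sum f S)
        = (\<Sum>x\<in>S. h (f x))"
    "h (prod f S) = (\<Prod>x\<in>S. h (f x))"
proof -
  show 1: "h 1 = 1" and a: "h (a + b) = h a + h b" and m: "h (a * b) = h a * h b" for a b
    using assms by (simp_all add: is_ring_hom_def)
  show 0: "h 0 = 0" using a[of 0 0] by simp
  show n: "h (- a) = - h a" for a using a[of a "- a"] 0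
      by (simp add: eq_neg_iff_add_eq_0 add.commute)
  show "h (a - b) = h a - h b" using a[of a "- b"] n by simp
  show "h (of_nat n) = of_nat n" by (induction n) (simp_all add: 0 1 a)
  show "h (a ^ n) = h a ^ n" by (induction n) (simp_all add: 1 m)
  show "h (sum f S) = (\<Sum>x\<in>S. h (f x))" by (induction S rule: infinite_finite_induct) (simp_all
      add: 0 a)
  show "h (prod f S) = (\<Prod>x\<in>S. h (f x))" by (induction S rule: infinite_finite_induct) (simp_all
      add: 1 m)
qed

section \<open>Normal forms under ring homomorphisms\<close>

definition map_series2 :: "('b \<Rightarrow> 'c) \<Rightarrow> 'b fps fps \<Rightarrow> 'c fps fps" where
  "map_series2 h F = series2 (\<lambda>i j. h (F $ i $ j))"

lemma map_series2_nth [simp]: "map_series2 h F $ i $ j = h (F $ i $ j)"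
  by (simp add: map_series2_def)

lemma map_series2_series2: "map_series2 h (series2 c) = series2 (\<lambda>i j. h (c i j))"
  by (simp add: map_series2_def)

lemma is_ring_hom_map_series2:
  assumes "is_ring_hom h" shows "is_ring_hom (map_series2 h)"
  unfolding is_ring_hom_def
proof (intro conjI allI fps2_ext)
  show "map_series2 h 1 $ i $ j = 1 $ i $ j" for i j
    by (simp add: one_eq_monomial monomial_nth is_ring_hom_simps[OF assms])
  show "map_series2 h (F * G) $ i $ j = (map_series2 h F * map_series2 h G) $ i $ j" for F G i j
    by (simp add: fps2_mult_nth is_ring_hom_simps[OF assms])
qed (simp_all add: is_ring_hom_simps[OF assms])

lemma map_series2_monomial: "is_ring_hom h \<Longrightarrow> map_series2 h (monomial a b) = monomial a b"
  by (rule fps2_ext) (simp add: monomial_nth is_ring_hom_simps)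

lemma map_series2_deriv:
  assumes "is_ring_hom h"
  shows "map_series2 h (deriv_x F) = deriv_x (map_series2 h F)" "map_series2 h (deriv_y F)
      = deriv_y (map_series2 h F)"
  by (auto intro!: fps2_ext simp: deriv_x_nth deriv_y_nth is_ring_hom_simps[OF assms] simp del:
      of_nat_Suc)

lemma map_series2_resonant_sum:
  assumes "is_ring_hom h" shows "map_series2 h (resonant_sum c Z)
      = resonant_sum (\<lambda>k. h (c k)) (map_series2 h Z)"
proof (rule fps2_ext)
  fix i j
  have "h ((Z ^ k) $ i $ j) = (map_series2 h Z ^ k) $ i $ j" for k
    by (simp flip: is_ring_hom_simps(8)[OF is_ring_hom_map_series2[OF assms]])
  then show "map_series2 h (resonant_sum c Z) $ i $ j
      = resonant_sum (\<lambda>k. h (c k)) (map_series2 h Z) $ i $ j"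
    by (simp add: resonant_sum_nth is_ring_hom_simps[OF assms])
qed

text \<open>The defining equations are built from ring operations, derivatives and coefficientwise
  finite sums, all of which commute with a homomorphism of the coefficients.\<close>

lemma map_series2_normalizes:
  assumes h: "is_ring_hom h" and n: "normalizes p q P Q \<phi> \<psi> a b"
  shows "normalizes p q (map_series2 h P) (map_series2 h Q) (\<lambda>i j. h (\<phi> i j)) (\<lambda>i j. h (\<psi> i j))
      (\<lambda>k. h (a k)) (\<lambda>k. h (b k))"
proof -
  note H = is_ring_hom_simps[OF is_ring_hom_map_series2[OF h]] map_series2_deriv[OF h]
      map_series2_resonant_sum[OF h] map_series2_series2
    map_series2_monomial[OF h, of 1 0, folded var_x_eq] map_series2_monomial[OF h, of 0 1, folded
        var_y_eq]
  note n = n[unfolded normalizes_def Let_def]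
  note e1 = arg_cong[of _ _ "map_series2 h", OF n[THEN conjunct2, THEN conjunct2, THEN conjunct1],
      unfolded H]
  note e2 = arg_cong[of _ _ "map_series2 h", OF n[THEN conjunct2, THEN conjunct2, THEN conjunct2],
      unfolded H]
  note s = n[THEN conjunct1, rule_format] n[THEN conjunct2, THEN conjunct1, rule_format]
  show ?thesis unfolding normalizes_def Let_def
    by (intro conjI allI impI; (rule e1 | rule e2 | simp add: s s[simplified]
        is_ring_hom_simps(4)[OF h]))
qed

section \<open>Substitution of values for the indeterminates\<close>

definition eval_monomial :: "('v \<Rightarrow> 'b::comm_ring_1) \<Rightarrow> ('v \<Rightarrow>\<^sub>0 nat) \<Rightarrow> 'b" where
  "eval_monomial \<rho> m = (\<Prod>v\<in>Poly_Mapping.keys m. \<rho> v ^ Poly_Mapping.lookup m v)"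

definition eval_poly :: "('a \<Rightarrow> 'b) \<Rightarrow> (coeff_var \<Rightarrow> 'b::comm_ring_1) \<Rightarrow> 'a::field_char_0 coeff_poly \<Rightarrow>
    'b" where
  "eval_poly e \<rho> f = (\<Sum>m\<in>Poly_Mapping.keys f. e (Poly_Mapping.lookup f m) * eval_monomial \<rho> m)"

lemma eval_monomial_superset:
  "finite S \<Longrightarrow> Poly_Mapping.keys m \<subseteq> S \<Longrightarrow> eval_monomial \<rho> m = (\<Prod>v\<in>S. \<rho> v ^ Poly_Mapping.lookup m v)"
  unfolding eval_monomial_def by (intro prod.mono_neutral_left) (auto simp: in_keys_iff)

lemma eval_monomial_add: "eval_monomial \<rho> (m + m') = eval_monomial \<rho> m * eval_monomial \<rho> m'"
proof -
  let ?S = "Poly_Mapping.keys m \<union> Poly_Mapping.keys m'"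
  have "eval_monomial \<rho> (m + m') = (\<Prod>v\<in>?S. \<rho> v ^ Poly_Mapping.lookup (m + m') v)"
    by (rule eval_monomial_superset[OF _ keys_add]) simp
  also have "\<dots> = (\<Prod>v\<in>?S. \<rho> v ^ Poly_Mapping.lookup m v) * (\<Prod>v\<in>?S. \<rho> v ^ Poly_Mapping.lookup m' v)"
    by (simp add: lookup_add power_add prod.distrib)
  also have "\<dots> = eval_monomial \<rho> m * eval_monomial \<rho> m'"
    by (simp add: eval_monomial_superset[of ?S])
  finally show ?thesis .
qed

lemma eval_poly_superset:
  assumes "is_ring_hom e" "finite S" "Poly_Mapping.keys f \<subseteq> S"
  shows "eval_poly e \<rho> f = (\<Sum>m\<in>S. e (Poly_Mapping.lookup f m) * eval_monomial \<rho> m)"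
  unfolding eval_poly_def by (intro sum.mono_neutral_left) (use assms in \<open>auto simp: in_keys_iff
      is_ring_hom_simps\<close>)

lemma eval_poly_add:
  assumes "is_ring_hom e" shows "eval_poly e \<rho> (f + g) = eval_poly e \<rho> f + eval_poly e \<rho> g"
proof -
  let ?S = "Poly_Mapping.keys f \<union> Poly_Mapping.keys g"
  have "eval_poly e \<rho> (f + g) = (\<Sum>m\<in>?S. e (Poly_Mapping.lookup (f + g) m) * eval_monomial \<rho> m)"
    by (rule eval_poly_superset[OF assms _ keys_add]) simp
  also have "\<dots> = eval_poly e \<rho> f + eval_poly e \<rho> g"
    by (simp add: eval_poly_superset[OF assms, of ?S] lookup_add is_ring_hom_simps[OF assms]
        distrib_right sum.distrib)
  finally show ?thesis .
qed

lemma eval_poly_single: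
  assumes "is_ring_hom e" shows "eval_poly e \<rho> (Poly_Mapping.single m c) = e c * eval_monomial \<rho> m"
  using eval_poly_superset[OF assms, of "{m}" "Poly_Mapping.single m c"] by simp

lemma eval_poly_sum:
  assumes "is_ring_hom e" shows "eval_poly e \<rho> (sum f S) = (\<Sum>x\<in>S. eval_poly e \<rho> (f x))"
proof (induction S rule: infinite_finite_induct)
qed (simp_all add: eval_poly_add[OF assms], simp_all add: eval_poly_def)

lemma is_ring_hom_eval_poly:
  fixes e :: "'a::field_char_0 \<Rightarrow> 'b::comm_ring_1"
  assumes e: "is_ring_hom e" shows "is_ring_hom (eval_poly e \<rho>)"
  unfolding is_ring_hom_def
proof (intro conjI allI eval_poly_add[OF e])
  show "eval_poly e \<rho> 1 = 1"
    using eval_poly_single[OF e, of \<rho> 0 1] by (simp add: is_ring_hom_simps[OF e] eval_monomial_def)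
  fix f g :: "'a coeff_poly"
  let ?s = "\<lambda>f m. Poly_Mapping.single m (Poly_Mapping.lookup f m)"
  have "f * g = (\<Sum>a\<in>Poly_Mapping.keys f. ?s f a) * (\<Sum>b\<in>Poly_Mapping.keys g. ?s g b)"
    by (simp flip: poly_mapping_sum_single)
  also have "\<dots> = (\<Sum>a\<in>Poly_Mapping.keys f. \<Sum>b\<in>Poly_Mapping.keys g.
      Poly_Mapping.single (a + b) (Poly_Mapping.lookup f a * Poly_Mapping.lookup g b))"
    by (simp add: sum_product mult_single)
  also have "eval_poly e \<rho> \<dots> = eval_poly e \<rho> f * eval_poly e \<rho> g"
    by (simp add: eval_poly_sum[OF e] eval_poly_single[OF e] is_ring_hom_simps[OF e]
        eval_monomial_add)
      (simp add: eval_poly_def sum_product algebra_simps)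
  finally show "eval_poly e \<rho> (f * g) = eval_poly e \<rho> f * eval_poly e \<rho> g" .
qed

lemma eval_poly_indet:
  assumes "is_ring_hom e" shows "eval_poly e \<rho> (indet v) = \<rho> v"
  by (simp add: indet_def eval_poly_single[OF assms] is_ring_hom_simps[OF assms] eval_monomial_def)

lemma is_ring_hom_single_0: "is_ring_hom (Poly_Mapping.single 0 :: 'a::field_char_0 \<Rightarrow> 'a
    coeff_poly)"
  by (simp add: is_ring_hom_def single_add mult_single)

lemma is_ring_hom_fps_const: "is_ring_hom (fps_const :: 'a::comm_ring_1 \<Rightarrow> 'a fps)"
  by (simp add: is_ring_hom_def)

section \<open>Saddle values of the general system\<close>

lemma resonant_saddle_general:
  assumes "p > 0" "q > 0" "coprime p q"
  shows "resonant_saddle p q (general_P n :: 'a::field_char_0 coeff_poly fps fps) (general_Q n)"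
proof
  show "\<exists>c::'a coeff_poly. of_int m * c = 1" if "m \<noteq> 0" for m
    by (rule exI[of _ "Poly_Mapping.single 0 (inverse (of_int m))"])
      (use that in \<open>simp add: mult_single flip: single_of_int\<close>)
qed (use assms in \<open>auto simp: vanishes_below_def general_P_def general_Q_def\<close>)

text \<open>Existence and uniqueness of the normalization turn the definite description into an
  actual difference of coefficients, for all \<open>k\<close> at once.\<close>

lemma saddle_value_exists:
  assumes "p > 0" "q > 0" "coprime p q"
  obtains \<phi> \<psi> a b where
    "normalizes p q (general_P n :: 'a::field_char_0 coeff_poly fps fps) (general_Q n) \<phi> \<psi> a b"
    "\<And>k. k \<ge> 1 \<Longrightarrow> (saddle_value p q n k :: 'a coeff_poly) = a k - b k"
proof -
  interpret resonant_saddle p q "general_P n :: 'a coeff_poly fps fps" "general_Q n"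
    by (rule resonant_saddle_general[OF assms])
  obtain \<phi> \<psi> a b where n: "normalizes p q (general_P n :: 'a coeff_poly fps fps) (general_Q n) \<phi> \<psi>
      a b"
    using normalizes_exists by blast
  moreover have "(saddle_value p q n k :: 'a coeff_poly) = a k - b k" if "k \<ge> 1" for k
    unfolding saddle_value_def
  proof (rule the_equality)
    show "\<exists>\<phi> \<psi> \<pi>1 \<pi>2. normalizes p q (general_P n) (general_Q n) \<phi> \<psi> \<pi>1 \<pi>2 \<and> a k - b k
        = \<pi>1 k - \<pi>2 k"
      using n by blast
  next
    fix L :: "'a coeff_poly" assume "\<exists>\<phi> \<psi> \<pi>1 \<pi>2. normalizes p q (general_P n) (general_Q n) \<phi> \<psi> \<pi>1
        \<pi>2 \<and> L = \<pi>1 k - \<pi>2 k"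
    then show "L = a k - b k" using normalizes_unique(3,4)[OF n _ that] by metis
  qed
  ultimately show ?thesis using that by blast
qed

text \<open>This replaces the general polynomials by the normal form of one concrete system, which
  may also have coefficients in a ring containing \<open>\<epsilon>\<close>.\<close>

lemma saddle_value_eval:
  fixes h :: "'a::field_char_0 coeff_poly \<Rightarrow> 'b::comm_ring_1"
  assumes "p > 0" "q > 0" "coprime p q" "is_ring_hom h"
  obtains \<phi> \<psi> a b where
    "normalizes p q (map_series2 h (general_P n)) (map_series2 h (general_Q n)) \<phi> \<psi> a b"
    "\<And>k. k \<ge> 1 \<Longrightarrow> h (saddle_value p q n k) = a k - b k"
proof -
  obtain \<phi> \<psi> a b where
    *: "normalizes p q (general_P n :: 'a coeff_poly fps fps) (general_Q n) \<phi> \<psi> a b"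
    "\<And>k. k \<ge> 1 \<Longrightarrow> (saddle_value p q n k :: 'a coeff_poly) = a k - b k"
    using saddle_value_exists[OF assms(1-3), where 'a='a] by blast
  show ?thesis
    by (rule that[OF map_series2_normalizes[OF assms(4) *(1)]]) (simp add: * is_ring_hom_simps[OF
        assms(4)])
qed

text \<open>The homomorphism \<open>h\<close> that sends all indeterminates outside
  \<open>coeff_vars n\<close> to zero fixes the general system. By uniqueness it fixes the saddle
  values, which therefore lie in its image.\<close>

lemma saddle_value_in_ring:
  assumes "p > 0" "q > 0" "coprime p q" "k \<ge> 1"
  shows "(saddle_value p q n k :: 'a::field_char_0 coeff_poly) \<in> poly_in (coeff_vars n)"
proof -
  define \<rho> :: "coeff_var \<Rightarrow> 'a coeff_poly" where "\<rho> v = (if v \<in> coeff_vars n then indet v else 0)"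
      for v
  define h where "h = eval_poly (Poly_Mapping.single 0) \<rho>"
  have h: "is_ring_hom h" unfolding h_def by (rule is_ring_hom_eval_poly[OF is_ring_hom_single_0])
  have "h (indet v) = indet v" if "v \<in> coeff_vars n" for v
    using that by (simp add: h_def eval_poly_indet[OF is_ring_hom_single_0] \<rho>_def)
  then have PQ: "map_series2 h (general_P n) = general_P n" "map_series2 h (general_Q n)
      = general_Q n"
    by (auto intro!: fps2_ext simp: general_P_def general_Q_def is_ring_hom_simps[OF h]
        coeff_vars_def)
  obtain \<phi> \<psi> a b where 1:
    "normalizes p q (general_P n :: 'a coeff_poly fps fps) (general_Q n) \<phi> \<psi> a b"
    "\<And>k. k \<ge> 1 \<Longrightarrow> h (saddle_value p q n k) = a k - b k"
    using saddle_value_eval[OF assms(1-3) h, of n] unfolding PQ by blast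
  obtain \<phi>' \<psi>' a' b' where 2:
    "normalizes p q (general_P n :: 'a coeff_poly fps fps) (general_Q n) \<phi>' \<psi>' a' b'"
    "\<And>k. k \<ge> 1 \<Longrightarrow> (saddle_value p q n k :: 'a coeff_poly) = a' k - b' k"
    using saddle_value_exists[OF assms(1-3), where 'a='a] by blast
  interpret resonant_saddle p q "general_P n :: 'a coeff_poly fps fps" "general_Q n"
    by (rule resonant_saddle_general[OF assms(1-3)])
  have "saddle_value p q n k = h (saddle_value p q n k)"
    using 1(2) 2(2) normalizes_unique(3,4)[OF 1(1) 2(1)] assms(4) by simp
  moreover have "h f \<in> poly_in (coeff_vars n)" for f
  proof -
    have C: "closed_ring (poly_in (coeff_vars n) :: 'a coeff_poly set)"
        by (rule closed_ring_poly_in)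
    have "\<rho> v \<in> poly_in (coeff_vars n)" for v
      using closed_ringD(1)[OF C] by (simp add: \<rho>_def indet_in_poly_in)
    then show ?thesis unfolding h_def eval_poly_def eval_monomial_def
      by (intro closed_ring_sum[OF C] closed_ringD(4)[OF C] closed_ring_prod[OF C]
          closed_ring_power[OF C]
          single_in_poly_in) auto
  qed
  ultimately show ?thesis by metis
qed

section \<open>Ideals in the ring of coefficient polynomials\<close>

lemma finite_coeff_vars: "finite (coeff_vars n)"
proof -
  have "coeff_vars n \<subseteq> (\<lambda>(i, j). CoeffP i j) ` ({..n} \<times> {..n}) \<union> (\<lambda>(i, j). CoeffQ i j) ` ({..n} \<times>
      {..n})"
    unfolding coeff_vars_def by force
  then show ?thesis by (rule finite_subset) auto
qed

lemma carrier_coeff_ring: "carrier (coeff_ring n) = poly_in (coeff_vars n)"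
  by (simp add: coeff_ring_def poly_in_def)

lemma coeff_ring_simps:
  "x \<otimes>\<^bsub>coeff_ring n\<^esub> y = x * y" "x \<oplus>\<^bsub>coeff_ring n\<^esub> y = x + y"
  "\<one>\<^bsub>coeff_ring n\<^esub> = 1" "\<zero>\<^bsub>coeff_ring n\<^esub> = 0"
  by (simp_all add: coeff_ring_def)

lemma cring_coeff_ring: "cring (coeff_ring n :: 'a::field_char_0 coeff_poly ring)"
proof -
  note C = closed_ringD[OF closed_ring_poly_in[of "coeff_vars n", where 'a='a]]
  have "abelian_group (coeff_ring n :: 'a coeff_poly ring)"
  proof (rule abelian_groupI)
    show "\<exists>y\<in>carrier (coeff_ring n). y \<oplus>\<^bsub>coeff_ring n\<^esub> x = \<zero>\<^bsub>coeff_ring n\<^esub>"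
      if "x \<in> carrier (coeff_ring n)" for x :: "'a coeff_poly"
      using that C by (intro bexI[of _ "- x"]) (auto simp: carrier_coeff_ring coeff_ring_simps)
  qed (use C in \<open>auto simp: carrier_coeff_ring coeff_ring_simps algebra_simps\<close>)
  moreover have "comm_monoid (coeff_ring n :: 'a coeff_poly ring)"
    by (rule comm_monoidI) (use C in \<open>auto simp: carrier_coeff_ring coeff_ring_simps algebra_simps\<close>)
  ultimately show ?thesis
    by (rule cringI) (simp add: coeff_ring_simps algebra_simps)
qed

text \<open>The inductive span is an ideal containing \<open>S\<close>, and by induction it lies in
  every other such ideal; hence it is their intersection.\<close>

lemma genideal_coeff_ring:
  fixes S :: "'a::field_char_0 coeff_poly set"
  assumes S: "S \<subseteq> poly_in (coeff_vars n)"
  shows "Idl\<^bsub>coeff_ring n\<^esub> S = span_ideal (poly_in (coeff_vars n)) S" (is "_ = ?I")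
proof -
  interpret R: cring "coeff_ring n :: 'a coeff_poly ring" by (rule cring_coeff_ring)
  note C = closed_ring_poly_in[of "coeff_vars n", where 'a='a]
  have sub: "?I \<subseteq> poly_in (coeff_vars n)" using span_ideal_closed[OF _ C S] by blast
  have minus: "\<ominus>\<^bsub>coeff_ring n\<^esub> x = - x" if "x \<in> poly_in (coeff_vars n)" for x :: "'a coeff_poly"
    by (rule R.minus_equality)
      (use that closed_ringD(5)[OF C] in \<open>auto simp: coeff_ring_simps carrier_coeff_ring\<close>)
  have mult: "x * a \<in> ?I" if "a \<in> ?I" "x \<in> poly_in (coeff_vars n)" for a x
    using span_ideal_mult[OF that(1) C that(2)] .
  then have "a * x \<in> ?I" if "a \<in> ?I" "x \<in> poly_in (coeff_vars n)" for a x
    using that by (simp add: mult.commute)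
  note mult = mult this
  have "ideal ?I (coeff_ring n)"
  proof (rule idealI[OF R.ring_axioms])
    show "subgroup ?I (add_monoid (coeff_ring n))"
    proof (rule R.add.subgroupI)
      show "\<ominus>\<^bsub>coeff_ring n\<^esub> x \<in> ?I" if "x \<in> ?I" for x
        using that sub minus span_ideal_diff[OF C span_ideal.zero that] by auto
    qed (use sub span_ideal.zero in \<open>auto simp: carrier_coeff_ring coeff_ring_simps intro:
        span_ideal_add\<close>)
  qed (use mult in \<open>auto simp: carrier_coeff_ring coeff_ring_simps\<close>)
  moreover have "S \<subseteq> ?I" using span_ideal_base[OF C] by blast
  ultimately have "Idl\<^bsub>coeff_ring n\<^esub> S \<subseteq> ?I" by (rule R.genideal_minimal)
  moreover have "x \<in> J" if J: "ideal J (coeff_ring n)" "S \<subseteq> J" and x: "x \<in> ?I" for J x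
  proof -
    interpret J: ideal J "coeff_ring n" by fact
    show ?thesis using x
    proof induction
      case zero
      then show ?case using J.zero_closed by (simp add: coeff_ring_simps)
    next
      case (step a s x)
      then have "a * s \<in> J" using J.I_l_closed[of s a] J(2)
          by (auto simp: coeff_ring_simps carrier_coeff_ring)
      then show ?case using J.a_closed[of "a * s" x] step by (simp add: coeff_ring_simps)
    qed
  qed
  ultimately show ?thesis unfolding genideal_def by blast
qed

text \<open>By the basis theorem the chain of ideals becomes stationary, so the \<open>LEAST\<close>
  in \<open>M_I\<close> is attained and the ideal at that index contains every saddle value. An
  index below \<open>k\<close> would contradict \<open>notin\<close>.\<close>

lemma M_I_ge:
  assumes pq: "p > 0" "q > 0" "coprime p q" and k: "k \<ge> 1"
    and notin: "\<And>M. M < k \<Longrightarrow> (saddle_value p q n k :: 'a::field_char_0 coeff_poly)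
        \<notin> span_ideal (poly_in (coeff_vars n)) (saddle_value p q n ` {1..M})"
  shows "k \<le> M_I TYPE('a) p q n"
proof -
  let ?A = "poly_in (coeff_vars n) :: 'a coeff_poly set" and ?L
      = "saddle_value p q n :: nat \<Rightarrow> 'a coeff_poly"
  note C = closed_ring_poly_in[of "coeff_vars n", where 'a='a]
  have L: "?L ` S \<subseteq> ?A" if "S \<subseteq> {1..}" for S
    using saddle_value_in_ring[OF pq] that by force
  have fin: "saddle_ideal p q n M = span_ideal ?A (?L ` {1..M})" for M
    unfolding saddle_ideal_def by (intro genideal_coeff_ring L) auto
  have inf: "saddle_ideal_inf p q n = span_ideal ?A (?L ` {1..})"
    unfolding saddle_ideal_inf_def by (intro genideal_coeff_ring L) auto
  have "\<exists>F\<subseteq>?L ` {1..}. finite F \<and> ?L ` {1..} \<subseteq> span_ideal ?A F"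
    using noetherian_poly_in[OF finite_coeff_vars] L[of "{1..}"] unfolding noetherian_def by blast
  then obtain I where I: "I \<subseteq> {1..}" "finite I" "?L ` {1..} \<subseteq> span_ideal ?A (?L ` I)"
    by (metis finite_subset_image)
  then obtain M where M: "\<And>i. i \<in> I \<Longrightarrow> i \<le> M" using finite_nat_set_iff_bounded_le[of I] by blast
  have "?L ` I \<subseteq> ?L ` {1..M}" using I(1) M by (intro image_mono) auto
  then have "?L ` {1..} \<subseteq> span_ideal ?A (?L ` {1..M})" using I(3) span_ideal_mono by blast
  then have "span_ideal ?A (?L ` {1..}) \<subseteq> span_ideal ?A (?L ` {1..M})"
      by (rule span_ideal_subset[OF C])
  moreover have "span_ideal ?A (?L ` {1..M}) \<subseteq> span_ideal ?A (?L ` {1..})"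
    by (intro subsetI, erule span_ideal_mono) auto
  ultimately have ex: "(saddle_ideal p q n M :: 'a coeff_poly set) = saddle_ideal_inf p q n"
    unfolding fin inf by blast
  have "(saddle_ideal p q n (M_I TYPE('a) p q n) :: 'a coeff_poly set) = saddle_ideal_inf p q n"
    unfolding M_I_def by (rule LeastI[of "\<lambda>M. (saddle_ideal p q n M :: 'a coeff_poly set)
        = saddle_ideal_inf p q n", OF ex])
  moreover have "?L k \<in> saddle_ideal_inf p q n"
    unfolding inf using k by (intro span_ideal_base[OF C]) auto
  ultimately have "\<not> M_I TYPE('a) p q n < k" using notin[of "M_I TYPE('a) p q n"] unfolding fin
      by blast
  then show ?thesis by simp
qed

section \<open>Powers of a series with constant term one\<close>

definition euler_x :: "'b::comm_ring_1 fps fps \<Rightarrow> 'b fps fps" where "euler_x F = deriv_x F * var_x"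
definition euler_y :: "'b::comm_ring_1 fps fps \<Rightarrow> 'b fps fps" where "euler_y F = deriv_y F * var_y"

lemma euler_x_nth: "euler_x F $ i $ j = of_nat i * F $ i $ j"
    and euler_y_nth: "euler_y F $ i $ j = of_nat j * F $ i $ j"
  by (simp_all only: euler_x_def euler_y_def deriv_x_mult_var_x deriv_y_mult_var_y)

lemma euler_add: "euler_x (F + G) = euler_x F + euler_x G" "euler_y (F + G) = euler_y F + euler_y G"
  and euler_mult: "euler_x (F * G) = euler_x F * G + F * euler_x G" "euler_y (F * G)
      = euler_y F * G + F * euler_y G"
  by (simp_all add: euler_x_def euler_y_def deriv_x_add deriv_y_add deriv_x_mult deriv_y_mult
      algebra_simps)

lemma euler_commute: "euler_x (euler_y F) = euler_y (euler_x F)"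
  by (rule fps2_ext) (simp add: euler_x_nth euler_y_nth algebra_simps)

lemma euler_monomial: "euler_x (monomial a b) = of_nat a * monomial a b" "euler_y (monomial a b)
    = of_nat b * monomial a b"
  by (rule fps2_ext; simp add: euler_x_nth euler_y_nth monomial_nth)+

lemma euler_cst_mult: "euler_x (const2 c * F) = const2 c * euler_x F" "euler_y (const2 c * F)
    = const2 c * euler_y F"
  by (rule fps2_ext; simp add: euler_x_nth euler_y_nth mult.left_commute)+

lemma euler_sum: "euler_x (sum f S) = (\<Sum>x\<in>S. euler_x (f x))" "euler_y (sum f S)
    = (\<Sum>x\<in>S. euler_y (f x))"
  by (rule fps2_ext; simp add: euler_x_nth euler_y_nth fps_sum_nth sum_distrib_left)+

lemma const2_simps: "const2 (a + b) = const2 a + const2 b" "const2 (a * b)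
    = const2 a * const2 b" "const2 (- a) = - const2 a" "const2 1 = 1" "const2 0 = 0"
   "const2 (of_nat n) = of_nat n"
  by (simp_all add: const2_def fps_of_nat flip: fps_const_neg)

text \<open>The series of \<open>(1 + g) ^ \<mu>\<close> for a scalar exponent. Composition is in
  \<open>x\<close> over the series in \<open>y\<close>, so the lemmas below require \<open>x\<close>
  to divide \<open>g\<close>, in the form \<open>g $ 0 = 0\<close>.\<close>

definition binomial_power :: "'a::field_char_0 \<Rightarrow> 'a fps fps \<Rightarrow> 'a fps fps" where
  "binomial_power \<mu> g = fps_compose (Abs_fps (\<lambda>k. fps_const (\<mu> gchoose k))) g"

lemma binomial_power_nth: "binomial_power \<mu> g $ i $ j = (\<Sum>k\<le>i. (\<mu> gchoose k) * (g ^ k) $ i $ j)"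
  by (simp add: binomial_power_def fps_compose_nth fps_sum_nth atLeast0AtMost)

lemma binomial_power_nth_00: "binomial_power \<mu> g $ 0 $ 0 = 1"
  by (simp add: binomial_power_nth)

lemma binomial_power_add:
  assumes "g $ 0 = 0" shows "binomial_power (\<mu> + \<nu>) g = binomial_power \<mu> g * binomial_power \<nu> g"
proof -
  have "Abs_fps (\<lambda>k. fps_const (\<mu> + \<nu> gchoose k)) =
      Abs_fps (\<lambda>k. fps_const (\<mu> gchoose k)) * Abs_fps (\<lambda>k. fps_const (\<nu> gchoose k))"
  proof (rule fps_ext)
    fix k
    have "(\<mu> + \<nu> gchoose k) = (\<Sum>i=0..k. (\<mu> gchoose i) * (\<nu> gchoose (k - i)))"
      by (rule gbinomial_Vandermonde[symmetric])
    then show "Abs_fps (\<lambda>k. fps_const (\<mu> + \<nu> gchoose k)) $ k =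
        (Abs_fps (\<lambda>k. fps_const (\<mu> gchoose k)) * Abs_fps (\<lambda>k. fps_const (\<nu> gchoose k))) $ k"
      by (simp add: fps_mult_nth is_ring_hom_simps(9)[OF is_ring_hom_fps_const])
  qed
  then show ?thesis unfolding binomial_power_def by (simp add: fps_compose_mult_distrib[OF assms])
qed

lemma binomial_power_0: "binomial_power 0 g = 1"
proof -
  have "Abs_fps (\<lambda>k. fps_const (0 gchoose k)) = (1 :: 'a fps fps)"
    by (intro fps2_ext) (auto simp: gbinomial_0_left fps_one_nth)
  then show ?thesis by (simp add: binomial_power_def)
qed

lemma binomial_power_1: "g $ 0 = 0 \<Longrightarrow> binomial_power 1 g = 1 + g"
proof -
  have "Abs_fps (\<lambda>k. fps_const (1 gchoose k)) = (1 + fps_X :: 'a fps fps)"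
  proof (rule fps_ext)
    fix k
    show "Abs_fps (\<lambda>k. fps_const (1 gchoose k)) $ k = (1 + fps_X :: 'a fps fps) $ k"
      using arg_cong[OF fps_binomial_1[where 'a='a], of "\<lambda>F. F $ k"] by (auto simp: fps_X_def)
  qed
  then show "g $ 0 = 0 \<Longrightarrow> binomial_power 1 g = 1 + g"
    by (simp add: binomial_power_def fps_compose_add_distrib)
qed

text \<open>The chain rule for the variable hidden in the coefficients:
  \<open>fps_compose_deriv\<close> covers \<open>x\<close>, and this covers \<open>y\<close>, for an
  outer series whose coefficients are free of \<open>y\<close>.\<close>

lemma compose_deriv_y:
  fixes g :: "'a::field_char_0 fps fps"
  assumes g: "g $ 0 = 0" and c: "\<And>k. fps_deriv (c $ k) = 0"
  shows "deriv_y (c oo g) = (fps_deriv c oo g) * deriv_y g"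
proof (rule fps_ext)
  fix i
  have pw: "deriv_y (g ^ k) = of_nat k * g ^ (k - 1) * deriv_y g" for k
    using flow_power[of 0 1 g k] by (simp add: flow_def)
  have "deriv_y (c oo g) $ i = (\<Sum>k=0..i. fps_deriv (c $ k * (g ^ k) $ i))"
    by (simp add: deriv_y_def fps_compose_nth fps_deriv_sum)
  also have "\<dots> = (\<Sum>k=0..i. c $ k * deriv_y (g ^ k) $ i)"
    by (simp add: c deriv_y_def)
  also have "\<dots> = (\<Sum>k=0..i. c $ k * (of_nat k * (g ^ (k - 1) * deriv_y g) $ i))"
    by (simp add: pw mult.assoc)
  \<comment> \<open>The added summand is zero because \<open>x\<close> divides \<open>g\<close> and
    \<open>deriv_y g\<close>. It makes room for the index shift in
    \<open>fps_deriv c\<close>.\<close>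
  also have "\<dots> = (\<Sum>k=0..Suc i. c $ k * (of_nat k * (g ^ (k - 1) * deriv_y g) $ i))"
  proof -
    have "(g ^ i * deriv_y g) $ i = g ^ i $ i * deriv_y g $ 0"
      by (simp add: fps_mult_nth startsby_zero_power_prefix[OF g] sum.atLeast0_lessThan_Suc flip:
          atLeastLessThanSuc_atLeastAtMost)
    also have "deriv_y g $ 0 = 0" using g by (simp add: deriv_y_def)
    finally show ?thesis by simp
  qed
  also have "\<dots> = (\<Sum>k=0..i. fps_deriv c $ k * (g ^ k * deriv_y g) $ i)"
    by (subst sum.atLeast0_atMost_Suc_shift) (simp add: algebra_simps)
  also have "\<dots> = (\<Sum>k=0..i. \<Sum>l=0..i. fps_deriv c $ k * (g ^ k) $ l * deriv_y g $ (i - l))"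
    by (simp add: fps_mult_nth sum_distrib_left mult.assoc)
  also have "\<dots> = (\<Sum>l=0..i. \<Sum>k=0..i. fps_deriv c $ k * (g ^ k) $ l * deriv_y g $ (i - l))"
    by (rule sum.swap)
  also have "\<dots> = (\<Sum>l=0..i. \<Sum>k=0..l. fps_deriv c $ k * (g ^ k) $ l * deriv_y g $ (i - l))"
    by (intro sum.cong sum.mono_neutral_right) (auto simp: startsby_zero_power_prefix[OF g])
  also have "\<dots> = ((fps_deriv c oo g) * deriv_y g) $ i"
    by (simp add: fps_mult_nth fps_compose_nth sum_distrib_right)
  finally show "deriv_y (c oo g) $ i = ((fps_deriv c oo g) * deriv_y g) $ i" .
qed

lemma euler_binomial_power:
  assumes g: "g $ 0 = 0"
  shows "euler_x (binomial_power \<mu> g) = const2 \<mu> * (binomial_power (\<mu> - 1) g * euler_x g)"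
      "euler_y (binomial_power \<mu> g) = const2 \<mu> * (binomial_power (\<mu> - 1) g * euler_y g)"
proof -
  let ?c = "\<lambda>\<mu>. Abs_fps (\<lambda>k. fps_const (\<mu> gchoose k)) :: 'a fps fps"
  have "fps_deriv (?c \<mu>) = const2 \<mu> * ?c (\<mu> - 1)"
  proof (intro fps2_ext)
    fix i j
    have "of_nat (Suc i) * (\<mu> gchoose Suc i) = \<mu> * (\<mu> - 1 gchoose i)" by (rule gbinomial_absorption)
    then show "fps_deriv (?c \<mu>) $ i $ j = (const2 \<mu> * ?c (\<mu> - 1)) $ i $ j"
      by (simp add: const2_mult_nth algebra_simps del: of_nat_Suc)
  qed
  then have d: "fps_deriv (?c \<mu>) oo g = const2 \<mu> * binomial_power (\<mu> - 1) g"
    by (simp add: binomial_power_def fps_compose_mult_distrib[OF g] const2_def)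
  show "euler_x (binomial_power \<mu> g) = const2 \<mu> * (binomial_power (\<mu> - 1) g * euler_x g)"
    unfolding euler_x_def deriv_x_def binomial_power_def[of \<mu>] fps_compose_deriv[OF g] d
        by (simp add: mult.assoc)
  have "deriv_y (binomial_power \<mu> g) = (fps_deriv (?c \<mu>) oo g) * deriv_y g"
    unfolding binomial_power_def by (rule compose_deriv_y[OF g]) simp
  then show "euler_y (binomial_power \<mu> g) = const2 \<mu> * (binomial_power (\<mu> - 1) g * euler_y g)"
    unfolding euler_y_def d by (simp add: mult.assoc)
qed

section \<open>Exponents and coefficients for a sum of two monomials\<close>

lemma power_two_monomials:
  "(monomial u1 u2 + monomial v1 v2) ^ k = (\<Sum>s\<le>k. of_nat (k choose s) * monomial (s * u1 + (k - s)
      * v1) (s * u2 + (k - s) * v2))"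
  by (simp add: binomial_ring monomial_power monomial_mult_monomial mult.assoc mult.commute[of u1]
      mult.commute[of u2]
      mult.commute[of v1] mult.commute[of v2])

lemma binomial_power_support:
  assumes "binomial_power \<mu> (monomial u1 u2 + monomial v1 v2) $ i $ j \<noteq> 0"
  obtains s t where "i = s * u1 + t * v1" "j = s * u2 + t * v2"
proof -
  obtain k where k: "(\<mu> gchoose k) * ((monomial u1 u2 + monomial v1 v2) ^ k) $ i $ j \<noteq> 0"
    using assms unfolding binomial_power_nth by (rule sum.not_neutral_contains_not_neutral)
  then have "(\<Sum>s\<le>k. (of_nat (k choose s) * monomial (s * u1 + (k - s) * v1) (s * u2 + (k - s) *
      v2) :: 'a fps fps) $ i $ j) \<noteq> 0"
    unfolding power_two_monomials fps_sum_nth by (simp only: mult_eq_0_iff de_Morgan_disj simp_thms)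
  then obtain s where "(of_nat (k choose s) * monomial (s * u1 + (k - s) * v1) (s * u2 + (k - s) *
      v2) :: 'a fps fps) $ i $ j \<noteq> 0"
    by (rule sum.not_neutral_contains_not_neutral)
  then have "i = s * u1 + (k - s) * v1 \<and> j = s * u2 + (k - s) * v2"
    unfolding of_nat_fps2_mult_nth monomial_nth
    by (cases "i = s * u1 + (k - s) * v1 \<and> j = s * u2 + (k - s) * v2") (simp_all only: if_False
        mult_zero_right simp_thms)
  then show ?thesis using that by blast
qed

text \<open>By \<open>inj\<close> the exponent arises from only one pair of multiplicities, so a
  single binomial term contributes and nothing can cancel.\<close>

lemma binomial_power_coeff:
  assumes inj: "\<And>s' t'. s * u1 + t * v1 = s' * u1 + t' * v1 \<Longrightarrow> s * u2 + t * v2 = s' * u2 + t' * v2 \<Longrightarrow>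
      s' = s \<and> t' = t"
    and pos: "u1 > 0" "v1 > 0"
  shows "binomial_power \<mu> (monomial u1 u2 + monomial v1 v2) $ (s * u1 + t * v1) $ (s * u2 + t *
      v2) =
    (\<mu> gchoose (s + t)) * of_nat (s + t choose s)"
proof -
  let ?i = "s * u1 + t * v1" and ?j = "s * u2 + t * v2"
  have eq: "?i = l * u1 + (k - l) * v1 \<and> ?j = l * u2 + (k - l) * v2 \<longleftrightarrow> k = s + t \<and> l = s"
      if "l \<le> k" for k l
  proof
    assume "?i = l * u1 + (k - l) * v1 \<and> ?j = l * u2 + (k - l) * v2"
    then have "l = s" "k - l = t" using inj[of l "k - l"] by blast+
    then show "k = s + t \<and> l = s" using that by simp
  qed simp
  have "((monomial u1 u2 + monomial v1 v2) ^ k :: 'a fps fps) $ ?i $ ?j = (if k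
      = s + t then of_nat (s + t choose s) else 0)" for k
  proof -
    have "((monomial u1 u2 + monomial v1 v2) ^ k :: 'a fps fps) $ ?i $ ?j =
        (\<Sum>l\<le>k. of_nat (k choose l) * (if ?i = l * u1 + (k - l) * v1 \<and> ?j
            = l * u2 + (k - l) * v2 then 1 else 0))"
      unfolding power_two_monomials fps_sum_nth by (simp only: of_nat_fps2_mult_nth monomial_nth)
    also have "\<dots> = (\<Sum>l\<le>k. if l = s then (if k = s + t then of_nat (k choose s) else 0) else 0)"
    proof (intro sum.cong refl)
      fix l assume "l \<in> {..k}"
      then show "of_nat (k choose l) * (if ?i = l * u1 + (k - l) * v1 \<and> ?j
          = l * u2 + (k - l) * v2 then 1 else 0) =
          (if l = s then (if k = s + t then of_nat (k choose s) else 0) else (0::'a))"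
        using eq[of l k] by (cases "k = s + t \<and> l = s") auto
    qed
    also have "\<dots> = (if k = s + t then of_nat (s + t choose s) else 0)"
      by (simp add: sum.delta)
    finally show ?thesis .
  qed
  note pw = this
  \<comment> \<open>Positivity of \<open>u1\<close> and \<open>v1\<close> puts the index
    \<open>s + t\<close> inside the truncated range of \<open>binomial_power_nth\<close>.\<close>
  have "s * 1 + t * 1 \<le> ?i" using pos by (intro add_mono mult_le_mono) auto
  then show ?thesis
    unfolding binomial_power_nth pw by (simp add: if_distrib[of "(*) _"] cong: if_cong)
qed

section \<open>Perturbing a field with a Darboux first integral\<close>

locale darboux =
  fixes p q u1 u2 v1 v2 :: nat and lam :: "'a::field_char_0"
  assumes p: "p > 0" and q: "q > 0" and u1: "u1 > 0" and v1: "v1 > 0"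
begin

definition g :: "'a fps fps" where "g = monomial u1 u2 + monomial v1 v2"
definition F :: "'a \<Rightarrow> 'a fps fps" where "F \<mu> = binomial_power \<mu> g"
text \<open>\<open>F 1\<close> is \<open>f = 1 + g\<close>, and the Euler derivatives of
  \<open>f\<close> and \<open>g\<close> coincide; \<open>V1\<close> and \<open>V2\<close> are thus
  the components of the field with first integral \<open>H\<close>.\<close>

definition V1 where "V1 = var_x * (of_nat p * F 1 + const2 lam * euler_y g)"
definition V2 where "V2 = - var_y * (of_nat q * F 1 + const2 lam * euler_x g)"

lemma g0: "g $ 0 = 0"
  by (rule fps_ext) (use u1 v1 in \<open>simp add: g_def monomial_nth\<close>)

lemma F_mult: "F \<mu> * F \<nu> = F (\<mu> + \<nu>)"
  by (simp add: F_def binomial_power_add[OF g0])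

lemma F_0: "F 0 = 1" and F_1: "F 1 = 1 + g" and F_00: "F \<mu> $ 0 $ 0 = 1"
  by (simp_all add: F_def binomial_power_0 binomial_power_1[OF g0] binomial_power_nth_00)

lemma euler_F: "euler_x (F \<mu>) = const2 \<mu> * (F (\<mu> - 1) * euler_x g)" "euler_y (F \<mu>)
    = const2 \<mu> * (F (\<mu> - 1) * euler_y g)"
  by (simp_all add: F_def euler_binomial_power[OF g0])

lemma flow_V: "flow V1 V2 G = euler_x G * (of_nat p * F 1 + const2 lam * euler_y g) - euler_y G *
    (of_nat q * F 1 + const2 lam * euler_x g)"
  by (simp add: flow_def V1_def V2_def euler_x_def euler_y_def algebra_simps)

text \<open>\<open>T k G\<close> is the residue of \<open>G / (H ^ k f) dx dy / (x y)\<close>, where \<open>H = x\<^sup>q y\<^sup>p f\<^sup>\<lambda>\<close>. It kills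
  the derivatives along the field, since \<open>dx dy / (x y f)\<close> is an invariant density.\<close>

definition T :: "nat \<Rightarrow> 'a fps fps \<Rightarrow> 'a" where
  "T k G = (G * F (- lam * of_nat k - 1)) $ (k * q) $ (k * p)"

lemma T_add: "T k (G + G') = T k G + T k G'"
  by (simp add: T_def algebra_simps)

lemma T_cst_mult: "T k (const2 c * G) = c * T k G"
  by (simp add: T_def mult.assoc)

lemma T_sum: "T k (sum f S) = (\<Sum>x\<in>S. T k (f x))"
  by (simp add: T_def sum_distrib_right fps_sum_nth)

lemma T_vanishes_below: "vanishes_below d G \<Longrightarrow> k * (p + q) < d \<Longrightarrow> T k G = 0"
  unfolding T_def by (rule vanishes_belowD[OF vanishes_below_mult_right]) (auto simp: algebra_simps)

text \<open>Integration by parts leaves Euler derivatives of \<open>G * h\<close>,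
  \<open>G * euler_y h\<close> and \<open>G * euler_x h\<close>, and undifferentiated copies of the
  last two. At the exponent \<open>(k q, k p)\<close> the Euler derivatives are multiplications by
  \<open>k q\<close> and \<open>k p\<close>, and everything cancels in pairs.\<close>

lemma T_flow:
  assumes "k \<ge> 1" shows "T k (flow V1 V2 G) = 0"
proof -
  define h where "h = F (- lam * of_nat k)"
  define A where "A = F (- lam * of_nat k - 1)"
  have fA: "F 1 * A = h" by (simp add: F_mult A_def h_def)
  have hx: "euler_x h = - (of_nat k * const2 lam * (A * euler_x g))"
      and hy: "euler_y h = - (of_nat k * const2 lam * (A * euler_y g))"
    by (simp_all add: h_def A_def euler_F const2_simps algebra_simps)
  \<comment> \<open>The factor \<open>k\<close> matches the one in the Euler derivatives of
    \<open>h\<close>; it is divided out at the end.\<close>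
  have "of_nat k * (flow V1 V2 G * A) =
      of_nat (k * p) * (euler_x G * (F 1 * A)) - of_nat (k * q) * (euler_y G * (F 1 * A))
      + euler_x G * (of_nat k * const2 lam * (A * euler_y g)) - euler_y G * (of_nat k * const2 lam
          * (A * euler_x g))"
    by (simp add: flow_V algebra_simps)
  also have "\<dots> = of_nat (k * p) * (euler_x G * h) - of_nat (k * q) * (euler_y G * h) - (euler_x G
      * euler_y h - euler_y G * euler_x h)"
    by (simp add: fA hx hy)
  also have "\<dots> = of_nat (k * p) * (euler_x (G * h) - G * euler_x h) - of_nat (k * q) * (euler_y (G
      * h) - G * euler_y h)
     - (euler_x (G * euler_y h) - euler_y (G * euler_x h))"
    by (simp add: euler_mult euler_commute algebra_simps)
  finally have "(of_nat k * (flow V1 V2 G * A)) $ (k * q) $ (k * p) =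
    (of_nat (k * p) * (euler_x (G * h) - G * euler_x h) - of_nat (k * q) * (euler_y (G * h) - G *
        euler_y h)
     - (euler_x (G * euler_y h) - euler_y (G * euler_x h))) $ (k * q) $ (k * p)" by (rule arg_cong)
  also have "\<dots> = 0"
    unfolding fps_sub_nth of_nat_fps2_mult_nth euler_x_nth euler_y_nth by (simp add: algebra_simps)
  finally show ?thesis using assms by (simp add: T_def A_def)
qed

text \<open>The \<open>i\<close>-th power of the first integral.\<close>

definition H :: "nat \<Rightarrow> 'a fps fps" where
  "H i = monomial (i * q) (i * p) * F (lam * of_nat i)"

lemma euler_H: "euler_x (H i) = of_nat i * (monomial (i * q) (i * p) * (of_nat q * F (lam * of_nat
    i) + const2 lam * (F (lam * of_nat i - 1) * euler_x g)))"
  "euler_y (H i) = of_nat i * (monomial (i * q) (i * p) * (of_nat p * F (lam * of_nat i) + const2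
      lam * (F (lam * of_nat i - 1) * euler_y g)))"
  by (simp_all add: H_def euler_mult euler_monomial euler_F const2_simps algebra_simps)

lemma flow_H: "flow V1 V2 (H i) = 0"
proof -
  define A where "A = F (lam * of_nat i - 1)"
  have f: "F (lam * of_nat i) = F 1 * A" by (simp add: A_def F_mult)
  show ?thesis unfolding flow_V euler_H f A_def[symmetric] by (simp add: algebra_simps)
qed

lemma vanishes_below_H: "vanishes_below (i * (p + q)) (H i)"
  unfolding H_def by (intro vanishes_below_mult_right vanishes_below_monomial) (simp add:
      algebra_simps)

lemma H_nth: "H i $ (l * q) $ (l * p) = (if l = i then 1 else 0)" if "l \<le> i"
proof -
  have "l * q < i * q" if "l \<noteq> i" using that \<open>l \<le> i\<close> q by simp
  then show ?thesis by (auto simp: H_def monomial_mult_nth F_00)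
qed

lemma vanishes_below_V: "vanishes_below 2 (V1 - of_nat p * var_x)" "vanishes_below 2 (V2 + of_nat
    q * var_y)"
proof -
  have g: "vanishes_below 1 g" unfolding g_def by (intro vanishes_below_add
      vanishes_below_monomial) (use u1 v1 in auto)
  have th: "vanishes_below 1 (euler_x g)" "vanishes_below 1 (euler_y g)" using g
      by (simp_all add: vanishes_below_def euler_x_nth euler_y_nth)
  have "V1 - of_nat p * var_x = monomial 1 0 * (of_nat p * g + const2 lam * euler_y g)"
    by (simp add: V1_def F_1 var_x_eq algebra_simps)
  moreover have "vanishes_below (1 + 1) (monomial 1 0 * (of_nat p * g + const2 lam * euler_y g))"
    by (intro vanishes_below_mult vanishes_below_monomial vanishes_below_add
        vanishes_below_mult_left g th) simp
  ultimately show "vanishes_below 2 (V1 - of_nat p * var_x)" by (simp add: numeral_2_eq_2)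
  have "V2 + of_nat q * var_y = - (monomial 0 1 * (of_nat q * g + const2 lam * euler_x g))"
    by (simp add: V2_def F_1 var_y_eq algebra_simps)
  moreover have "vanishes_below (1 + 1) (- (monomial 0 1 * (of_nat q * g + const2 lam * euler_x
      g)))"
    by (intro vanishes_below_minus vanishes_below_mult vanishes_below_monomial vanishes_below_add
        vanishes_below_mult_left g th) simp
  ultimately show "vanishes_below 2 (V2 + of_nat q * var_y)" by (simp add: numeral_2_eq_2)
qed

lemma flow_V_leading:
  assumes R: "vanishes_below d R" and ij: "i + j = d"
  shows "flow V1 V2 R $ i $ j = of_int (int p * int i - int q * int j) * R $ i $ j"
proof -
  let ?P = "V1 - of_nat p * var_x" and ?Q = "V2 + of_nat q * var_y"
  have "flow V1 V2 R = flow (of_nat p * var_x + ?P) (- of_nat q * var_y + ?Q) R" by simp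
  moreover have "(deriv_x R * ?P + deriv_y R * ?Q) $ i $ j = 0"
  proof (rule vanishes_belowD)
    show "vanishes_below (d - 1 + 2) (deriv_x R * ?P + deriv_y R * ?Q)"
      by (intro vanishes_below_add vanishes_below_mult vanishes_below_deriv_x
          vanishes_below_deriv_y R vanishes_below_V)
  qed (use ij in auto)
  ultimately show ?thesis using flow_linear[of p ?P q ?Q R i j] by simp
qed

lemma flow_sum_H: "flow V1 V2 (\<Sum>i\<le>B. const2 (c i) * H i) = 0"
proof -
  have "flow V1 V2 (const2 a * G) = const2 a * flow V1 V2 G" for a G
    unfolding flow_V euler_cst_mult by (simp add: algebra_simps)
  then have "flow V1 V2 (const2 (c i) * H i) = 0" for i by (simp add: flow_H)
  moreover have "flow V1 V2 0 = 0" using flow_diff[of V1 V2 0 0] by simp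
  ultimately show ?thesis by (induction B) (simp_all add: flow_add)
qed

text \<open>The lowest-degree part of the remainder is annihilated by the diagonal linear field. By
  coprimality it is a multiple of a power of \<open>x\<^sup>q y\<^sup>p\<close>, and the same power
  of \<open>H\<close> removes it. So first integrals are series in \<open>H\<close>. The bound
  \<open>B\<close> keeps the range of summation fixed during the induction.\<close>

lemma first_integral_expansion:
  assumes cop: "coprime p q" and G: "flow V1 V2 G = 0"
  shows "d \<le> B \<Longrightarrow> \<exists>c. vanishes_below d (G - (\<Sum>i\<le>B. const2 (c i) * H i))"
proof (induction d)
  case (Suc d)
  then obtain c where c: "vanishes_below d (G - (\<Sum>i\<le>B. const2 (c i) * H i))" by auto
  define R where "R = G - (\<Sum>i\<le>B. const2 (c i) * H i)"
  have R: "vanishes_below d R" using c by (simp add: R_def)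
  have "flow V1 V2 R = 0" by (simp add: R_def flow_diff flow_sum_H G)
  then have nz: "int p * int i = int q * int j" if "i + j = d" "R $ i $ j \<noteq> 0" for i j
  proof -
    have "of_int (int p * int i - int q * int j) * R $ i $ j = 0"
      using flow_V_leading[OF R that(1)] \<open>flow V1 V2 R = 0\<close> by (simp only: fps_zero_nth)
    then have "int p * int i - int q * int j = 0"
      using that(2) by (simp only: mult_eq_0_iff of_int_eq_0_iff simp_thms)
    then show ?thesis by simp
  qed
  have res: "\<exists>l. i = l * q \<and> j = l * p" if "i + j = d" "R $ i $ j \<noteq> 0" for i j
  proof -
    have e: "p * i = q * j" using nz[OF that] by (simp flip: of_nat_mult)
    then have "q dvd i" using cop by (metis coprime_commute coprime_dvd_mult_right_iff
        dvd_triv_left)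
    then obtain l where l: "i = l * q" by (metis dvd_def mult.commute)
    then have "j = l * p" using e q by (simp add: mult.left_commute mult.commute)
    then show ?thesis using l by blast
  qed
  show ?case
  proof (cases "\<exists>l. l * (p + q) = d")
    case False
    have "R $ i $ j = 0" if "i + j = d" for i j
      using res[OF that] that False by (metis add.commute distrib_left)
    then have "vanishes_below (Suc d) R" using R by (auto simp: vanishes_below_def less_Suc_eq)
    then show ?thesis unfolding R_def by blast
  next
    case True
    then obtain l where l: "l * (p + q) = d" by blast
    have "l * 1 \<le> l * (p + q)" using p by (intro mult_le_mono) auto
    then have lB: "l \<le> B" using l Suc.prems by simp
    define c' where "c' i = (if i = l then c i + R $ (l * q) $ (l * p) else c i)" for i
    have "(\<Sum>i\<le>B. const2 (c' i) * H i) = (\<Sum>i\<le>B. const2 (c i) * H i + (if i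
        = l then const2 (R $ (l * q) $ (l * p)) * H l else 0))"
      by (intro sum.cong) (auto simp: c'_def const2_simps algebra_simps)
    also have "\<dots> = (\<Sum>i\<le>B. const2 (c i) * H i) + const2 (R $ (l * q) $ (l * p)) * H l"
      using lB by (simp add: sum.distrib)
    finally have eq: "G - (\<Sum>i\<le>B. const2 (c' i) * H i) = R - const2 (R $ (l * q) $ (l * p)) * H l"
      by (simp add: R_def)
    have "vanishes_below (Suc d) (R - const2 (R $ (l * q) $ (l * p)) * H l)"
      unfolding vanishes_below_def less_Suc_eq
    proof (intro allI impI, elim disjE)
      fix i j assume "i + j < d"
      then show "(R - const2 (R $ (l * q) $ (l * p)) * H l) $ i $ j = 0"
        using R vanishes_below_H[of l] l by (simp add: vanishes_below_def)
    next
      fix i j assume ij: "i + j = d"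
      have Hl: "H l $ i $ j = (if i = l * q \<and> j = l * p then 1 else 0)"
      proof (cases "l * q \<le> i \<and> l * p \<le> j")
        case True
        then have "i = l * q" "j = l * p" using ij l by (auto simp: algebra_simps)
        then show ?thesis by (simp add: H_nth)
      qed (auto simp: H_def monomial_mult_nth)
      show "(R - const2 (R $ (l * q) $ (l * p)) * H l) $ i $ j = 0"
      proof (cases "R $ i $ j = 0")
        case True
        then show ?thesis by (auto simp: Hl)
      next
        case False
        then obtain m where m: "i = m * q" "j = m * p" using res ij by blast
        then have "m * (p + q) = l * (p + q)" using ij l by (simp add: algebra_simps)
        then have "m = l" using p by simp
        then show ?thesis by (simp add: m H_nth)
      qed
    qed
    then show ?thesis unfolding eq[symmetric] by blast
  qed
qed simp

text \<open>The value of \<open>T (Suc k)\<close> on \<open>x\<^sup>w\<close> times the Euler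
  derivative of \<open>H\<close>, after cancelling one factor \<open>x\<^sup>q y\<^sup>p\<close> and
  powers of \<open>f\<close>. It measures the first-order effect of the perturbation on
  \<open>H\<close>.\<close>

definition melnikov :: "nat \<Rightarrow> nat \<Rightarrow> nat \<Rightarrow> 'a" where
  "melnikov w1 w2 k = (monomial w1 w2 * (of_nat q * F (- lam * of_nat k - 1) + const2 lam * (F (-
      lam * of_nat k - 2) * euler_x g)))
      $ (k * q) $ (k * p)"

text \<open>The Euler derivative of the \<open>i\<close>-th power is \<open>i\<close> times the
  \<open>(i - 1)\<close>-th power times that of the first integral, and these powers cancel against
  the \<open>K\<close>-th power in the density. For \<open>i > K\<close> the exponent read off by
  \<open>T K\<close> is out of reach.\<close>

lemma T_H: "T K (monomial w1 w2 * euler_x (H i)) = (if i \<le> K then of_nat i * melnikov w1 w2 (K -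
    i) else 0)"
proof -
  define k where "k = K - i"
  define M where "M = monomial (i * q) (i * p) * (monomial w1 w2 * (of_nat q * F (lam * of_nat i -
      lam * of_nat K - 1) + const2 lam * (F (lam * of_nat i - lam * of_nat K - 2) * euler_x g)))"
  have 1: "F (lam * of_nat i) * F (- lam * of_nat K - 1) = F (lam * of_nat i - lam * of_nat K - 1)"
    unfolding F_mult by (rule arg_cong[of _ _ F]) (simp add: algebra_simps)
  have 2: "F (lam * of_nat i - 1) * F (- lam * of_nat K - 1)
      = F (lam * of_nat i - lam * of_nat K - 2)"
    unfolding F_mult by (rule arg_cong[of _ _ F]) (simp add: algebra_simps)
  have "monomial w1 w2 * euler_x (H i) * F (- lam * of_nat K - 1) =
    of_nat i * (monomial (i * q) (i * p) * (monomial w1 w2 * (of_nat q * (F (lam * of_nat i) * F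
        (- lam * of_nat K - 1))
      + const2 lam * ((F (lam * of_nat i - 1) * F (- lam * of_nat K - 1)) * euler_x g))))"
    unfolding euler_H by (simp add: algebra_simps)
  also have "\<dots> = of_nat i * M" unfolding 1 2 M_def ..
  finally have T: "T K (monomial w1 w2 * euler_x (H i)) = of_nat i * M $ (K * q) $ (K * p)"
    by (simp add: T_def)
  show ?thesis
  proof (cases "i \<le> K")
    case True
    then have K: "K = i + k" by (simp add: k_def)
    have "lam * of_nat i - lam * of_nat K - c = - lam * of_nat k - c" for c
        by (simp add: K algebra_simps)
    then have "M $ (K * q) $ (K * p) = melnikov w1 w2 k"
      unfolding M_def melnikov_def monomial_mult_nth[of "i * q" "i * p"]
          by (simp add: K algebra_simps)
    then show ?thesis using T True by (simp add: k_def)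
  next
    case False
    then have "\<not> i * q \<le> K * q" using q by simp
    then have "M $ (K * q) $ (K * p) = 0" unfolding M_def monomial_mult_nth[of "i * q" "i * p"]
        by simp
    then show ?thesis using T False by simp
  qed
qed

text \<open>In the expansion of \<open>G\<close> in powers of the first integral the linear term has
  coefficient one. Higher powers contribute Melnikov coefficients of index below \<open>k\<close>,
  which vanish by \<open>zero\<close>.\<close>

lemma T_perturbation:
  assumes cop: "coprime p q" and G: "flow V1 V2 G = 0"
      and lead: "vanishes_below (Suc (p + q)) (G - monomial q p)"
    and zero: "\<And>k. k < k1 \<Longrightarrow> melnikov w1 w2 k = 0" and k: "k \<le> k1"
  shows "T (Suc k) (monomial w1 w2 * euler_x G) = melnikov w1 w2 k"
proof -
  \<comment> \<open>One more than the degree read by \<open>T (Suc k)\<close>, so that the remainder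
    of the expansion is invisible to it.\<close>
  let ?B = "Suc (Suc k * (p + q))"
  obtain c where c: "vanishes_below ?B (G - (\<Sum>i\<le>?B. const2 (c i) * H i))" (is "vanishes_below _ ?R")
    using first_integral_expansion[OF cop G order_refl] by blast
  have B: "?B = Suc (p + q) + k * (p + q)" by simp
  have low: "\<And>i j. i + j \<le> p + q \<Longrightarrow> G $ i $ j = (\<Sum>l\<le>?B. c l * H l $ i $ j)"
    using c by (simp add: vanishes_below_def fps_sum_nth B del: mult_Suc)
  have Hn: "H l $ q $ p = (if l = 1 then 1 else 0)" if "l \<ge> 1" for l
    using H_nth[of 1 l] that by auto
  have "G $ 0 $ 0 = 0" "G $ q $ p = 1"
    using lead p q by (auto simp: vanishes_below_def monomial_nth)
  moreover have "G $ 0 $ 0 = c 0"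
  proof -
    have "c l * H l $ 0 $ 0 = (if l = 0 then c 0 else 0)" for l using H_nth[of 0 l]
        by (cases l) auto
    then show ?thesis using low[of 0 0] by simp
  qed
  moreover have "G $ q $ p = c 1"
  proof -
    have "c l * H l $ q $ p = (if l = 1 then c 1 else 0)" for l
      using Hn[of l] \<open>G $ 0 $ 0 = 0\<close> \<open>G $ 0 $ 0 = c 0\<close> by (cases l) auto
    then show ?thesis using low[of q p] by simp
  qed
  ultimately have c01: "c 0 = 0" "c 1 = 1" by auto
  define R where "R = ?R"
  have R: "vanishes_below ?B R" using c by (simp only: R_def)
  have "G = (\<Sum>i\<le>?B. const2 (c i) * H i) + R" by (simp add: R_def)
  then have "euler_x G = euler_x ((\<Sum>i\<le>?B. const2 (c i) * H i) + R)" by (rule arg_cong)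
  also have "\<dots> = (\<Sum>i\<le>?B. const2 (c i) * euler_x (H i)) + euler_x R"
    by (simp only: euler_add euler_sum euler_cst_mult)
  finally have "monomial w1 w2 * euler_x G = (\<Sum>i\<le>?B. const2 (c i) * (monomial w1 w2 * euler_x (H
      i))) + monomial w1 w2 * euler_x R"
    by (simp only: distrib_left sum_distrib_left mult.left_commute[of "monomial w1 w2"])
  moreover have "T (Suc k) (monomial w1 w2 * euler_x R) = 0"
  proof (rule T_vanishes_below)
    show "vanishes_below ?B (monomial w1 w2 * euler_x R)" using R
        by (intro vanishes_below_mult_left) (auto simp only: vanishes_below_def euler_x_nth
        mult_zero_right)
  qed simp
  ultimately have "T (Suc k) (monomial w1 w2 * euler_x G)
      = (\<Sum>i\<le>?B. c i * T (Suc k) (monomial w1 w2 * euler_x (H i)))"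
    by (simp only: T_add T_sum T_cst_mult add_0_right)
  also have "\<dots> = (\<Sum>i\<le>?B. if i = 1 then melnikov w1 w2 k else 0)"
  proof (intro sum.cong refl)
    fix i :: nat
    consider "i = 0" | "i = 1" | "i \<ge> 2" by linarith
    then show "c i * T (Suc k) (monomial w1 w2 * euler_x (H i)) = (if i
        = 1 then melnikov w1 w2 k else 0)"
    proof cases
      case 3
      then have "i \<le> Suc k \<Longrightarrow> melnikov w1 w2 (Suc k - i) = 0" using zero k by auto
      then show ?thesis using 3 by (simp add: T_H)
    qed (simp_all add: T_H c01 c01(2)[unfolded One_nat_def])
  qed
  also have "\<dots> = melnikov w1 w2 k" by simp
  finally show ?thesis .
qed

text \<open>\<open>T (Suc k)\<close> reads degree at most \<open>Suc k * (p + q)\<close>. Powers of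
  \<open>Z\<close> above the \<open>Suc k\<close>-th start later, the lower ones have coefficient
  zero, and of \<open>Z ^ Suc k\<close> only the leading monomial counts, where the power of
  \<open>f\<close> enters with its constant term one.\<close>

lemma T_resonant:
  assumes lead: "vanishes_below (Suc (p + q)) (Z - monomial q p)" and k: "k \<ge> 1"
      and c: "\<And>j. 1 \<le> j \<Longrightarrow> j < k \<Longrightarrow> c j = 0"
  shows "T (Suc k) (Z * resonant_sum c Z) = c k"
proof -
  let ?n = "Suc k * (p + q)" and ?A = "F (- lam * of_nat (Suc k) - 1)"
  have "vanishes_below (p + q) ((Z - monomial q p) + monomial q p)"
    by (intro vanishes_below_add vanishes_below_monomial) (auto intro: vanishes_below_mono[OF lead])
  then have Z: "vanishes_below (p + q) Z" by simp
  then have Z1: "vanishes_below 1 Z" using p by (auto intro: vanishes_below_mono)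
  define S where "S = (\<Sum>j = 1..?n. const2 (c j) * Z ^ j)"
  have "resonant_sum c Z = S + (resonant_sum c Z - S)" by simp
  then have "Z * resonant_sum c Z = (\<Sum>j = 1..?n. const2 (c j) * Z ^ Suc j) + Z * (resonant_sum c Z
      - S)"
    unfolding S_def by (simp add: algebra_simps sum_distrib_left)
  moreover have "T (Suc k) (Z * (resonant_sum c Z - S)) = 0"
    by (rule T_vanishes_below[OF vanishes_below_mult_left[OF resonant_sum_cong_poly[OF Z1, of ?n
        c, folded S_def]]]) simp
  ultimately have "T (Suc k) (Z * resonant_sum c Z) = (\<Sum>j = 1..?n. c j * T (Suc k) (Z ^ Suc j))"
    by (simp only: T_add T_sum T_cst_mult add_0_right)
  also have "\<dots> = (\<Sum>j = 1..?n. if j = k then c k else 0)"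
  proof (intro sum.cong refl)
    fix j assume j: "j \<in> {1..?n}"
    consider "j < k" | "j = k" | "j > k" by linarith
    then show "c j * T (Suc k) (Z ^ Suc j) = (if j = k then c k else 0)"
    proof cases
      case 2
      have "vanishes_below (Suc (Suc k * (p + q))) (Z ^ Suc k - monomial q p ^ Suc k)"
        using lead by (intro cong_power vanishes_below_monomial) auto
      then have "vanishes_below (Suc ?n) ((Z ^ Suc k - monomial q p ^ Suc k) * ?A)"
          by (rule vanishes_below_mult_right)
      then have "((Z ^ Suc k - monomial q p ^ Suc k) * ?A) $ (Suc k * q) $ (Suc k * p) = 0"
        by (rule vanishes_belowD) (simp add: algebra_simps)
      then have "T (Suc k) (Z ^ Suc k) = (monomial q p ^ Suc k * ?A) $ (Suc k * q) $ (Suc k * p)"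
        by (simp only: T_def left_diff_distrib fps_sub_nth right_minus_eq)
      also have "\<dots> = 1" by (simp only: monomial_power monomial_mult_nth mult.commute[of "Suc k"])
          (simp add: F_00)
      finally show ?thesis using 2 by simp
    next
      case 3
      have "T (Suc k) (Z ^ Suc j) = 0"
        by (rule T_vanishes_below[OF vanishes_below_power[OF Z]]) (use 3 p in \<open>simp add:
            mult_less_mono1\<close>)
      then show ?thesis using 3 by simp
    qed (use c j in auto)
  qed
  also have "\<dots> = c k"
  proof -
    have "k * 1 \<le> Suc k * (p + q)" using p by (intro mult_le_mono) auto
    then show ?thesis using k by simp
  qed
  finally show ?thesis .
qed

end

section \<open>Choice of the exponents\<close>

text \<open>\<open>rel\<close> makes \<open>(q, p)\<close> generate the quotient by the lattice of
  \<open>(N, a)\<close> and \<open>(b, N)\<close>. \<open>mq\<close> and \<open>mp\<close> keep the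
  exponents of the perturbation nonnegative, \<open>mpq\<close> bounds its degree, and
  \<open>big\<close> makes \<open>D\<close> large compared with \<open>N\<close>.\<close>

locale witness_numbers =
  fixes p q a b N m :: nat
  assumes p: "p > 0" and q: "q > 0" and rel: "p * p * b = 1 + q * q * a"
    and m0: "m > 0" and mq: "m * q \<le> N" and mp: "m * p \<le> N" and mpq: "N \<le> m * (p + q)"
    and big: "N \<ge> 4 + a * b + 2 * b + p * b + q * a"
begin

definition D where "D = N * N - a * b"
definition w1 where "w1 = N + b - m * q"
definition w2 where "w2 = N + a - m * p"
definition k0 where "k0 = D - m"
definition k1 where "k1 = 2 * D - m"

lemma b0: "b > 0" using rel by (cases b) auto

lemma N0: "N > 0" using big by linarith

lemma D_ge: "4 * N \<le> D"
proof -
  have "N * (a * b + 4) \<le> N * N" using big by (intro mult_le_mono2) linarith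
  moreover have "1 * (a * b) \<le> N * (a * b)" using N0 by (intro mult_le_mono1) linarith
  moreover have "N * (a * b + 4) = N * (a * b) + 4 * N" by (simp add: algebra_simps)
  ultimately have "a * b + 4 * N \<le> N * N" by linarith
  then show ?thesis by (simp add: D_def)
qed

lemma int_D: "int D = int N * int N - int a * int b"
proof -
  have "a * b \<le> N * N"
  proof (rule ccontr)
    assume "\<not> a * b \<le> N * N"
    then have "D = 0" by (simp add: D_def)
    then show False using D_ge N0 by simp
  qed
  then show ?thesis by (simp add: D_def of_nat_diff)
qed

lemma m_le: "m \<le> N"
proof -
  have "m * 1 \<le> m * q" using q by (intro mult_le_mono) auto
  then show ?thesis using mq by linarith
qed

lemma k0_ge: "3 * N \<le> k0" and k0_k1: "k0 < k1" and k0_D: "k0 + m = D" and k1_D: "k1 + m = 2 * D"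
  using D_ge m_le N0 by (auto simp: k0_def k1_def)

lemma w_eq: "w1 + m * q = N + b" "w2 + m * p = N + a"
  using mq mp by (auto simp: w1_def w2_def)

lemma w1_bounds: "b \<le> w1" "w1 \<le> N + b"
  using mq by (auto simp: w1_def)

lemma w1_less: "2 * w1 < q * k0" "w1 + N < k0 * q" "w1 + b < k0 * q"
proof -
  have "1 * k0 \<le> q * k0" using q by (intro mult_le_mono) auto
  then have "3 * N \<le> q * k0" using k0_ge by linarith
  moreover have "2 * b < N" using big by linarith
  ultimately show "2 * w1 < q * k0" "w1 + N < k0 * q" "w1 + b < k0 * q"
    using w1_bounds by (auto simp: mult.commute)
qed

text \<open>Adding \<open>m (q, p)\<close> turns the hypotheses into
  \<open>\<kappa> (q, p) = S (N, a) + S' (b, N)\<close>. Cramer's rule expresses \<open>S D\<close>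
  and \<open>S' D\<close> through \<open>\<kappa>\<close>, and \<open>rel\<close> combines them to
  \<open>\<kappa> = D (q S' - p S)\<close>. As \<open>k + m\<close> is positive and below
  \<open>2 D\<close>, it equals \<open>D\<close>.\<close>

lemma resonant_weight:
  assumes k: "k < k1" and e: "k * q = w1 + (s * N + t * b)" "k * p = w2 + (s * a + t * N)"
  shows "k = k0"
proof -
  define \<kappa> S S' where "\<kappa> = int (k + m)" and "S = int (Suc s)" and "S' = int (Suc t)"
  have "(k + m) * q = Suc s * N + Suc t * b" using e(1) w_eq(1) by (simp add: algebra_simps)
  then have 1: "\<kappa> * int q = S * int N + S' * int b" unfolding \<kappa>_def S_def S'_def
      by (metis of_nat_add of_nat_mult)
  have "(k + m) * p = Suc s * a + Suc t * N" using e(2) w_eq(2) by (simp add: algebra_simps)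
  then have 2: "\<kappa> * int p = S * int a + S' * int N" unfolding \<kappa>_def S_def S'_def
      by (metis of_nat_add of_nat_mult)
  have r: "int p * int p * int b = 1 + int q * int q * int a" using rel
      by (metis of_nat_1 of_nat_add of_nat_mult)
  have "int N * (\<kappa> * int q) - int b * (\<kappa> * int p) = S * int D"
    unfolding 1 2 int_D by (simp add: algebra_simps)
  moreover have "int N * (\<kappa> * int p) - int a * (\<kappa> * int q) = S' * int D"
    unfolding 1 2 int_D by (simp add: algebra_simps)
  ultimately have "int q * (S' * int D) - int p * (S * int D)
      = int q * (int N * (\<kappa> * int p) - int a * (\<kappa> * int q)) - int p * (int N * (\<kappa> * int q) - int b
          * (\<kappa> * int p))"
    by simp
  also have "\<dots> = \<kappa> * (int p * int p * int b - int q * int q * int a)" by (simp add: algebra_simps)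
  also have "\<dots> = \<kappa>" by (simp add: r)
  finally have "\<kappa> = int D * (int q * S' - int p * S)" by (simp add: algebra_simps)
  then have "int D dvd int (k + m)" unfolding \<kappa>_def by (rule dvdI)
  then have "D dvd k + m" by (simp only: int_dvd_int_iff)
  then obtain j where j: "k + m = D * j" by (rule dvdE)
  have "k + m < D * 2" using k k1_D by simp
  then have "j < 2" unfolding j by (simp add: mult_less_cancel1)
  moreover have "j \<noteq> 0" using j m0 by (cases j) auto
  ultimately have "j = 1" by simp
  then show ?thesis using j k0_D by simp
qed

text \<open>\<open>D\<close> is the determinant of the vectors \<open>(N, a)\<close> and
  \<open>(b, N)\<close>; it is nonzero, so they are linearly independent.\<close>

lemma weights_inj:
  assumes "s * N + t * b = s' * N + t' * b" "s * a + t * N = s' * a + t' * N"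
  shows "s' = s \<and> t' = t"
proof -
  have 1: "(int s - int s') * int N = (int t' - int t) * int b"
    using arg_cong[OF assms(1), of int] by (simp add: algebra_simps)
  have 2: "(int s - int s') * int a = (int t' - int t) * int N"
    using arg_cong[OF assms(2), of int] by (simp add: algebra_simps)
  have "(int s - int s') * int D = ((int s - int s') * int N) * int N - ((int s - int s') * int a)
      * int b"
    by (simp add: int_D algebra_simps)
  also have "\<dots> = 0" unfolding 1 2 by simp
  finally have s: "s = s'" using D_ge N0 by simp
  then show ?thesis using 2 N0 by simp
qed

lemma k1_weight:
  obtains s t where "k1 * q = w1 + (s * N + t * b)" "k1 * p = w2 + (s * a + t * N)"
proof -
  have s0: "p * b < q * N" and t0: "q * a < p * N"
  proof -
    have "1 * N \<le> q * N" "1 * N \<le> p * N" using p q by (intro mult_le_mono; simp)+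
    then show "p * b < q * N" "q * a < p * N" using big by linarith+
  qed
  \<comment> \<open>Cramer's rule for \<open>(k1 + m) (q, p) = 2 D (q, p)\<close>. One copy of each
    vector is already contained in \<open>w1\<close>, \<open>w2\<close>, hence the subtraction of
    one.\<close>
  define s t where "s = 2 * (q * N - p * b) - 1" and "t = 2 * (p * N - q * a) - 1"
  have s: "int (Suc s) = 2 * (int q * int N - int p * int b)" using s0
    by (simp add: s_def of_nat_diff)
  have t: "int (Suc t) = 2 * (int p * int N - int q * int a)" using t0
    by (simp add: t_def of_nat_diff)
  have "int ((k1 + m) * q) = int (Suc s * N + Suc t * b)"
    unfolding k1_D of_nat_mult of_nat_add s t int_D by (simp add: algebra_simps)
  then have 1: "(k1 + m) * q = Suc s * N + Suc t * b" by (simp only: of_nat_eq_iff)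
  have "int ((k1 + m) * p) = int (Suc s * a + Suc t * N)"
    unfolding k1_D of_nat_mult of_nat_add s t int_D by (simp add: algebra_simps)
  then have 2: "(k1 + m) * p = Suc s * a + Suc t * N" by (simp only: of_nat_eq_iff)
  show ?thesis
    by (rule that[of s t]) (use 1 2 w_eq in \<open>simp_all add: algebra_simps\<close>)
qed

end

locale witness = witness_numbers p q a b N m for p q a b N m +
  fixes lam :: "'a::field_char_0"
  assumes lam: "lam = - 2 / of_nat k0"

sublocale witness \<subseteq> darboux p q N a b N lam
  by unfold_locales (use p q N0 b0 in auto)

context witness
begin

lemma k0_pos: "k0 > 0" using k0_ge N0 by simp

lemma euler_x_g: "euler_x g = of_nat N * monomial N a + of_nat b * monomial b N"
  by (simp add: g_def euler_add euler_monomial)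

lemma F_support: "F \<mu> $ i $ j \<noteq> 0 \<Longrightarrow> \<exists>s t. i = s * N + t * b \<and> j = s * a + t * N"
  unfolding F_def g_def by (erule binomial_power_support) blast

lemma F_euler_x_g_support:
  assumes "(F \<mu> * euler_x g) $ i $ j \<noteq> 0"
  shows "\<exists>s t. i = s * N + t * b \<and> j = s * a + t * N"
proof -
  have "(F \<mu> * euler_x g) $ i $ j = of_nat N * (monomial N a * F \<mu>) $ i $ j + of_nat b * (monomial
      b N * F \<mu>) $ i $ j"
    by (simp add: euler_x_g algebra_simps)
  then consider "(monomial N a * F \<mu>) $ i $ j \<noteq> 0" | "(monomial b N * F \<mu>) $ i $ j \<noteq> 0"
    using assms by fastforce
  then show ?thesis
  proof cases
    case 1
    then have c: "N \<le> i" "a \<le> j" "F \<mu> $ (i - N) $ (j - a) \<noteq> 0"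
        by (auto simp: monomial_mult_nth split: if_splits)
    then obtain s t where "i - N = s * N + t * b" "j - a = s * a + t * N" using F_support by blast
    then have "i = Suc s * N + t * b" "j = Suc s * a + t * N" using c by auto
    then show ?thesis by blast
  next
    case 2
    then have c: "b \<le> i" "N \<le> j" "F \<mu> $ (i - b) $ (j - N) \<noteq> 0"
        by (auto simp: monomial_mult_nth split: if_splits)
    then obtain s t where "i - b = s * N + t * b" "j - N = s * a + t * N" using F_support by blast
    then have "i = s * N + Suc t * b" "j = s * a + Suc t * N" using c by auto
    then show ?thesis by blast
  qed
qed

lemma lam_k0: "- lam * of_nat k0 = 2" using k0_pos by (simp add: lam)

text \<open>The supports leave only \<open>k0\<close>, where the two powers of \<open>f\<close> that
  occur are \<open>f\<close> and \<open>1\<close>. The products are then polynomials whose exponents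
  of \<open>x\<close> are too small for the one required.\<close>

lemma melnikov_zero:
  assumes k: "k < k1" shows "melnikov w1 w2 k = 0"
proof (rule ccontr)
  assume nz: "melnikov w1 w2 k \<noteq> 0"
  define \<mu> where "\<mu> = - lam * of_nat k - 1"
  define i j where "i = k * q - w1" and "j = k * p - w2"
  have \<mu>': "- lam * of_nat k - 2 = \<mu> - 1" by (simp add: \<mu>_def)
  have c: "w1 \<le> k * q" "w2 \<le> k * p" and "of_nat q * F \<mu> $ i $ j + lam * (F (\<mu> - 1) * euler_x g) $
      i $ j \<noteq> 0"
    using nz unfolding melnikov_def monomial_mult_nth \<mu>' \<mu>_def[symmetric] i_def j_def
        by (auto split: if_splits)
  then have ij: "F \<mu> $ i $ j \<noteq> 0 \<or> (F (\<mu> - 1) * euler_x g) $ i $ j \<noteq> 0" by auto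
  then obtain s t where "i = s * N + t * b" "j = s * a + t * N"
    using F_support F_euler_x_g_support by meson
  then have "k * q = w1 + (s * N + t * b)" "k * p = w2 + (s * a + t * N)"
    using c by (auto simp: i_def j_def)
  then have k0: "k = k0" using resonant_weight[OF k] by blast
  have "- lam * of_nat k = 2" unfolding k0 by (rule lam_k0)
  then have \<mu>: "\<mu> = 1" by (simp add: \<mu>_def)
  have "N < i" "b < i" using w1_less by (auto simp: i_def k0)
  then have "F 1 $ i $ j = 0" "(F 0 * euler_x g) $ i $ j = 0"
    by (auto simp: F_1 F_0 euler_x_g) (auto simp: g_def one_eq_monomial monomial_nth)
  then show False using ij by (simp add: \<mu>)
qed

lemma gbinomial_nonzero:
  assumes "\<And>i. \<mu> \<noteq> of_nat i" shows "(\<mu> :: 'a) gchoose n \<noteq> 0"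
  using assms by (simp add: gbinomial_prod_rev)

text \<open>Multiplication by \<open>\<mu>\<close> lets the Euler derivative of
  \<open>F \<mu>\<close> merge both terms into a scalar times one coefficient of
  \<open>F \<mu>\<close>. That coefficient is nonzero because \<open>\<mu>\<close> is not a natural
  number.\<close>

lemma melnikov_nonzero: "melnikov w1 w2 k1 \<noteq> 0"
proof -
  define \<mu> where "\<mu> = - lam * of_nat k1 - 1"
  obtain s t where st: "k1 * q = w1 + (s * N + t * b)" "k1 * p = w2 + (s * a + t * N)"
    by (rule k1_weight)
  define i j where "i = s * N + t * b" and "j = s * a + t * N"
  have lk: "lam * of_nat k0 = - 2" using k0_pos by (simp add: lam)
  have \<mu>k: "\<mu> * of_nat k0 = 2 * of_nat k1 - of_nat k0"
  proof -
    have "\<mu> * of_nat k0 = - (lam * of_nat k0) * of_nat k1 - of_nat k0"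
        by (simp add: \<mu>_def algebra_simps)
    then show ?thesis unfolding lk by simp
  qed
  \<comment> \<open>If \<open>\<mu>\<close> were a natural number, \<open>k0\<close> would divide
    \<open>2 * k1 = 4 * k0 + 2 * m\<close>, hence \<open>2 * m\<close>, which is positive and
    smaller than \<open>k0\<close>.\<close>
  have \<mu>_nat: "\<mu> \<noteq> of_nat l" for l
  proof
    assume "\<mu> = of_nat l"
    then have "of_nat (Suc l * k0) = (of_nat (2 * k1) :: 'a)" using \<mu>k by (simp add: algebra_simps)
    then have e: "Suc l * k0 = 2 * k1" by (simp only: of_nat_eq_iff)
    have "2 * k1 = 4 * k0 + 2 * m" using k0_D k1_D by simp
    then have "k0 dvd 4 * k0 + 2 * m" using e by (metis dvd_triv_right)
    then have "k0 dvd 2 * m" using dvd_add_right_iff[of k0 "4 * k0" "2 * m"] by simp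
    then have "k0 \<le> 2 * m" using m0 by (intro dvd_imp_le) auto
    then show False using k0_ge m_le N0 by simp
  qed
  have F: "F \<mu> $ i $ j \<noteq> 0"
  proof -
    have "F \<mu> $ i $ j = (\<mu> gchoose (s + t)) * of_nat (s + t choose s)"
      unfolding F_def g_def i_def j_def
      by (rule binomial_power_coeff) (use weights_inj N0 b0 in blast)+
    moreover have "s + t choose s > 0" by (intro zero_less_binomial) simp
    ultimately show ?thesis using gbinomial_nonzero[OF \<mu>_nat] by simp
  qed
  have "\<mu> * (F (\<mu> - 1) * euler_x g) $ i $ j = euler_x (F \<mu>) $ i $ j" by (simp add: euler_F)
  also have "\<dots> = of_nat i * F \<mu> $ i $ j" by (simp only: euler_x_nth)
  finally have th: "\<mu> * (F (\<mu> - 1) * euler_x g) $ i $ j = of_nat i * F \<mu> $ i $ j" .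
  have \<mu>': "- lam * of_nat k1 - 2 = \<mu> - 1" by (simp add: \<mu>_def)
  have "melnikov w1 w2 k1 = of_nat q * F \<mu> $ i $ j + lam * (F (\<mu> - 1) * euler_x g) $ i $ j"
    unfolding melnikov_def monomial_mult_nth \<mu>' \<mu>_def[symmetric] st i_def j_def by simp
  then have "\<mu> * melnikov w1 w2 k1 = of_nat q * \<mu> * F \<mu> $ i $ j + lam * (\<mu> * (F (\<mu> - 1) * euler_x
      g) $ i $ j)"
    by (simp add: algebra_simps)
  also have "\<dots> = (of_nat q * \<mu> + lam * of_nat i) * F \<mu> $ i $ j" unfolding th
      by (simp add: algebra_simps)
  finally have M: "\<mu> * melnikov w1 w2 k1 = (of_nat q * \<mu> + lam * of_nat i) * F \<mu> $ i $ j" .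
  have "of_nat q * \<mu> + lam * of_nat i \<noteq> 0"
  proof
    assume z: "of_nat q * \<mu> + lam * of_nat i = 0"
    have i: "of_nat i = (of_nat k1 * of_nat q - of_nat w1 :: 'a)"
      using arg_cong[OF st(1), of "of_nat :: nat \<Rightarrow> 'a"] by (simp add: i_def)
    \<comment> \<open>\<open>k1\<close> drops out of the scalar. Multiplied by \<open>k0\<close>,
      its vanishing would mean \<open>q * k0 = 2 * w1\<close>, which the size of \<open>k0\<close>
      excludes.\<close>
    have eq: "of_nat q * \<mu> + lam * of_nat i = - (of_nat q + lam * of_nat w1)"
      unfolding i \<mu>_def by (simp add: algebra_simps)
    then have "of_nat q + lam * of_nat w1 = 0"
      using trans[OF eq[symmetric] z] by (simp only: neg_equal_0_iff_equal)
    moreover have "of_nat k0 * of_nat q + (lam * of_nat k0) * of_nat w1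
        = of_nat k0 * (of_nat q + lam * of_nat w1)"
      by (simp add: algebra_simps)
    ultimately have "of_nat k0 * of_nat q + (lam * of_nat k0) * of_nat w1 = 0" by simp
    then have "of_nat (q * k0) = (of_nat (2 * w1) :: 'a)" unfolding lk by (simp add: algebra_simps)
    then have "q * k0 = 2 * w1" by (simp only: of_nat_eq_iff)
    then show False using w1_less(1) by simp
  qed
  then have "\<mu> * melnikov w1 w2 k1 \<noteq> 0" unfolding M using F by simp
  then show ?thesis by simp
qed

end

section \<open>The lower bound\<close>

text \<open>The coefficients of \<open>\<epsilon>\<^sup>0\<close> and \<open>\<epsilon>\<^sup>1\<close>: the dual numbers are modelled by power series in
  \<open>\<epsilon>\<close> of which only these two coefficients are looked at.\<close>

definition \<epsilon>0 :: "'a::comm_ring_1 fps fps fps \<Rightarrow> 'a fps fps" where "\<epsilon>0 = map_series2 (\<lambda>c. c $ 0)"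
definition \<epsilon>1 :: "'a::comm_ring_1 fps fps fps \<Rightarrow> 'a fps fps" where "\<epsilon>1 = map_series2 (\<lambda>c. c $ 1)"

lemma is_ring_hom_nth_0: "is_ring_hom (\<lambda>c :: 'a::comm_ring_1 fps. c $ 0)"
  by (simp add: is_ring_hom_def)

lemma homo_\<epsilon>0: "is_ring_hom \<epsilon>0"
  unfolding \<epsilon>0_def by (rule is_ring_hom_map_series2[OF is_ring_hom_nth_0])

lemma \<epsilon>1_add: "\<epsilon>1 (F + G) = \<epsilon>1 F + \<epsilon>1 G"
  by (rule fps2_ext) (simp add: \<epsilon>1_def)

lemma \<epsilon>1_mult: "\<epsilon>1 (F * G) = \<epsilon>1 F * \<epsilon>0 G + \<epsilon>0 F * \<epsilon>1 G"
  by (rule fps2_ext) (simp add: \<epsilon>0_def \<epsilon>1_def fps2_mult_nth fps_sum_nth fps_mult_nth_1 sum.distrib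
      add.commute)

lemma \<epsilon>1_deriv: "\<epsilon>1 (deriv_x F) = deriv_x (\<epsilon>1 F)" "\<epsilon>1 (deriv_y F) = deriv_y (\<epsilon>1 F)"
  by (rule fps2_ext; simp only: \<epsilon>1_def map_series2_nth deriv_x_nth deriv_y_nth of_nat_fps_mult_nth)+

lemma \<epsilon>1_flow: "\<epsilon>1 (flow F G Z) = flow (\<epsilon>0 F) (\<epsilon>0 G) (\<epsilon>1 Z) + flow (\<epsilon>1 F) (\<epsilon>1 G) (\<epsilon>0 Z)"
  by (simp add: flow_def \<epsilon>1_add \<epsilon>1_mult \<epsilon>1_deriv \<epsilon>0_def map_series2_deriv[OF is_ring_hom_nth_0]
      algebra_simps)

lemma \<epsilon>0_flow: "\<epsilon>0 (flow F G Z) = flow (\<epsilon>0 F) (\<epsilon>0 G) (\<epsilon>0 Z)"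
  by (simp add: flow_def is_ring_hom_simps[OF homo_\<epsilon>0]) (simp add: \<epsilon>0_def map_series2_deriv[OF
      is_ring_hom_nth_0])

lemma \<epsilon>1_of_nat_mult: "\<epsilon>1 (of_nat n * F) = of_nat n * \<epsilon>1 F"
  by (rule fps2_ext) (simp add: \<epsilon>1_def)

lemma \<epsilon>0_resonant_sum: "\<epsilon>0 (resonant_sum c Z) = resonant_sum (\<lambda>k. c k $ 0) (\<epsilon>0 Z)"
  unfolding \<epsilon>0_def by (rule map_series2_resonant_sum[OF is_ring_hom_nth_0])

text \<open>The product rule in \<epsilon> also produces first-order parts of the powers of
  \<open>Z\<close>, but these are multiplied by the vanishing constant coefficients.\<close>

lemma \<epsilon>1_resonant_sum:
  assumes "\<And>k. k \<ge> 1 \<Longrightarrow> c k $ 0 = 0"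
  shows "\<epsilon>1 (resonant_sum c Z) = resonant_sum (\<lambda>k. c k $ 1) (\<epsilon>0 Z)"
proof (rule fps2_ext)
  fix i j
  have "\<epsilon>1 (resonant_sum c Z) $ i $ j = (\<Sum>k = 1..i + j. (c k * (Z ^ k) $ i $ j) $ 1)"
    by (simp add: \<epsilon>1_def resonant_sum_nth fps_sum_nth)
  also have "\<dots> = (\<Sum>k = 1..i + j. c k $ 1 * (\<epsilon>0 Z ^ k) $ i $ j)"
  proof (intro sum.cong refl)
    fix k assume "k \<in> {1..i + j}"
    moreover have "(Z ^ k) $ i $ j $ 0 = (\<epsilon>0 Z ^ k) $ i $ j"
      unfolding is_ring_hom_simps(8)[OF homo_\<epsilon>0, symmetric] by (simp add: \<epsilon>0_def)
    ultimately show "(c k * (Z ^ k) $ i $ j) $ 1 = c k $ 1 * (\<epsilon>0 Z ^ k) $ i $ j"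
      using assms[of k] by (simp add: fps_mult_nth_1)
  qed
  finally show "\<epsilon>1 (resonant_sum c Z) $ i $ j = resonant_sum (\<lambda>k. c k $ 1) (\<epsilon>0 Z) $ i $ j"
    by (simp only: resonant_sum_nth)
qed

section \<open>The perturbed field as a specialization of the general system\<close>

context witness
begin

text \<open>A degree bound for the Darboux field and, thanks to \<open>mpq\<close>, for the
  perturbing monomial.\<close>

definition n where "n = N + a + b + 1"

lemma V1_nth: "(V1 - of_nat p * var_x) $ i $ j \<noteq> 0 \<Longrightarrow> i + j \<le> n"
  and V2_nth: "(V2 + of_nat q * var_y) $ i $ j \<noteq> 0 \<Longrightarrow> i + j \<le> n"
proof -
  have "V1 - of_nat p * var_x = monomial 1 0 * (of_nat p * g + const2 lam * euler_y g)"
    by (simp add: V1_def F_1 var_x_eq algebra_simps)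
  then have "(V1 - of_nat p * var_x) $ i $ j = (if 1 \<le> i then of_nat p * g $ (i - 1) $ j + lam *
      (of_nat j * g $ (i - 1) $ j) else 0)"
    by (simp add: monomial_mult_nth euler_y_nth)
  then show "(V1 - of_nat p * var_x) $ i $ j \<noteq> 0 \<Longrightarrow> i + j \<le> n"
    by (auto simp: g_def monomial_nth n_def split: if_splits)
  have "V2 + of_nat q * var_y = - (monomial 0 1 * (of_nat q * g + const2 lam * euler_x g))"
    by (simp add: V2_def F_1 var_y_eq algebra_simps)
  then have "(V2 + of_nat q * var_y) $ i $ j = - (if 1 \<le> j then of_nat q * g $ i $ (j - 1) + lam *
      (of_nat i * g $ i $ (j - 1)) else 0)"
    by (simp only: fps_neg_nth monomial_mult_nth) (simp add: euler_x_nth)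
  then show "(V2 + of_nat q * var_y) $ i $ j \<noteq> 0 \<Longrightarrow> i + j \<le> n"
    by (auto simp: g_def monomial_nth n_def split: if_splits)
qed

text \<open>\<open>fps_X\<close> stands for \<epsilon>; the perturbation is \<open>x\<^sup>w\<close>
  times \<open>x\<close> in the first component.\<close>

definition witness_coeff :: "coeff_var \<Rightarrow> 'a fps" where
  "witness_coeff v = (case v of
     CoeffP i j \<Rightarrow> fps_const ((V1 - of_nat p * var_x) $ i $ j) + (if i = w1 + 1 \<and> j
         = w2 then fps_X else 0)
   | CoeffQ i j \<Rightarrow> fps_const ((V2 + of_nat q * var_y) $ i $ j))"

definition h :: "'a coeff_poly \<Rightarrow> 'a fps" where "h = eval_poly fps_const witness_coeff"

lemma is_ring_hom_h: "is_ring_hom h"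
  unfolding h_def by (rule is_ring_hom_eval_poly[OF is_ring_hom_fps_const])

lemma h_P_nth: "h (general_P n $ i $ j) =
    fps_const ((V1 - of_nat p * var_x) $ i $ j) + (if i = w1 + 1 \<and> j = w2 then fps_X else 0)"
proof (cases "2 \<le> i + j \<and> i + j \<le> n")
  case True
  then show ?thesis by (simp add: general_P_def h_def eval_poly_indet[OF is_ring_hom_fps_const]
      witness_coeff_def)
next
  case False
  \<comment> \<open>The perturbing monomial has degree between \<open>2\<close> and
    \<open>n\<close>, so the truncation in \<open>general_P\<close> loses nothing of the perturbed
    field.\<close>
  have "2 \<le> (w1 + 1) + w2" using w1_bounds b0 by simp
  moreover have "(w1 + 1) + w2 \<le> n" using w_eq mpq by (simp add: n_def algebra_simps)
  moreover have "(V1 - of_nat p * var_x) $ i $ j = 0"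
    using False vanishes_belowD[OF vanishes_below_V(1), of i j] V1_nth[of i j] by linarith
  ultimately show ?thesis using False by (auto simp: general_P_def is_ring_hom_simps[OF
      is_ring_hom_h])
qed

lemma h_Q_nth: "h (general_Q n $ i $ j) = fps_const ((V2 + of_nat q * var_y) $ i $ j)"
proof (cases "2 \<le> i + j \<and> i + j \<le> n")
  case True
  then show ?thesis by (simp add: general_Q_def h_def eval_poly_indet[OF is_ring_hom_fps_const]
      witness_coeff_def)
next
  case False
  then have "(V2 + of_nat q * var_y) $ i $ j = 0"
    using vanishes_belowD[OF vanishes_below_V(2), of i j] V2_nth[of i j] by linarith
  then show ?thesis using False by (auto simp: general_Q_def is_ring_hom_simps[OF is_ring_hom_h])
qed

text \<open>The derivative of \<open>Z\<close> along the perturbed field is \<open>p q Z\<close>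
  times the series in \<open>Z\<close> with the saddle values as coefficients. The functionals
  \<open>T\<close> read this identity at order zero, where all values vanish, and at order one,
  where the first nonzero value is a Melnikov coefficient.\<close>

lemma saddle_value_witness_coeff:
  assumes cop: "coprime p q"
  shows "1 \<le> k \<Longrightarrow> k < k1 \<Longrightarrow> h (saddle_value p q n k) $ 0 = 0 \<and> h (saddle_value p q n k) $ 1 = 0"
    and "h (saddle_value p q n k1) $ 1 \<noteq> 0"
proof -
  let ?P = "map_series2 h (general_P n)" and ?Q = "map_series2 h (general_Q n)"
  define FF where "FF = of_nat p * var_x + ?P"
  define GG where "GG = - of_nat q * var_y + ?Q"
  have FF0: "\<epsilon>0 FF = V1" and FF1: "\<epsilon>1 FF = monomial (w1 + 1) w2"
    by (rule fps2_ext; simp add: FF_def \<epsilon>0_def \<epsilon>1_def h_P_nth var_x_eq monomial_nth)+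
  have GG0: "\<epsilon>0 GG = V2" and GG1: "\<epsilon>1 GG = 0"
    by (rule fps2_ext; simp add: GG_def \<epsilon>0_def \<epsilon>1_def h_Q_nth var_y_eq monomial_nth)+
  interpret R: resonant_saddle p q ?P ?Q
  proof
    show "\<exists>c::'a fps. of_int l * c = 1" if "l \<noteq> 0" for l
      by (rule exI[of _ "fps_const (inverse (of_int l))"]) (use that in \<open>simp flip: fps_of_int\<close>)
  qed (use p q cop in \<open>auto simp: vanishes_below_def general_P_def general_Q_def
      is_ring_hom_simps[OF is_ring_hom_h]\<close>)
  obtain \<phi> \<psi> \<pi>1 \<pi>2 where nrm: "normalizes p q ?P ?Q \<phi> \<psi> \<pi>1 \<pi>2"
    and L: "\<And>k. k \<ge> 1 \<Longrightarrow> h (saddle_value p q n k) = \<pi>1 k - \<pi>2 k"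
    using saddle_value_eval[OF p q cop is_ring_hom_h] by blast
  define l where "l k = \<pi>1 k - \<pi>2 k" for k
  define Z where "Z = R.Z \<phi> \<psi>"
  have admissible: "R.admissible \<phi> \<psi>" using nrm by (simp add: R.normalizes_iff)
  have lead: "vanishes_below (Suc (p + q)) (Z - monomial q p)" unfolding Z_def
      by (rule R.vanishes_below_Z[OF admissible])
  have "flow FF GG Z = of_nat (p * q) * Z * (resonant_sum \<pi>1 Z - resonant_sum \<pi>2 Z)"
    unfolding Z_def R.Z_def
    by (rule flow_Z) (use nrm p q in \<open>auto simp: normalizes_def Let_def flow_def FF_def GG_def
        R.X_def R.Y_def\<close>)
  then have Z: "flow FF GG Z = of_nat (p * q) * (Z * resonant_sum l Z)"
    unfolding resonant_sum_diff l_def by (simp only: mult.assoc)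
  define Z0 where "Z0 = \<epsilon>0 Z"
  have Z0_lead: "vanishes_below (Suc (p + q)) (Z0 - monomial q p)"
  proof -
    have "Z0 - monomial q p = \<epsilon>0 (Z - monomial q p)"
      by (simp add: Z0_def is_ring_hom_simps[OF homo_\<epsilon>0]) (simp add: \<epsilon>0_def
          map_series2_monomial[OF is_ring_hom_nth_0])
    then show ?thesis using lead by (simp add: \<epsilon>0_def vanishes_below_def)
  qed
  have Tm: "T k (of_nat c * G) = of_nat c * T k G" for k c G by (simp add: T_def mult.assoc)
  have pq: "of_nat (p * q) \<noteq> (0 :: 'a)" using p q by (simp only: of_nat_eq_0_iff) simp
  have order0: "flow V1 V2 Z0 = of_nat (p * q) * (Z0 * resonant_sum (\<lambda>k. l k $ 0) Z0)"
    using arg_cong[OF Z, of \<epsilon>0]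
    by (simp only: \<epsilon>0_flow FF0 GG0 is_ring_hom_simps[OF homo_\<epsilon>0] \<epsilon>0_resonant_sum Z0_def)
  \<comment> \<open>\<open>T (Suc k)\<close> annihilates the left side of \<open>order0\<close> and,
    once the earlier coefficients vanish, picks the \<open>k\<close>-th one on the right.\<close>
  have l0: "l k $ 0 = 0" if "k \<ge> 1" for k
    using that
  proof (induction k rule: less_induct)
    case (less k)
    have "0 = T (Suc k) (flow V1 V2 Z0)" by (rule T_flow[symmetric]) simp
    also have "\<dots> = of_nat (p * q) * l k $ 0"
      unfolding order0 Tm by (subst T_resonant[OF Z0_lead less.prems]) (use less.IH in auto)
    finally show ?case using pq by (metis mult_eq_0_iff)
  qed
  have rs0: "resonant_sum (\<lambda>k. l k $ 0) Z0 = 0"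
    by (rule fps2_ext) (simp add: resonant_sum_nth l0)
  \<comment> \<open>Hence \<open>Z0\<close> is a first integral of the unperturbed field, as
    \<open>T_perturbation\<close> requires.\<close>
  have fi: "flow V1 V2 Z0 = 0" using order0 by (simp only: rs0 mult_zero_right)
  have r0: "\<epsilon>0 (resonant_sum l Z) = 0" using rs0 by (simp only: \<epsilon>0_resonant_sum Z0_def)
  \<comment> \<open>The part linear in \<epsilon>. Since the resonant sum vanishes at order zero,
    the first-order part of \<open>Z\<close> appears only inside the unperturbed flow, which
    \<open>T\<close> kills.\<close>
  have e: "flow V1 V2 (\<epsilon>1 Z) + monomial w1 w2 * euler_x Z0
      = of_nat (p * q) * (Z0 * resonant_sum (\<lambda>k. l k $ 1) Z0)"
  proof -
    have "monomial (w1 + 1) w2 = monomial w1 w2 * (monomial 1 0 :: 'a fps fps)"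
        by (simp only: monomial_mult_monomial add_0_right)
    then have fl: "flow (monomial (w1 + 1) w2) 0 Z0 = monomial w1 w2 * euler_x Z0"
      by (simp add: flow_def euler_x_def var_x_eq algebra_simps)
    have e: "\<epsilon>1 (Z * resonant_sum l Z) = Z0 * resonant_sum (\<lambda>k. l k $ 1) Z0"
      by (simp only: \<epsilon>1_mult r0 \<epsilon>1_resonant_sum[OF l0] mult_zero_right add_0_left Z0_def)
    show ?thesis
      using arg_cong[OF Z, of \<epsilon>1]
      unfolding \<epsilon>1_of_nat_mult e \<epsilon>1_flow FF0 GG0 FF1 GG1 Z0_def[symmetric] fl .
  qed
  have order1: "T (Suc k) (monomial w1 w2 * euler_x Z0)
      = of_nat (p * q) * T (Suc k) (Z0 * resonant_sum (\<lambda>k. l k $ 1) Z0)" for k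
  proof -
    have "T (Suc k) (flow V1 V2 (\<epsilon>1 Z)) = 0" by (rule T_flow) simp
    then show ?thesis using arg_cong[OF e, of "T (Suc k)"] by (simp only: T_add Tm add_0_left)
  qed
  have m: "melnikov w1 w2 k = of_nat (p * q) * l k $ 1" if k: "1 \<le> k" "k \<le> k1"
      and z: "\<And>j. 1 \<le> j \<Longrightarrow> j < k \<Longrightarrow> l j $ 1 = 0" for k
    using order1[of k] T_perturbation[OF cop fi Z0_lead melnikov_zero k(2)] T_resonant[OF Z0_lead
        k(1), of "\<lambda>k. l k $ 1"] z by simp
  have l1: "l k $ 1 = 0" if "1 \<le> k" "k < k1" for k
    using that
  proof (induction k rule: less_induct)
    case (less k)
    have "of_nat (p * q) * l k $ 1 = 0" using m[of k] less melnikov_zero[of k] by simp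
    then show ?case using pq by (metis mult_eq_0_iff)
  qed
  have k1: "1 \<le> k1" using k0_k1 by simp
  have "melnikov w1 w2 k1 = of_nat (p * q) * l k1 $ 1" using m[OF k1 order_refl] l1 by simp
  then have "l k1 $ 1 \<noteq> 0" using melnikov_nonzero by auto
  then show "h (saddle_value p q n k1) $ 1 \<noteq> 0" using L[OF k1]
      by (simp only: l_def not_False_eq_True simp_thms)
  show "1 \<le> k \<Longrightarrow> k < k1 \<Longrightarrow> h (saddle_value p q n k) $ 0 = 0 \<and> h (saddle_value p q n k) $ 1 = 0"
    using L[of k] l0[of k] l1[of k] unfolding l_def by simp
qed

text \<open>The polynomials whose image under \<open>h\<close> is divisible by
  \<open>\<epsilon>\<^sup>2\<close> form an ideal. It contains the saddle values before the
  \<open>k1\<close>-th, but not that one.\<close>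

lemma M_I_ge_k1:
  assumes cop: "coprime p q" shows "k1 \<le> M_I TYPE('a) p q n"
proof (rule M_I_ge[OF p q cop])
  show "1 \<le> k1" using k0_k1 by simp
  fix M assume M: "M < k1"
  show "(saddle_value p q n k1 :: 'a coeff_poly) \<notin> span_ideal (poly_in (coeff_vars n))
      (saddle_value p q n ` {1..M})"
  proof
    assume "(saddle_value p q n k1 :: 'a coeff_poly) \<in> span_ideal (poly_in (coeff_vars n))
        (saddle_value p q n ` {1..M})"
    then have "h (saddle_value p q n k1) $ 0 = 0 \<and> h (saddle_value p q n k1) $ 1 = 0"
    proof induction
      case zero
      then show ?case by (simp add: is_ring_hom_simps[OF is_ring_hom_h])
    next
      case (step r s x)
      then have "h s $ 0 = 0 \<and> h s $ 1 = 0" using saddle_value_witness_coeff(1)[OF cop] M by auto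
      then show ?case using step.IH by (simp add: is_ring_hom_simps[OF is_ring_hom_h]
          fps_mult_nth_1)
    qed
    then show False using saddle_value_witness_coeff(2)[OF cop] by simp
  qed
qed

end

lemma M_I_lower_bound:
  fixes p q :: nat
  assumes p: "1 \<le> p" and pq: "p \<le> q" and cop: "coprime p q"
  obtains c n0 where "\<And>n. n \<ge> n0 \<Longrightarrow> n \<ge> c \<Longrightarrow> 2 * (n - c) ^ 2 \<le> M_I TYPE('a::field_char_0) p q n + n
      + c * c"
proof -
  have q: "1 \<le> q" using p pq by simp
  \<comment> \<open>Bezout for the squares, with the sign for which \<open>a\<close> and
    \<open>b\<close> are natural numbers satisfying \<open>rel\<close>.\<close>
  have "coprime (p * p) (q * q)" using cop by simp
  then obtain b a where rel: "p * p * b = q * q * a + 1"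
    using bezout_nat[of "p * p" "q * q"] p by (auto simp: coprime_iff_gcd_eq_1)
  define c where "c = a + b + 1"
  define n0 where "n0 = c + 4 + a * b + 2 * b + p * b + q * a + q * q"
  show ?thesis
  proof (rule that[of n0 c])
    fix n assume n: "n \<ge> n0" "n \<ge> c"
    define N where "N = n - c"
    \<comment> \<open>The largest \<open>m\<close> with \<open>m * q \<le> N\<close>;
      \<open>p \<le> q\<close> gives \<open>m * p \<le> N\<close> too. From
      \<open>N < m * q + q\<close> and \<open>q \<le> m * p\<close> follows
      \<open>N \<le> m * (p + q)\<close>; the summand \<open>q * q\<close> in \<open>n0\<close>
      ensures \<open>q \<le> m\<close>.\<close>
    define m where "m = N div q"
    have N: "N \<ge> 4 + a * b + 2 * b + p * b + q * a + q * q" using n by (simp add: N_def n0_def)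
    have mq: "m * q \<le> N" by (simp add: m_def)
    have "q * q \<le> N" using N by simp
    then have mge: "q \<le> m" unfolding m_def using q by (metis div_le_mono
        nonzero_mult_div_cancel_left not_one_le_zero)
    have lt: "N < m * q + q" unfolding m_def using q
        by (metis dividend_less_div_times less_le_trans zero_less_one add.commute)
    have "m * 1 \<le> m * p" using p by (rule mult_le_mono2)
    then have mp: "q \<le> m * p" using mge by linarith
    interpret witness_numbers p q a b N m
    proof
      show "N \<le> m * (p + q)" using lt mp by (simp add: distrib_left)
      show "m * p \<le> N" using mq pq by (meson le_trans mult_le_mono2)
    qed (use p q rel mge mq N in auto)
    interpret witness p q a b N m "- 2 / of_nat k0 :: 'a"
      by unfold_locales simp
    have nn: "n = N + a + b + 1" using n by (simp add: N_def c_def)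
    have "k1 \<le> M_I TYPE('a) p q n" using M_I_ge_k1[OF cop] by (simp add: n_def nn)
    moreover have "2 * (a * b) \<le> c * c" unfolding c_def by (simp add: algebra_simps)
    moreover have "2 * (N * N) \<le> 2 * D + 2 * (a * b)" unfolding D_def
        by (simp add: diff_mult_distrib2)
    moreover have "N \<le> n" by (simp add: N_def)
    ultimately have "2 * (N * N) \<le> M_I TYPE('a) p q n + n + c * c" using k1_D m_le by linarith
    then show "2 * (n - c) ^ 2 \<le> M_I TYPE('a) p q n + n + c * c"
        by (simp add: N_def power2_eq_square)
  qed
qed

text \<open>One argument serves both constants and both ground fields: the shift by \<open>c\<close>
  and the subtraction of \<open>m\<close> cost only linear terms, apart from a constant.\<close>

lemma M_I_asymptotics:
  fixes p q :: nat
  assumes "1 \<le> p" and "p \<le> q" and "coprime p q" and C: "C \<le> 2"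
  shows "\<exists>g :: nat \<Rightarrow> real. g \<in> O(\<lambda>n. real n) \<and>
    (\<forall>\<^sub>F n in sequentially. real (M_I TYPE('a::field_char_0) p q n) \<ge> C * real n ^ 2 + g n)"
proof -
  obtain c n0 where bound: "\<And>n. n \<ge> n0 \<Longrightarrow> n \<ge> c \<Longrightarrow> 2 * (n - c) ^ 2 \<le> M_I TYPE('a) p q n + n + c * c"
    using M_I_lower_bound[OF assms(1-3), where 'a='a] by blast
  \<comment> \<open>Expanding \<open>2 (n - c)\<^sup>2\<close> gives \<open>- 4 c n\<close>, and the
    summand \<open>n\<close> in \<open>bound\<close> gives \<open>- n\<close>. The constant
    \<open>2 c\<^sup>2\<close> from the expansion covers \<open>c\<^sup>2\<close>.\<close>
  define g where "g n = - (4 * real c + 1) * real n" for n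
  have "g \<in> O(\<lambda>n. real n)" unfolding g_def by simp
  moreover have "\<forall>\<^sub>F n in sequentially. real (M_I TYPE('a) p q n) \<ge> C * real n ^ 2 + g n"
    using eventually_ge_at_top[of "max n0 c"]
  proof eventually_elim
    case (elim n)
    have "real (2 * (n - c) ^ 2) \<le> real (M_I TYPE('a) p q n + n + c * c)"
      using bound[of n] elim by (simp only: of_nat_le_iff max.bounded_iff)
    then have "2 * (real n - real c) ^ 2 \<le> real (M_I TYPE('a) p q n) + real n + real c * real c"
      using elim by (simp add: of_nat_diff)
    moreover have "2 * (real n - real c) ^ 2 = 2 * real n ^ 2 - 4 * real c * real n + 2 * (real c
        * real c)"
      by (simp add: power2_eq_square algebra_simps)
    moreover have "C * real n ^ 2 \<le> 2 * real n ^ 2" using C by (intro mult_right_mono) auto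
    moreover have "0 \<le> real c * real c" by simp
    moreover have "g n = - (4 * real c * real n) - real n" by (simp add: g_def algebra_simps)
    ultimately show ?case by linarith
  qed
  ultimately show ?thesis by blast
qed

theorem theorem4:
  fixes p q :: nat
  assumes "1 \<le> p" and "p \<le> q" and "coprime p q"
  shows
    "(\<exists>g :: nat \<Rightarrow> real. g \<in> O(\<lambda>n. real n) \<and>
        (\<forall>\<^sub>F n in sequentially. real (M_I TYPE(real) p q n) \<ge> 3 / 2 * real n ^ 2 + g n)) \<and>
     (\<exists>g :: nat \<Rightarrow> real. g \<in> O(\<lambda>n. real n) \<and>
        (\<forall>\<^sub>F n in sequentially. real (M_I TYPE(complex) p q n) \<ge> 3 / 2 * real n ^ 2 + g n)) \<and>
     (p = 1 \<longrightarrow>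
       (\<exists>g :: nat \<Rightarrow> real. g \<in> O(\<lambda>n. real n) \<and>
          (\<forall>\<^sub>F n in sequentially. real (M_I TYPE(real) p q n) \<ge> 2 * real n ^ 2 + g n)) \<and>
       (\<exists>g :: nat \<Rightarrow> real. g \<in> O(\<lambda>n. real n) \<and>
          (\<forall>\<^sub>F n in sequentially. real (M_I TYPE(complex) p q n) \<ge> 2 * real n ^ 2 + g n)))"
  by (intro conjI impI M_I_asymptotics assms) simp_all

end
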